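(* Let $(\mu_1,\dots,\mu_d)\sim\text{Vec-IFPP}(q_M,H,P_0)$, $P_j=\mu_j/\mu_j(\Theta)$, and let $(\boldsymbol\theta_1,\dots,\boldsymbol\theta_d)$, $\boldsymbol\theta_j=(\theta_{j,1},\dots,\theta_{j,n_j})$, $n_j\ge1$, be such that conditionally on $(\mu_1,\dots,\mu_d)$ the $\theta_{j,i}$ are independent with $\theta_{j,i}\sim P_j$. Let $\boldsymbol U_n=(U_1,\dots,U_d)$ be the auxiliary variables defined in the context. Let $\theta^{**}_1,\dots,\theta^{**}_K$ be the distinct values in $(\boldsymbol\theta_1,\dots,\boldsymbol\theta_d)$ and $n_{j,k}=\#\{i:\theta_{j,i}=\theta^{**}_k\}$. Then the conditional distribution of $(\mu_1,\dots,\mu_d)$ given $(\boldsymbol\theta_1,\dots,\boldsymbol\theta_d)$ and $\boldsymbol U_n=\boldsymbol u=(u_1,\dots,u_d)$ is that of the superposition of two independent processes: $$(\mu_1,\dots,\mu_d)\mid\boldsymbol\theta_1,\dots,\boldsymbol\theta_d,\boldsymbol U_n\ \stackrel{d}{=}\ \left(\mu_1^{(a)},\dots,\mu_d^{(a)}\right)+\left(\mu_1^{(na)},\dots,\mu_d^{(na)}\right),$$ where: (i) the process of allocated components is $\mu_j^{(a)}=\sum_{k=1}^K S^{(a)}_{j,k}\delta_{\theta^{**}_k}$, $j=1,\dots,d$, where the random variables $S^{(a)}_{j,k}$, $j\in\{1,\dots,d\}$, $k\in\{1,\dots,K\}$, are independent with densities on $(0,\infty)$ $$f_{S^{(a)}_{j,k}}(s)\propto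 e^{-u_js}s^{n_{j,k}}h_j(s);$$ (ii) the process of non-allocated components $(\mu_1^{(na)},\dots,\mu_d^{(na)})$ is a $\text{Vec-IFPP}(q_M^*,H^*,P_0)$, with $H^*(\mathrm d\boldsymbol s)=H_1^*(\mathrm ds_1)\times\dots\times H^*_d(\mathrm ds_d)$ and $$H_j^*(\mathrm ds)\propto e^{-u_js}h_j(s)\,\mathrm ds,\qquad q_M^*(m)\propto q_M(m+K)\frac{(m+K)!}{m!}\prod_{j=1}^d(\psi_j(u_j))^m,\quad m=0,1,2,\dots,$$ where $\psi_j(u)=\int_0^\infty e^{-us}h_j(s)\,\mathrm ds$.
   Context: Setting. $d\ge1$ is an integer, $\Theta\subset\mathbb R^s$ is a (Borel) parameter space, $P_0$ is a diffuse (non-atomic) probability measure on $\Theta$, $q_M$ is a probability mass function on $\{1,2,3,\dots\}$, and $H=H_1\times\dots\times H_d$, where $H_j(\mathrm ds)=h_j(s)\,\mathrm ds$, $h_j(s)=h(s\mid\gamma_j)$, are probability distributions on $(0,\infty)$ with densities from a common parametric family, with parameters $\gamma_j>0$. Vec-IFPP. For a probability mass function $q$ on $\{0,1,2,\dots\}$ and a product $G=G_1\times\dots\times G_d$ of probability distributions on $(0,\infty)$, a vector of random measures $(\mu_1,\dots,\mu_d)$ on $\Theta$ is a $\text{Vec-IFPP}(q,G,P_0)$ if $\mu_j=\sum_{m=1}^{N}S_{j,m}\delta_{\tau_m}$, where $N\sim q$ and, conditionally on $N$, all $S_{j,m}$ are independent with $S_{j,m}\sim G_j$ and $\tau_1,\dots,\tau_N$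 are i.i.d. from $P_0$, independent of the $S_{j,m}$ (all $\mu_j$ are null if $N=0$). Auxiliary variables. Put $T_j=\mu_j(\Theta)$. Conditionally on $(\mu_1,\dots,\mu_d)$, the variables $U_1,\dots,U_d$ are independent of each other and of all the $\theta_{j,i}$, with $U_j\sim\text{Gamma}(n_j,T_j)$ (shape-rate parametrization). *)

theory Defs
  imports "HOL-Probability.Probability"
begin

text \<open>The finite measures on the measurable space underlying \<open>T\<close>, with the sigma-algebra generated
  by the evaluation maps; the analogue of \<^const>\<open>subprob_algebra\<close> without the mass constraint.
  Only \<open>sets T\<close> matters, so \<open>T\<close> may be any measure carrying the right sigma-algebra.\<close>

definition finite_measures :: "'a measure \<Rightarrow> 'a measure measure" where
  "finite_measures T =
     (SUP A \<in> sets T. vimage_algebra {m. finite_measure m \<and> sets m = sets T} (\<lambda>m. emeasure m A) borel)"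

definition vec_measures :: "nat \<Rightarrow> 'a measure \<Rightarrow> (nat \<Rightarrow> 'a measure) measure" where
  "vec_measures d T = (\<Pi>\<^sub>M j\<in>{1..d}. finite_measures T)"

definition dirac_sum :: "'a measure \<Rightarrow> 'i set \<Rightarrow> ('i \<Rightarrow> real) \<Rightarrow> ('i \<Rightarrow> 'a) \<Rightarrow> 'a measure" where
  "dirac_sum T I S \<tau> =
     measure_of (space T) (sets T) (\<lambda>A. \<Sum>m\<in>I. ennreal (S m) * emeasure (return T (\<tau> m)) A)"

definition superpose :: "'a measure \<Rightarrow> 'a measure \<Rightarrow> 'a measure" where
  "superpose \<mu> \<nu> = measure_of (space \<mu>) (sets \<mu>) (\<lambda>A. emeasure \<mu> A + emeasure \<nu> A)"

definition normalize_measure :: "'a measure \<Rightarrow> 'a measure" where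
  "normalize_measure \<mu> = scale_measure (inverse (emeasure \<mu> (space \<mu>))) \<mu>"

abbreviation lpos :: "real measure" where
  "lpos \<equiv> restrict_space lborel {0<..}"

definition pos_density :: "(real \<Rightarrow> real) \<Rightarrow> bool" where
  "pos_density f \<longleftrightarrow>
     f \<in> borel_measurable lpos \<and> (\<forall>s>0. 0 \<le> f s) \<and> (\<integral>\<^sup>+ s. ennreal (f s) \<partial>lpos) = 1"

text \<open>The distribution whose density with respect to \<open>M\<close> is proportional to \<open>f\<close>. If the integral
  of \<open>f\<close> is zero or does not exist, this is the null measure.\<close>

definition density_propto :: "'a measure \<Rightarrow> ('a \<Rightarrow> real) \<Rightarrow> 'a measure" where
  "density_propto M f = density M (\<lambda>s. ennreal (f s / (LINT t|M. f t)))"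

text \<open>For natural \<open>k\<close>, \<open>erlang_density k l\<close> is the Gamma density with shape \<open>k + 1\<close> and rate \<open>l\<close>.\<close>

definition gamma_dist :: "nat \<Rightarrow> real \<Rightarrow> real measure" where
  "gamma_dist n r = density lborel (\<lambda>x. ennreal (erlang_density (n - 1) r x))"

definition laplace :: "(real \<Rightarrow> real) \<Rightarrow> real \<Rightarrow> real" where
  "laplace f u = (LINT s|lpos. exp (- u * s) * f s)"

text \<open>\<open>X\<close> (with values in \<open>MX\<close>) has conditional distribution \<open>\<kappa> y\<close> given \<open>Y = y\<close> (with values in
  \<open>MY\<close>): \<open>\<kappa>\<close> agrees, for almost every \<open>y\<close> under the law of \<open>Y\<close>, with a regular conditional
  distribution \<open>K\<close>. Thus \<open>\<kappa>\<close> may be arbitrary on a null set of values of \<open>Y\<close>.\<close>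

definition cond_law ::
    "'w measure \<Rightarrow> 'x measure \<Rightarrow> ('w \<Rightarrow> 'x) \<Rightarrow> 'y measure \<Rightarrow> ('w \<Rightarrow> 'y) \<Rightarrow> ('y \<Rightarrow> 'x measure) \<Rightarrow> bool" where
  "cond_law M MX X MY Y \<kappa> \<longleftrightarrow>
     X \<in> M \<rightarrow>\<^sub>M MX \<and> Y \<in> M \<rightarrow>\<^sub>M MY \<and>
     (\<exists>K. K \<in> MY \<rightarrow>\<^sub>M prob_algebra MX \<and>
          (\<forall>A\<in>sets MX. \<forall>B\<in>sets MY.
             emeasure M {\<omega>\<in>space M. X \<omega> \<in> A \<and> Y \<omega> \<in> B}
               = (\<integral>\<^sup>+ y. emeasure (K y) A * indicator B y \<partial>distr M MY Y)) \<and>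
          (AE y in distr M MY Y. K y = \<kappa> y))"

text \<open>The law of a \<open>Vec-IFPP(q, G, P\<^sub>0)\<close>. The atoms \<open>\<tau> m\<close> are shared by the \<open>d\<close> coordinates; the
  jumps \<open>S j m\<close> are not.\<close>

definition vec_ifpp ::
    "nat \<Rightarrow> nat pmf \<Rightarrow> (nat \<Rightarrow> real measure) \<Rightarrow> 'a measure \<Rightarrow> (nat \<Rightarrow> 'a measure) measure" where
  "vec_ifpp d q G P0 =
     measure_pmf q \<bind> (\<lambda>N.
       distr ((\<Pi>\<^sub>M j\<in>{1..d}. \<Pi>\<^sub>M m\<in>{1..N}. G j) \<Otimes>\<^sub>M (\<Pi>\<^sub>M m\<in>{1..N}. P0)) (vec_measures d P0)
         (\<lambda>(S, \<tau>). \<lambda>j\<in>{1..d}. dirac_sum P0 {1..N} (S j) \<tau>))"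

definition obs_space :: "nat \<Rightarrow> (nat \<Rightarrow> nat) \<Rightarrow> 'a measure \<Rightarrow> (nat \<Rightarrow> nat \<Rightarrow> 'a) measure" where
  "obs_space d n T = (\<Pi>\<^sub>M j\<in>{1..d}. \<Pi>\<^sub>M i\<in>{1..n j}. T)"

definition aux_space :: "nat \<Rightarrow> (nat \<Rightarrow> real) measure" where
  "aux_space d = (\<Pi>\<^sub>M j\<in>{1..d}. borel)"

text \<open>Given the random measures, all observations and all auxiliary variables are independent, hence
  a product measure. If some \<open>\<mu> j\<close> is null the value is meaningless; this has probability zero
  when \<open>pmf q 0 = 0\<close>.\<close>

definition sampling_law ::
    "nat \<Rightarrow> (nat \<Rightarrow> nat) \<Rightarrow> (nat \<Rightarrow> 'a measure) \<Rightarrow> ((nat \<Rightarrow> nat \<Rightarrow> 'a) \<times> (nat \<Rightarrow> real)) measure" where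
  "sampling_law d n \<mu> =
     (\<Pi>\<^sub>M j\<in>{1..d}. \<Pi>\<^sub>M i\<in>{1..n j}. normalize_measure (\<mu> j)) \<Otimes>\<^sub>M
     (\<Pi>\<^sub>M j\<in>{1..d}. gamma_dist (n j) (measure (\<mu> j) (space (\<mu> j))))"

definition distinct_values :: "nat \<Rightarrow> (nat \<Rightarrow> nat) \<Rightarrow> (nat \<Rightarrow> nat \<Rightarrow> 'a) \<Rightarrow> 'a set" where
  "distinct_values d n x = {x j i | j i. j \<in> {1..d} \<and> i \<in> {1..n j}}"

definition group_count :: "(nat \<Rightarrow> nat) \<Rightarrow> (nat \<Rightarrow> nat \<Rightarrow> 'a) \<Rightarrow> nat \<Rightarrow> 'a \<Rightarrow> nat" where
  "group_count n x j v = card {i \<in> {1..n j}. x j i = v}"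

text \<open>The atoms are \<open>t 1, \<dots>, t K\<close>, and \<open>c j k\<close> is the number of observations of group \<open>j\<close> at \<open>t k\<close>;
  it may be zero.\<close>

definition allocated_law ::
    "nat \<Rightarrow> 'a measure \<Rightarrow> (nat \<Rightarrow> real \<Rightarrow> real) \<Rightarrow> nat \<Rightarrow> (nat \<Rightarrow> 'a) \<Rightarrow> (nat \<Rightarrow> nat \<Rightarrow> nat) \<Rightarrow> (nat \<Rightarrow> real)
      \<Rightarrow> (nat \<Rightarrow> 'a measure) measure" where
  "allocated_law d T h K t c u =
     distr (\<Pi>\<^sub>M j\<in>{1..d}. \<Pi>\<^sub>M k\<in>{1..K}. density_propto lpos (\<lambda>s. exp (- u j * s) * s ^ c j k * h j s))
       (vec_measures d T) (\<lambda>S. \<lambda>j\<in>{1..d}. dirac_sum T {1..K} (S j) t)"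

definition H_star :: "(real \<Rightarrow> real) \<Rightarrow> real \<Rightarrow> real measure" where
  "H_star f u = density_propto lpos (\<lambda>s. exp (- u * s) * f s)"

definition q_star_weight ::
    "nat \<Rightarrow> nat pmf \<Rightarrow> (nat \<Rightarrow> real \<Rightarrow> real) \<Rightarrow> nat \<Rightarrow> (nat \<Rightarrow> real) \<Rightarrow> nat \<Rightarrow> real" where
  "q_star_weight d q h K u m =
     pmf q (m + K) * (fact (m + K) / fact m) * (\<Prod>j\<in>{1..d}. laplace (h j) (u j) ^ m)"

text \<open>\<^const>\<open>embed_pmf\<close> is unspecified where the weights cannot be normalised; for data following
  the model and \<open>u j > 0\<close> this happens with probability zero.\<close>

definition q_star :: "nat \<Rightarrow> nat pmf \<Rightarrow> (nat \<Rightarrow> real \<Rightarrow> real) \<Rightarrow> nat \<Rightarrow> (nat \<Rightarrow> real) \<Rightarrow> nat pmf" where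
  "q_star d q h K u =
     embed_pmf (\<lambda>m. q_star_weight d q h K u m / (\<Sum>l. q_star_weight d q h K u l))"

definition superposition_law ::
    "nat \<Rightarrow> 'a measure \<Rightarrow> (nat \<Rightarrow> 'a measure) measure \<Rightarrow> (nat \<Rightarrow> 'a measure) measure
      \<Rightarrow> (nat \<Rightarrow> 'a measure) measure" where
  "superposition_law d T A B =
     distr (A \<Otimes>\<^sub>M B) (vec_measures d T) (\<lambda>(a, b). \<lambda>j\<in>{1..d}. superpose (a j) (b j))"

lemma space_finite_measures: "space (finite_measures T) = {m. finite_measure m \<and> sets m = sets T}"
  by (auto simp: finite_measures_def space_Sup_eq_UN)

lemma finite_measures_cong: "sets T = sets T' \<Longrightarrow> finite_measures T = finite_measures T'"
  by (simp add: finite_measures_def)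

lemma measurable_emeasure_finite_measures:
  "A \<in> sets T \<Longrightarrow> (\<lambda>m. emeasure m A) \<in> borel_measurable (finite_measures T)"
  by (auto intro!: measurable_Sup1 measurable_vimage_algebra1 simp: finite_measures_def)

lemma measurable_finite_measures:
  assumes "\<And>a. a \<in> space M \<Longrightarrow> finite_measure (K a)"
    and "\<And>a. a \<in> space M \<Longrightarrow> sets (K a) = sets T"
    and "\<And>A. A \<in> sets T \<Longrightarrow> (\<lambda>a. emeasure (K a) A) \<in> borel_measurable M"
  shows "K \<in> M \<rightarrow>\<^sub>M finite_measures T"
  using assms by (auto intro!: measurable_Sup2 measurable_vimage_algebra2 simp: finite_measures_def)

lemma sets_dirac_sum: "sets (dirac_sum T I S \<tau>) = sets T"
  and space_dirac_sum: "space (dirac_sum T I S \<tau>) = space T"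
  by (simp_all add: dirac_sum_def)

lemma emeasure_dirac_sum:
  assumes "finite I" "A \<in> sets T"
  shows "emeasure (dirac_sum T I S \<tau>) A = (\<Sum>m\<in>I. ennreal (S m) * indicator A (\<tau> m))"
proof -
  have "countably_additive (sets T) (\<lambda>A. \<Sum>m\<in>I. ennreal (S m) * emeasure (return T (\<tau> m)) A)"
  proof (rule countably_additiveI)
    fix F :: "nat \<Rightarrow> _" assume F: "range F \<subseteq> sets T" "disjoint_family F" "\<Union> (range F) \<in> sets T"
    have "(\<Sum>i. \<Sum>m\<in>I. ennreal (S m) * emeasure (return T (\<tau> m)) (F i))
        = (\<Sum>m\<in>I. \<Sum>i. ennreal (S m) * emeasure (return T (\<tau> m)) (F i))"
      by (rule suminf_sum) auto
    also have "\<dots> = (\<Sum>m\<in>I. ennreal (S m) * emeasure (return T (\<tau> m)) (\<Union> (range F)))"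
      using F by (intro sum.cong refl) (simp add: suminf_emeasure del: emeasure_return)
    finally show "(\<Sum>i. \<Sum>m\<in>I. ennreal (S m) * emeasure (return T (\<tau> m)) (F i))
        = (\<Sum>m\<in>I. ennreal (S m) * emeasure (return T (\<tau> m)) (\<Union> (range F)))" .
  qed
  then have "emeasure (dirac_sum T I S \<tau>) A = (\<Sum>m\<in>I. ennreal (S m) * emeasure (return T (\<tau> m)) A)"
    using assms
    by (subst emeasure_measure_of[OF dirac_sum_def])
       (auto simp: positive_def sets.space_closed dirac_sum_def)
  then show ?thesis using assms by simp
qed

lemma emeasure_superpose:
  assumes "sets \<mu> = sets \<nu>" "A \<in> sets \<mu>"
  shows "emeasure (superpose \<mu> \<nu>) A = emeasure \<mu> A + emeasure \<nu> A"
proof -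
  have "countably_additive (sets \<mu>) (\<lambda>A. emeasure \<mu> A + emeasure \<nu> A)"
    using assms by (auto intro!: countably_additiveI simp: suminf_add[symmetric] suminf_emeasure)
  then show ?thesis
    using assms(2) by (subst emeasure_measure_of[OF superpose_def])
       (auto simp: positive_def sets.space_closed superpose_def)
qed

lemma prob_space_density_pos:
  "pos_density f \<Longrightarrow> prob_space (density lpos (\<lambda>s. ennreal (f s)))"
proof (rule prob_spaceI)
  assume f: "pos_density f"
  have "emeasure (density lpos (\<lambda>s. ennreal (f s))) (space lpos)
      = (\<integral>\<^sup>+ s. ennreal (f s) * indicator (space lpos) s \<partial>lpos)"
    using f by (intro emeasure_density sets.top) (auto simp: pos_density_def)
  also have "\<dots> = (\<integral>\<^sup>+ s. ennreal (f s) \<partial>lpos)"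
    by (intro nn_integral_cong) simp
  finally show "emeasure (density lpos (\<lambda>s. ennreal (f s))) (space (density lpos (\<lambda>s. ennreal (f s)))) = 1"
    using f by (simp add: pos_density_def)
qed

lemma measurable_vec_dirac_sum:
  assumes G: "\<And>j. j \<in> {1..d} \<Longrightarrow> sets (G j) = sets lpos"
  shows "(\<lambda>(S, \<tau>). \<lambda>j\<in>{1..d}. dirac_sum P0 {1..N::nat} (S j) \<tau>)
      \<in> (\<Pi>\<^sub>M j\<in>{1..d}. \<Pi>\<^sub>M m\<in>{1..N}. G j) \<Otimes>\<^sub>M (\<Pi>\<^sub>M m\<in>{1..N}. P0) \<rightarrow>\<^sub>M vec_measures d P0"
    (is "_ \<in> ?P \<rightarrow>\<^sub>M _")
  unfolding vec_measures_def split_beta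
proof (intro measurable_restrict measurable_finite_measures)
  fix j assume j: "j \<in> {1..d}"
  fix x assume "x \<in> space ?P"
  show "finite_measure (dirac_sum P0 {1..N} (fst x j) (snd x))"
    by (rule finite_measureI)
       (simp add: space_dirac_sum emeasure_dirac_sum ennreal_mult_eq_top_iff indicator_eq_0_iff)
  show "sets (dirac_sum P0 {1..N} (fst x j) (snd x)) = sets P0"
    by (rule sets_dirac_sum)
next
  fix j A assume j: "j \<in> {1..d}" and A: "A \<in> sets P0"
  have "(\<lambda>x. fst x j m) \<in> ?P \<rightarrow>\<^sub>M G j" if "m \<in> {1..N}" for m
  proof -
    have "(\<lambda>S. S j m) \<in> (\<Pi>\<^sub>M j\<in>{1..d}. \<Pi>\<^sub>M m\<in>{1..N}. G j) \<rightarrow>\<^sub>M G j"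
      by (rule measurable_compose[OF measurable_component_singleton[OF j]])
        (rule measurable_component_singleton[OF that])
    then show ?thesis
      by (rule measurable_compose[OF measurable_fst])
  qed
  then have [measurable]: "(\<lambda>x. fst x j m) \<in> borel_measurable ?P" if "m \<in> {1..N}" for m
    using that G[OF j] by (auto simp: measurable_restrict_space2_iff cong: measurable_cong_sets)
  have [measurable]: "(\<lambda>x. snd x m) \<in> ?P \<rightarrow>\<^sub>M P0" if "m \<in> {1..N}" for m
    using that by measurable
  note [measurable] = A
  have "(\<lambda>x. \<Sum>m\<in>{1..N}. ennreal (fst x j m) * indicator A (snd x m)) \<in> borel_measurable ?P"
    by (rule borel_measurable_sum) measurable
  then show "(\<lambda>x. emeasure (dirac_sum P0 {1..N} (fst x j) (snd x)) A) \<in> borel_measurable ?P"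
    using A by (simp add: emeasure_dirac_sum del: sum_mult_indicator)
qed

lemma measurable_vec_superpose:
  "(\<lambda>(a, b). \<lambda>j\<in>{1..d}. superpose (a j) (b j))
     \<in> vec_measures d T \<Otimes>\<^sub>M vec_measures d T \<rightarrow>\<^sub>M vec_measures d T"
  unfolding vec_measures_def split_beta
proof (intro measurable_restrict measurable_finite_measures)
  let ?P = "(\<Pi>\<^sub>M j\<in>{1..d}. finite_measures T) \<Otimes>\<^sub>M (\<Pi>\<^sub>M j\<in>{1..d}. finite_measures T)"
  fix j assume j: "j \<in> {1..d}"
  {
    fix x assume "x \<in> space ?P"
    then have x: "finite_measure (fst x j)" "sets (fst x j) = sets T"
      "finite_measure (snd x j)" "sets (snd x j) = sets T"
      using j by (auto simp: space_pair_measure space_PiM space_finite_measures PiE_iff)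
    then interpret l: finite_measure "fst x j" + r: finite_measure "snd x j" by auto
    show "sets (superpose (fst x j) (snd x j)) = sets T"
      using x by (metis superpose_def sets.sets_measure_of_eq)
    have "space (snd x j) = space (fst x j)" "space (superpose (fst x j) (snd x j)) = space (fst x j)"
      using x by (metis sets_eq_imp_space_eq, metis superpose_def sets.space_measure_of_eq)
    then show "finite_measure (superpose (fst x j) (snd x j))"
      using emeasure_superpose[OF trans[OF x(2) x(4)[symmetric]] sets.top]
        l.emeasure_finite r.emeasure_finite
      by (intro finite_measureI) simp
  }
  note sup = this
  fix A assume A: "A \<in> sets T"
  have "(\<lambda>x. emeasure (fst x j) A) \<in> borel_measurable ?P"
       "(\<lambda>x. emeasure (snd x j) A) \<in> borel_measurable ?P"
    by (rule measurable_compose[OF _ measurable_emeasure_finite_measures[OF A]],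
        rule measurable_compose[OF measurable_fst measurable_component_singleton[OF j]],
        rule measurable_compose[OF _ measurable_emeasure_finite_measures[OF A]],
        rule measurable_compose[OF measurable_snd measurable_component_singleton[OF j]])
  then have "(\<lambda>x. emeasure (fst x j) A + emeasure (snd x j) A) \<in> borel_measurable ?P"
    by measurable
  then show "(\<lambda>x. emeasure (superpose (fst x j) (snd x j)) A) \<in> borel_measurable ?P"
    using A j by (subst measurable_cong[OF emeasure_superpose])
      (auto simp: space_pair_measure space_PiM space_finite_measures PiE_iff)
qed

lemma
  assumes "prob_space P0"
    and G: "\<And>j. j \<in> {1..d} \<Longrightarrow> prob_space (G j) \<and> sets (G j) = sets lpos"
  shows prob_space_vec_ifpp: "prob_space (vec_ifpp d q G P0)"
    and sets_vec_ifpp: "sets (vec_ifpp d q G P0) = sets (vec_measures d P0)"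
proof -
  let ?K = "\<lambda>N. distr ((\<Pi>\<^sub>M j\<in>{1..d}. \<Pi>\<^sub>M m\<in>{1..N}. G j) \<Otimes>\<^sub>M (\<Pi>\<^sub>M m\<in>{1..N}. P0)) (vec_measures d P0)
         (\<lambda>(S, \<tau>). \<lambda>j\<in>{1..d}. dirac_sum P0 {1..N} (S j) \<tau>)"
  have "prob_space (?K N)" for N :: nat
  proof (intro prob_space.prob_space_distr prob_space_pair prob_space_PiM measurable_vec_dirac_sum)
  qed (use assms in auto)
  then have K: "?K \<in> measure_pmf q \<rightarrow>\<^sub>M prob_algebra (vec_measures d P0)"
    by (auto simp: space_prob_algebra)
  have q: "measure_pmf q \<in> space (prob_algebra (count_space UNIV))"
    by (simp add: space_prob_algebra measure_pmf.prob_space_axioms)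
  show "prob_space (vec_ifpp d q G P0)" "sets (vec_ifpp d q G P0) = sets (vec_measures d P0)"
    unfolding vec_ifpp_def
    using prob_space_bind'[OF q] sets_bind'[OF q] K by auto
qed

end

(*
Given N atoms with jumps S_{j,m}, the total masses T_j in the normalisation of the mu_j cancel
against the factors T_j^{n_j} of the Gamma densities: each observation contributes the jump of the
atom it sits on, and u_j contributes exp (- u_j T_j). The joint law of data and auxiliary variables
therefore factorises over the atoms. Sum over all allocations of observations to atoms. By
exchangeability the k atoms that are hit may be moved to the labels 1..k, at the cost of a factor
(N choose k) = (m + k)! / (m! k!), where N = m + k and k! does not depend on m. Allocated jumps are
then tilted by s^{n_{j,k}} exp (- u_j s), the remaining ones by exp (- u_j s), and the normalising
constants are the moments and the powers of the Laplace transforms in the weights of the claim.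
Since P0 is diffuse, the k labelled atoms are almost surely distinct; hence the data determine them
up to a permutation, which does not change the law.
*)
theory Submission
  imports Defs
begin

subsection \<open>Finite products of measures\<close>

text \<open>The conditional law has to be a Markov kernel, while \<open>\<theta>s\<close> is an
  arbitrary enumeration about whose measurability nothing is assumed. A measurable kernel is
  therefore built from the equality pattern of the data and compared with the claim only on a set of
  full measure. The computation takes place not on the space of the data but on label spaces: a
  labelling consists of a number \<open>k\<close> and a surjection of the observations onto
  \<open>{1..k}\<close>, and its label space carries Lebesgue measure for \<open>u\<close> and the
  law of \<open>k\<close> independent draws from \<open>P0\<close>. There the joint law of measures,
  data and auxiliary variables is a finite sum with explicit densities. Several labellings produce
  the same data, and this multiplicity is never divided out: each of them has the same ratio of
  joint to marginal density, so Bayes' formula holds summand by summand. All test functions are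
  nonnegative, so interchanges of sums and integrals are instances of Tonelli. The Laplace
  transforms are less than 1 for \<open>u j > 0\<close>, so the weights of \<open>q_star\<close> are
  summable whatever the tail of \<open>q\<close>.\<close>

lemma PiM_eqI_finite:
  assumes "finite I" and \<sigma>: "\<And>i. i \<in> I \<Longrightarrow> sigma_finite_measure (M i)"
    and "sets P = sets (PiM I M)"
    and "\<And>A. (\<And>i. i \<in> I \<Longrightarrow> A i \<in> sets (M i)) \<Longrightarrow>
      emeasure P (Pi\<^sub>E I A) = (\<Prod>i\<in>I. emeasure (M i) (A i))"
  shows "P = PiM I M"
proof -
  \<comment> \<open>The locale \<open>product_sigma_finite\<close> asks for sigma-finite factors at
    every index, whereas the hypotheses concern \<open>I\<close> only. Factors outside
    \<open>I\<close> are replaced by a one-point space, which leaves the product over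
    \<open>I\<close> unchanged.\<close>
  define M' where "M' = (\<lambda>i. if i \<in> I then M i else count_space {undefined})"
  have "sigma_finite_measure (M' i)" for i
    using \<sigma>[of i] sigma_finite_measure_count_space_finite[of "{undefined}"]
    by (cases "i \<in> I") (simp_all add: M'_def)
  then interpret product_sigma_finite M'
    by (simp add: product_sigma_finite_def)
  have eq: "PiM I M' = PiM I M"
    by (intro PiM_cong) (simp_all add: M'_def)
  have "P = PiM I M'"
  proof (rule PiM_eqI)
    show "emeasure P (Pi\<^sub>E I A) = (\<Prod>i\<in>I. emeasure (M' i) (A i))"
      if "\<And>i. i \<in> I \<Longrightarrow> A i \<in> sets (M' i)" for A
      using assms(4)[of A] that by (simp add: M'_def cong: prod.cong)
  qed (simp_all add: \<open>finite I\<close> assms(3) eq)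
  then show ?thesis by (simp add: eq)
qed

lemma nn_integral_PiM_prod:
  assumes "finite I" and \<sigma>: "\<And>i. i \<in> I \<Longrightarrow> sigma_finite_measure (M i)"
    and f: "\<And>i. i \<in> I \<Longrightarrow> f i \<in> borel_measurable (M i)"
  shows "(\<integral>\<^sup>+ x. (\<Prod>i\<in>I. f i (x i)) \<partial>PiM I M) = (\<Prod>i\<in>I. \<integral>\<^sup>+ y. f i y \<partial>M i)"
proof -
  define M' where "M' = (\<lambda>i. if i \<in> I then M i else count_space {undefined})"
  have "sigma_finite_measure (M' i)" for i
    using \<sigma>[of i] sigma_finite_measure_count_space_finite[of "{undefined}"]
    by (cases "i \<in> I") (simp_all add: M'_def)
  then interpret product_sigma_finite M'
    by (simp add: product_sigma_finite_def)
  have "PiM I M = PiM I M'"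
    by (intro PiM_cong) (simp_all add: M'_def)
  then show ?thesis
    using product_nn_integral_prod[OF assms(1), of f] f by (simp add: M'_def cong: prod.cong)
qed

text \<open>Both sides are compared on rectangles, where the integral of a product of functions of
  single coordinates factorises. Sigma-finiteness of the factors with densities is what makes
  rectangles determine the product.\<close>

lemma density_PiM:
  assumes "finite I" and \<sigma>: "\<And>i. i \<in> I \<Longrightarrow> sigma_finite_measure (M i)"
    and f[measurable]: "\<And>i. i \<in> I \<Longrightarrow> f i \<in> borel_measurable (M i)"
    and \<sigma>': "\<And>i. i \<in> I \<Longrightarrow> sigma_finite_measure (density (M i) (f i))"
  shows "density (PiM I M) (\<lambda>x. \<Prod>i\<in>I. f i (x i)) = PiM I (\<lambda>i. density (M i) (f i))"
proof (rule PiM_eqI_finite)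
  let ?D = "density (PiM I M) (\<lambda>x. \<Prod>i\<in>I. f i (x i))"
  have [measurable]: "(\<lambda>x. \<Prod>i\<in>I. f i (x i)) \<in> borel_measurable (PiM I M)"
    by (intro borel_measurable_prod_ennreal) measurable
  show "sets ?D = sets (PiM I (\<lambda>i. density (M i) (f i)))"
    by (simp cong: sets_PiM_cong)
  fix A assume A: "\<And>i. i \<in> I \<Longrightarrow> A i \<in> sets (density (M i) (f i))"
  then have A': "\<And>i. i \<in> I \<Longrightarrow> A i \<in> sets (M i)" by simp
  have [measurable]: "Pi\<^sub>E I A \<in> sets (PiM I M)"
    using A' \<open>finite I\<close> by (intro sets_PiM_I_finite) auto
  have "emeasure ?D (Pi\<^sub>E I A)
      = (\<integral>\<^sup>+ x. (\<Prod>i\<in>I. f i (x i)) * indicator (Pi\<^sub>E I A) x \<partial>PiM I M)"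
    by (rule emeasure_density) measurable
  also have "\<dots> = (\<integral>\<^sup>+ x. (\<Prod>i\<in>I. f i (x i) * indicator (A i) (x i)) \<partial>PiM I M)"
  proof (rule nn_integral_cong)
    fix x assume "x \<in> space (PiM I M)"
    then have "indicator (Pi\<^sub>E I A) x = (\<Prod>i\<in>I. indicator (A i) (x i) :: ennreal)"
      using \<open>finite I\<close> by (auto simp: space_PiM PiE_iff indicator_def split: if_splits)
    then show "(\<Prod>i\<in>I. f i (x i)) * indicator (Pi\<^sub>E I A) x = (\<Prod>i\<in>I. f i (x i) * indicator (A i) (x i))"
      by (simp add: prod.distrib)
  qed
  also have "\<dots> = (\<Prod>i\<in>I. \<integral>\<^sup>+ y. f i y * indicator (A i) y \<partial>M i)"
  proof (intro nn_integral_PiM_prod \<open>finite I\<close> \<sigma>)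
    show "(\<lambda>y. f i y * indicator (A i) y) \<in> borel_measurable (M i)" if "i \<in> I" for i
    proof -
      note [measurable] = f[OF that] A'[OF that]
      show ?thesis by measurable
    qed
  qed
  also have "\<dots> = (\<Prod>i\<in>I. emeasure (density (M i) (f i)) (A i))"
    using A' by (intro prod.cong refl) (simp add: emeasure_density)
  finally show "emeasure ?D (Pi\<^sub>E I A)
      = (\<Prod>i\<in>I. emeasure (density (M i) (f i)) (A i))" .
qed (fact \<open>finite I\<close>, fact \<sigma>')

text \<open>The coordinates under a product measure are independent, hence so are the disjoint
  blocks \<open>{j} \<times> I j\<close>; independence of the blocks says precisely that their joint
  law is the nested product. The characterisation of independence through the joint law concerns a
  nonempty family, whence \<open>J \<noteq> {}\<close>.\<close>

lemma PiM_curry: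
  assumes "finite J" "J \<noteq> {}" "\<And>j. j \<in> J \<Longrightarrow> finite (I j)"
    and G: "\<And>j i. j \<in> J \<Longrightarrow> i \<in> I j \<Longrightarrow> prob_space (G j i)"
  shows "distr (PiM (Sigma J I) (\<lambda>(j, i). G j i)) (\<Pi>\<^sub>M j\<in>J. \<Pi>\<^sub>M i\<in>I j. G j i)
      (\<lambda>\<omega>. \<lambda>j\<in>J. \<lambda>i\<in>I j. \<omega> (j, i)) = (\<Pi>\<^sub>M j\<in>J. \<Pi>\<^sub>M i\<in>I j. G j i)"
proof -
  let ?M = "\<lambda>(j, i). G j i"
  let ?Q = "PiM (Sigma J I) ?M"
  interpret prob_space ?Q
    by (rule prob_space_PiM) (auto intro: G)
  have comp: "distr ?Q (PiM (I j) (G j)) (\<lambda>\<omega>. \<lambda>i\<in>I j. \<omega> (j, i)) = PiM (I j) (G j)" if "j \<in> J" for j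
  proof -
    have "distr ?Q (\<Pi>\<^sub>M i\<in>I j. ?M (j, i)) (\<lambda>\<omega>. \<lambda>i\<in>I j. \<omega> (j, i)) = (\<Pi>\<^sub>M i\<in>I j. ?M (j, i))"
      by (rule distr_PiM_reindex) (auto simp: inj_on_def that intro: G)
    then show ?thesis by simp
  qed
  have indep: "indep_vars ?M (\<lambda>p \<omega>. \<omega> p) (Sigma J I)"
  \<comment> \<open>All blocks may be empty although \<open>J\<close> is not; independence of the
    empty family holds by definition.\<close>
  proof (cases "Sigma J I = {}")
    case True
    show ?thesis unfolding indep_vars_def indep_sets_def using True by auto
  next
    case False
    have "distr ?Q ?Q (\<lambda>\<omega>. \<lambda>p\<in>Sigma J I. \<omega> p) = distr ?Q ?Q (\<lambda>\<omega>. \<omega>)"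
      by (intro distr_cong refl) (auto simp: space_PiM)
    also have "\<dots> = PiM (Sigma J I) (\<lambda>p. distr ?Q (?M p) (\<lambda>\<omega>. \<omega> p))"
      unfolding distr_id
    proof (intro PiM_cong refl)
      show "?M p = distr ?Q (?M p) (\<lambda>\<omega>. \<omega> p)" if "p \<in> Sigma J I" for p
        by (rule distr_PiM_component[symmetric, OF _ that]) (auto intro: G)
    qed
    finally show ?thesis
      using False by (subst indep_vars_iff_distr_eq_PiM') auto
  qed
  have "indep_vars (\<lambda>j. PiM ({j} \<times> I j) ?M) (\<lambda>j \<omega>. restrict (\<lambda>p. \<omega> p) ({j} \<times> I j)) J"
    by (rule indep_vars_restrict[OF indep]) (auto simp: disjoint_family_on_def)
  then have "indep_vars (\<lambda>j. PiM (I j) (G j))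
      (\<lambda>j \<omega>. (\<lambda>f. \<lambda>i\<in>I j. f (j, i)) (restrict (\<lambda>p. \<omega> p) ({j} \<times> I j))) J"
  proof (rule indep_vars_compose2)
    fix j assume "j \<in> J"
    show "(\<lambda>f. \<lambda>i\<in>I j. f (j, i)) \<in> PiM ({j} \<times> I j) ?M \<rightarrow>\<^sub>M PiM (I j) (G j)"
      using measurable_component_singleton[of "(j, _)" "{j} \<times> I j" ?M]
      by (intro measurable_restrict) auto
  qed
  also have "?this \<longleftrightarrow> indep_vars (\<lambda>j. PiM (I j) (G j)) (\<lambda>j \<omega>. \<lambda>i\<in>I j. \<omega> (j, i)) J"
    by (intro indep_vars_cong refl) (auto simp: fun_eq_iff)
  finally have "distr ?Q (PiM J (\<lambda>j. PiM (I j) (G j))) (\<lambda>\<omega>. \<lambda>j\<in>J. \<lambda>i\<in>I j. \<omega> (j, i))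
      = PiM J (\<lambda>j. distr ?Q (PiM (I j) (G j)) (\<lambda>\<omega>. \<lambda>i\<in>I j. \<omega> (j, i)))"
  proof (subst (asm) indep_vars_iff_distr_eq_PiM')
    show "(\<lambda>\<omega>. \<lambda>i\<in>I j. \<omega> (j, i)) \<in> ?Q \<rightarrow>\<^sub>M PiM (I j) (G j)" if "j \<in> J" for j
      using measurable_component_singleton[of "(j, _)" "Sigma J I" ?M] that
      by (intro measurable_restrict) auto
  qed (rule \<open>J \<noteq> {}\<close>)
  also have "\<dots> = PiM J (\<lambda>j. PiM (I j) (G j))"
    by (intro PiM_cong comp refl)
  finally show ?thesis .
qed

text \<open>The map \<open>g\<close> is prescribed on the two disjoint index sets that make up
  \<open>C\<close>, so the preimage of a box is a product of two boxes and the measures multiply.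
  This glues the allocated and the remaining atoms into one labelled family.\<close>

lemma distr_PiM_join:
  assumes "finite A" "finite B" "inj_on a A" "inj_on b B" "a ` A \<inter> b ` B = {}" "C = a ` A \<union> b ` B"
    and M: "\<And>i. i \<in> C \<Longrightarrow> prob_space (M i)"
    and g[measurable]: "g \<in> PiM A (\<lambda>i. M (a i)) \<Otimes>\<^sub>M PiM B (\<lambda>i. M (b i)) \<rightarrow>\<^sub>M PiM C M"
    and ga: "\<And>x y i. i \<in> A \<Longrightarrow> g (x, y) (a i) = x i"
    and gb: "\<And>x y i. i \<in> B \<Longrightarrow> g (x, y) (b i) = y i"
  shows "distr (PiM A (\<lambda>i. M (a i)) \<Otimes>\<^sub>M PiM B (\<lambda>i. M (b i))) (PiM C M) g = PiM C M" (is "distr ?P _ _ = _")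
proof (rule PiM_eqI_finite)
  interpret B: prob_space "PiM B (\<lambda>i. M (b i))"
    using assms by (intro prob_space_PiM) auto
  fix X assume X: "\<And>i. i \<in> C \<Longrightarrow> X i \<in> sets (M i)"
  have "g -` Pi\<^sub>E C X \<inter> space ?P = PiE A (\<lambda>i. X (a i)) \<times> PiE B (\<lambda>i. X (b i))"
  proof (intro equalityI subsetI)
    fix z assume z: "z \<in> g -` Pi\<^sub>E C X \<inter> space ?P"
    obtain x y where [simp]: "z = (x, y)" by (cases z)
    have "x i \<in> X (a i)" if "i \<in> A" for i
      using z that by (simp add: assms(6) PiE_iff ga[OF that, of x y, symmetric])
    moreover have "y i \<in> X (b i)" if "i \<in> B" for i
      using z that by (simp add: assms(6) PiE_iff gb[OF that, of x y, symmetric])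
    ultimately show "z \<in> PiE A (\<lambda>i. X (a i)) \<times> PiE B (\<lambda>i. X (b i))"
      using z by (auto simp: space_pair_measure space_PiM PiE_iff)
  next
    fix z assume z: "z \<in> PiE A (\<lambda>i. X (a i)) \<times> PiE B (\<lambda>i. X (b i))"
    obtain x y where [simp]: "z = (x, y)" by (cases z)
    have sp: "z \<in> space ?P"
      using z X[THEN sets.sets_into_space] assms(6)
      by (fastforce simp: space_pair_measure space_PiM PiE_iff)
    \<comment> \<open>Values outside \<open>C\<close> are not covered by \<open>ga\<close> and
      \<open>gb\<close>; measurability of \<open>g\<close> forces them to be
      \<open>undefined\<close>, as membership in the box demands.\<close>
    then have "g z \<in> space (PiM C M)"
      by (rule measurable_space[OF g])
    then have "g z \<in> extensional C" by (simp add: space_PiM PiE_iff)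
    moreover have "g z i \<in> X i" if "i \<in> C" for i
      using that z ga gb assms(6) by (auto simp: PiE_iff)
    ultimately show "z \<in> g -` Pi\<^sub>E C X \<inter> space ?P"
      using sp by (simp add: PiE_iff)
  qed
  then have "emeasure (distr ?P (PiM C M) g) (Pi\<^sub>E C X)
      = emeasure ?P (PiE A (\<lambda>i. X (a i)) \<times> PiE B (\<lambda>i. X (b i)))"
    using X assms(1-6) by (subst emeasure_distr[OF g]) (auto intro!: sets_PiM_I_finite)
  also have "\<dots> = (\<Prod>i\<in>A. emeasure (M (a i)) (X (a i))) * (\<Prod>i\<in>B. emeasure (M (b i)) (X (b i)))"
  proof -
    have "emeasure (PiM A (\<lambda>i. M (a i))) (PiE A (\<lambda>i. X (a i))) = (\<Prod>i\<in>A. emeasure (M (a i)) (X (a i)))"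
      "emeasure (PiM B (\<lambda>i. M (b i))) (PiE B (\<lambda>i. X (b i))) = (\<Prod>i\<in>B. emeasure (M (b i)) (X (b i)))"
      using emeasure_PiM_emb[of A "\<lambda>i. M (a i)" A "\<lambda>i. X (a i)"]
        emeasure_PiM_emb[of B "\<lambda>i. M (b i)" B "\<lambda>i. X (b i)"] assms X
      by (simp_all add: prod_emb_PiE_same_index sets.sets_into_space)
    then show ?thesis
      using X assms(1-6) by (subst B.emeasure_pair_measure_Times) (auto intro!: sets_PiM_I_finite)
  qed
  also have "\<dots> = (\<Prod>i\<in>C. emeasure (M i) (X i))"
    using assms(1-6) by (simp add: prod.union_disjoint prod.reindex)
  finally show "emeasure (distr ?P (PiM C M) g) (Pi\<^sub>E C X) = (\<Prod>i\<in>C. emeasure (M i) (X i))" .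
qed (use assms(1,2,6) M in \<open>simp_all add: prob_space_imp_sigma_finite\<close>)

text \<open>A product of discrete measures is discrete: expanding the product of sums gives one mass
  for every function \<open>c\<close> that chooses an atom for each coordinate. These functions are
  the allocations of observations to atoms. The sum runs over labels rather than locations, so
  coinciding atoms are accounted for.\<close>

lemma PiM_point_mass:
  fixes w :: "'i \<Rightarrow> nat \<Rightarrow> ennreal"
  assumes "finite L" and R: "finite R" "\<And>m. m \<in> R \<Longrightarrow> \<tau> m \<in> space T"
    and sets: "\<And>l. l \<in> L \<Longrightarrow> sets (M l) = sets T"
    and \<sigma>: "\<And>l. l \<in> L \<Longrightarrow> sigma_finite_measure (M l)"
    and M: "\<And>l A. l \<in> L \<Longrightarrow> A \<in> sets T \<Longrightarrow> emeasure (M l) A = (\<Sum>m\<in>R. w l m * indicator A (\<tau> m))"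
    and f[measurable]: "f \<in> borel_measurable (PiM L (\<lambda>_. T))"
  shows "(\<integral>\<^sup>+ x. f x \<partial>PiM L M) = (\<Sum>c\<in>L \<rightarrow>\<^sub>E R. (\<Prod>l\<in>L. w l (c l)) * f (\<lambda>l\<in>L. \<tau> (c l)))"
proof -
  let ?C = "point_measure (L \<rightarrow>\<^sub>E R) (\<lambda>c. \<Prod>l\<in>L. w l (c l))"
  let ?g = "\<lambda>c. \<lambda>l\<in>L. \<tau> (c l)"
  have fin: "finite (L \<rightarrow>\<^sub>E R)" using assms by (intro finite_PiE) auto
  have g[measurable]: "?g \<in> ?C \<rightarrow>\<^sub>M PiM L (\<lambda>_. T)"
    using R(2) by (subst measurable_point_measure_eq1) (auto simp: space_PiM PiE_iff)
  have setsM: "sets (PiM L M) = sets (PiM L (\<lambda>_. T))"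
    by (intro sets_PiM_cong) (auto simp: sets)
  have eq: "distr ?C (PiM L (\<lambda>_. T)) ?g = PiM L M"
  proof (rule PiM_eqI_finite)
    fix A assume A: "\<And>i. i \<in> L \<Longrightarrow> A i \<in> sets (M i)"
    then have A': "\<And>i. i \<in> L \<Longrightarrow> A i \<in> sets T" using sets by auto
    then have [measurable]: "Pi\<^sub>E L A \<in> sets (PiM L (\<lambda>_. T))"
      using \<open>finite L\<close> by (intro sets_PiM_I_finite) auto
    have "emeasure (distr ?C (PiM L (\<lambda>_. T)) ?g) (Pi\<^sub>E L A)
        = (\<integral>\<^sup>+ c. indicator (Pi\<^sub>E L A) (?g c) \<partial>?C)"
      using nn_integral_distr[OF g, of "indicator (Pi\<^sub>E L A)"] by simp
    also have "\<dots> = (\<Sum>c\<in>L \<rightarrow>\<^sub>E R. (\<Prod>l\<in>L. w l (c l)) * indicator (Pi\<^sub>E L A) (?g c))"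
      using fin by (subst nn_integral_point_measure_finite) auto
    also have "\<dots> = (\<Sum>c\<in>L \<rightarrow>\<^sub>E R. (\<Prod>l\<in>L. w l (c l) * indicator (A l) (\<tau> (c l))))"
    proof (rule sum.cong[OF refl])
      fix c
      have "indicator (Pi\<^sub>E L A) (?g c) = (\<Prod>l\<in>L. indicator (A l) (\<tau> (c l)) :: ennreal)"
        using \<open>finite L\<close> by (auto simp: PiE_iff indicator_def split: if_splits)
      then show "(\<Prod>l\<in>L. w l (c l)) * indicator (Pi\<^sub>E L A) (?g c) = (\<Prod>l\<in>L. w l (c l) * indicator (A l) (\<tau> (c l)))"
        by (simp add: prod.distrib)
    qed
    also have "\<dots> = (\<Prod>l\<in>L. \<Sum>m\<in>R. w l m * indicator (A l) (\<tau> m))"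
      using assms by (subst prod_sum_PiE) auto
    also have "\<dots> = (\<Prod>i\<in>L. emeasure (M i) (A i))"
      using A' by (intro prod.cong refl) (simp add: M)
    finally show "emeasure (distr ?C (PiM L (\<lambda>_. T)) ?g) (Pi\<^sub>E L A) = (\<Prod>i\<in>L. emeasure (M i) (A i))" .
  qed (use assms(1) \<sigma> setsM in simp_all)
  show ?thesis
    unfolding eq[symmetric] using fin by (simp add: nn_integral_distr[OF g] nn_integral_point_measure_finite)
qed

lemma measurable_pred_eq:
  assumes "Measurable.pred (T \<Otimes>\<^sub>M T) (\<lambda>(x, y). x = y)" "f \<in> M \<rightarrow>\<^sub>M T" "g \<in> M \<rightarrow>\<^sub>M T"
  shows "Measurable.pred M (\<lambda>x. f x = g x)"
  using measurable_compose[OF measurable_Pair[OF assms(2,3)] assms(1)] by simp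

text \<open>With the other coordinates fixed, coordinate \<open>i\<close> would have to hit the
  single point \<open>t j\<close>, which has mass 0 because the measure is diffuse.\<close>

lemma AE_PiM_neq:
  assumes I: "finite I" "i \<in> I" "j \<in> I" "i \<noteq> j" and T: "prob_space T"
    and diag[measurable]: "Measurable.pred (T \<Otimes>\<^sub>M T) (\<lambda>(x, y). x = y)"
    and diffuse: "\<And>x. x \<in> space T \<Longrightarrow> emeasure T {x} = 0"
  shows "AE t in PiM I (\<lambda>_. T). t i \<noteq> t j"
proof -
  interpret prob_space T by fact
  interpret product_prob_space "\<lambda>_. T" by standard
  let ?P = "PiM I (\<lambda>_. T)"
  let ?E = "{t \<in> space ?P. t i = t j}"
  have meas[measurable]: "Measurable.pred ?P (\<lambda>t. t i = t j)"
    using I by (intro measurable_pred_eq[OF diag] measurable_component_singleton)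
  define I' where "I' = I - {i}"
  have I': "I = insert i I'" "i \<notin> I'" "finite I'" "j \<in> I'" using I by (auto simp: I'_def)
  have "emeasure ?P ?E
      = (\<integral>\<^sup>+ t. indicator ?E t \<partial>?P)"
    by simp
  also have "\<dots> = (\<integral>\<^sup>+ x. \<integral>\<^sup>+ y. indicator ?E (x(i := y)) \<partial>T \<partial>PiM I' (\<lambda>_. T))"
    using product_nn_integral_insert[OF I'(3,2),
      of "indicator ?E"] meas
    by (simp add: I'(1)[symmetric])
  also have "\<dots> = (\<integral>\<^sup>+ x. 0 \<partial>PiM I' (\<lambda>_. T))"
  proof (intro nn_integral_cong)
    fix x assume x: "x \<in> space (PiM I' (\<lambda>_. T))"
    then have xj: "x j \<in> space T" using I' by (auto simp: space_PiM)
    \<comment> \<open>The singleton is measurable as a section of the diagonal. Its mass 0 alone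
      would carry no information, since \<open>emeasure\<close> is 0 on every nonmeasurable
      set.\<close>
    have "(\<lambda>y. (x j, y)) \<in> T \<rightarrow>\<^sub>M T \<Otimes>\<^sub>M T" using xj by measurable
    from measurable_compose[OF this diag] have "{y \<in> space T. x j = y} \<in> sets T"
      by (simp add: pred_def)
    moreover have "{y \<in> space T. x j = y} = {x j}" using xj by auto
    ultimately have sing: "{x j} \<in> sets T" by simp
    have "(\<integral>\<^sup>+ y. indicator ?E (x(i := y)) \<partial>T) = (\<integral>\<^sup>+ y. indicator {x j} y \<partial>T)"
    proof (rule nn_integral_cong)
      fix y assume "y \<in> space T"
      then have "x(i := y) \<in> space ?P"
        using x I'(1) by (auto simp: space_PiM PiE_iff extensional_def)
      then show "indicator ?E (x(i := y)) = (indicator {x j} y :: ennreal)"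
        using \<open>i \<noteq> j\<close> by (simp add: indicator_def)
    qed
    also have "\<dots> = 0" using diffuse[OF xj] sing by simp
    finally show "(\<integral>\<^sup>+ y. indicator ?E (x(i := y)) \<partial>T) = 0" .
  qed
  finally show ?thesis
    by (intro AE_I[where N = "?E"]) auto
qed

lemma AE_PiM_inj_on:
  assumes "finite I" "prob_space T" "Measurable.pred (T \<Otimes>\<^sub>M T) (\<lambda>(x, y). x = y)"
    and "\<And>x. x \<in> space T \<Longrightarrow> emeasure T {x} = 0"
  shows "AE t in PiM I (\<lambda>_. T). inj_on t I"
proof -
  have "AE t in PiM I (\<lambda>_. T). \<forall>i\<in>I. \<forall>j\<in>I. i \<noteq> j \<longrightarrow> t i \<noteq> t j"
    using assms AE_PiM_neq[OF assms(1) _ _ _ assms(2-4)]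
    by (intro AE_finite_allI) auto
  then show ?thesis
    by eventually_elim (auto simp: inj_on_def)
qed

subsection \<open>Vectors of discrete measures\<close>

declare One_nat_def [simp del]

abbreviation jumps :: "nat \<Rightarrow> nat set \<Rightarrow> (nat \<times> nat \<Rightarrow> real) measure" where
  "jumps d I \<equiv> \<Pi>\<^sub>M p\<in>{1..d} \<times> I. lpos"

text \<open>Jumps are indexed by pairs \<open>(j, m)\<close> in place of the nested families of
  \<open>vec_ifpp\<close>: permuting, splitting and joining atoms then act on one index set and one
  product measure.\<close>

definition vec_atoms :: "nat \<Rightarrow> 'a measure \<Rightarrow> nat set \<Rightarrow> (nat \<times> nat \<Rightarrow> real) \<Rightarrow> (nat \<Rightarrow> 'a) \<Rightarrow> nat \<Rightarrow> 'a measure" where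
  "vec_atoms d T I S \<tau> = (\<lambda>j\<in>{1..d}. dirac_sum T I (\<lambda>m. S (j, m)) \<tau>)"

lemma dirac_sum_cong:
  assumes "finite I" "\<And>m. m \<in> I \<Longrightarrow> S m = S' m" "\<And>m. m \<in> I \<Longrightarrow> \<tau> m = \<tau>' m"
  shows "dirac_sum T I S \<tau> = dirac_sum T I S' \<tau>'"
  using assms by (intro measure_eqI) (simp_all add: sets_dirac_sum emeasure_dirac_sum cong: sum.cong)

lemma measurable_lpos_borel: "f \<in> M \<rightarrow>\<^sub>M lpos \<Longrightarrow> f \<in> borel_measurable M"
  by (auto simp: measurable_restrict_space2_iff)

lemma finite_measure_dirac_sum: "finite I \<Longrightarrow> finite_measure (dirac_sum T I S \<tau>)"
  by (rule finite_measureI)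
    (simp add: space_dirac_sum emeasure_dirac_sum ennreal_mult_eq_top_iff indicator_eq_0_iff)

lemma measurable_vec_atoms:
  assumes "finite I" and f: "f \<in> M \<rightarrow>\<^sub>M jumps d I" and g[measurable]: "g \<in> M \<rightarrow>\<^sub>M PiM I (\<lambda>_. T)"
  shows "(\<lambda>x. vec_atoms d T I (f x) (g x)) \<in> M \<rightarrow>\<^sub>M vec_measures d T"
  unfolding vec_measures_def vec_atoms_def
proof (intro measurable_restrict measurable_finite_measures)
  fix j A assume j: "j \<in> {1..d}" and A[measurable]: "A \<in> sets T"
  have [measurable]: "(\<lambda>x. f x (j, m)) \<in> borel_measurable M" if "m \<in> I" for m
    using measurable_compose[OF f measurable_component_singleton[of "(j, m)" "{1..d} \<times> I" "\<lambda>_. lpos"]] that j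
    by (auto intro: measurable_lpos_borel)
  have [measurable]: "(\<lambda>x. g x m) \<in> M \<rightarrow>\<^sub>M T" if "m \<in> I" for m
    using measurable_compose[OF g measurable_component_singleton[OF that]] .
  have "(\<lambda>x. \<Sum>m\<in>I. ennreal (f x (j, m)) * indicator A (g x m)) \<in> borel_measurable M"
    by (rule borel_measurable_sum) measurable
  then show "(\<lambda>x. emeasure (dirac_sum T I (\<lambda>m. f x (j, m)) (g x)) A) \<in> borel_measurable M"
    using A \<open>finite I\<close> by (simp add: emeasure_dirac_sum del: sum_mult_indicator)
qed (simp_all add: finite_measure_dirac_sum sets_dirac_sum \<open>finite I\<close>)

lemma measurable_vec_atoms_pair:
  assumes "finite I" and sets: "sets F = sets (jumps d I)"
  shows "(\<lambda>(S, \<tau>). vec_atoms d T I S \<tau>) \<in> F \<Otimes>\<^sub>M PiM I (\<lambda>_. T) \<rightarrow>\<^sub>M vec_measures d T"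
  unfolding split_beta
  by (rule measurable_vec_atoms[OF assms(1)])
    (auto simp: measurable_fst measurable_snd cong: measurable_cong_sets[OF refl sets[symmetric]])

context
  fixes d :: nat and P0 :: "'a measure" and G :: "nat \<Rightarrow> nat \<Rightarrow> real measure"
  assumes d: "d \<ge> 1"
    and G: "\<And>j m. j \<in> {1..d} \<Longrightarrow> prob_space (G j m)"
    and sets_G: "\<And>j m. j \<in> {1..d} \<Longrightarrow> sets (G j m) = sets lpos"
begin

lemma sets_flat: "sets (\<Pi>\<^sub>M (j, m)\<in>{1..d} \<times> I. G j m) = sets (jumps d I)"
  by (rule sets_PiM_cong) (auto simp: sets_G)

lemma flatten_jumps:
  assumes "finite I"
  shows "(\<Pi>\<^sub>M j\<in>{1..d}. \<Pi>\<^sub>M m\<in>I. G j m)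
    = distr (\<Pi>\<^sub>M (j, m)\<in>{1..d} \<times> I. G j m) (\<Pi>\<^sub>M j\<in>{1..d}. \<Pi>\<^sub>M m\<in>I. G j m)
      (\<lambda>S. \<lambda>j\<in>{1..d}. \<lambda>m\<in>I. S (j, m))"
  by (rule PiM_curry[symmetric]) (use assms d G in auto)

lemma measurable_curry:
  "(\<lambda>S. \<lambda>j\<in>{1..d}. \<lambda>m\<in>I. S (j, m)) \<in> (\<Pi>\<^sub>M (j, m)\<in>{1..d} \<times> I. G j m) \<rightarrow>\<^sub>M (\<Pi>\<^sub>M j\<in>{1..d}. \<Pi>\<^sub>M m\<in>I. G j m)"
proof (intro measurable_restrict)
  fix j m assume "j \<in> {1..d}" "m \<in> I"
  then show "(\<lambda>S. S (j, m)) \<in> (\<Pi>\<^sub>M (j, m)\<in>{1..d} \<times> I. G j m) \<rightarrow>\<^sub>M G j m"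
    using measurable_component_singleton[of "(j, m)" "{1..d} \<times> I" "\<lambda>(j, m). G j m"] by simp
qed

lemma measurable_nested_vec_atoms:
  assumes "finite I" and t: "t \<in> space (PiM I (\<lambda>_. P0))"
  shows "(\<lambda>S. \<lambda>j\<in>{1..d}. dirac_sum P0 I (S j) t) \<in> (\<Pi>\<^sub>M j\<in>{1..d}. \<Pi>\<^sub>M m\<in>I. G j m) \<rightarrow>\<^sub>M vec_measures d P0"
proof -
  have "(\<lambda>S. \<lambda>(j, m)\<in>{1..d} \<times> I. S j m) \<in> (\<Pi>\<^sub>M j\<in>{1..d}. \<Pi>\<^sub>M m\<in>I. G j m) \<rightarrow>\<^sub>M jumps d I"
  proof (rule measurable_restrict, clarify)
    fix j m assume jm: "j \<in> {1..d}" "m \<in> I"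
    have "(\<lambda>S. S j m) \<in> (\<Pi>\<^sub>M j\<in>{1..d}. \<Pi>\<^sub>M m\<in>I. G j m) \<rightarrow>\<^sub>M G j m"
      by (rule measurable_compose[OF measurable_component_singleton[OF jm(1)]])
        (rule measurable_component_singleton[OF jm(2)])
    then show "(\<lambda>S. S j m) \<in> (\<Pi>\<^sub>M j\<in>{1..d}. \<Pi>\<^sub>M m\<in>I. G j m) \<rightarrow>\<^sub>M lpos"
      by (simp add: measurable_cong_sets[OF refl sets_G[OF jm(1)]])
  qed
  from measurable_vec_atoms[OF assms(1) this, of "\<lambda>_. t" P0] t
  have "(\<lambda>S. vec_atoms d P0 I (\<lambda>(j, m)\<in>{1..d} \<times> I. S j m) t) \<in> (\<Pi>\<^sub>M j\<in>{1..d}. \<Pi>\<^sub>M m\<in>I. G j m) \<rightarrow>\<^sub>M vec_measures d P0"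
    by simp
  also have "(\<lambda>S. vec_atoms d P0 I (\<lambda>(j, m)\<in>{1..d} \<times> I. S j m) t) = (\<lambda>S. \<lambda>j\<in>{1..d}. dirac_sum P0 I (S j) t)"
    unfolding vec_atoms_def by (intro ext restrict_ext dirac_sum_cong) (use assms in auto)
  finally show ?thesis .
qed

text \<open>Serves to rewrite \<open>allocated_law\<close>. There every jump has its own law
  \<open>G j m\<close>, because the tilt depends on the count at the atom.\<close>

lemma distr_nested_vec_atoms:
  assumes "finite I" "t \<in> space (PiM I (\<lambda>_. P0))"
  shows "distr (\<Pi>\<^sub>M j\<in>{1..d}. \<Pi>\<^sub>M m\<in>I. G j m) (vec_measures d P0) (\<lambda>S. \<lambda>j\<in>{1..d}. dirac_sum P0 I (S j) t)
    = distr (\<Pi>\<^sub>M (j, m)\<in>{1..d} \<times> I. G j m) (vec_measures d P0) (\<lambda>S. vec_atoms d P0 I S t)"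
  apply (subst flatten_jumps[OF assms(1)])
  apply (subst distr_distr[OF measurable_nested_vec_atoms[OF assms] measurable_curry])
  apply (rule distr_cong[OF refl refl])
  apply (auto simp: vec_atoms_def intro!: restrict_ext dirac_sum_cong assms)
  done

end

text \<open>The nested product of the jumps is the image of the flat one under currying, and the map
  of \<open>vec_ifpp\<close> composed with currying is \<open>vec_atoms\<close>.\<close>

lemma vec_ifpp_kernel_flat:
  assumes d: "d \<ge> 1" and P0: "prob_space P0"
    and G: "\<And>j. j \<in> {1..d} \<Longrightarrow> prob_space (G j)" and sets_G: "\<And>j. j \<in> {1..d} \<Longrightarrow> sets (G j) = sets lpos"
  shows "distr ((\<Pi>\<^sub>M j\<in>{1..d}. \<Pi>\<^sub>M m\<in>{1..N}. G j) \<Otimes>\<^sub>M (\<Pi>\<^sub>M m\<in>{1..N}. P0)) (vec_measures d P0)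
         (\<lambda>(S, \<tau>). \<lambda>j\<in>{1..d}. dirac_sum P0 {1..N} (S j) \<tau>)
    = distr ((\<Pi>\<^sub>M (j, m)\<in>{1..d} \<times> {1..N}. G j) \<Otimes>\<^sub>M (\<Pi>\<^sub>M m\<in>{1..N}. P0)) (vec_measures d P0)
        (\<lambda>(S, \<tau>). vec_atoms d P0 {1..N} S \<tau>)"
proof -
  let ?F = "\<Pi>\<^sub>M (j, m)\<in>{1..d} \<times> {1..N}. G j" and ?N = "\<Pi>\<^sub>M j\<in>{1..d}. \<Pi>\<^sub>M m\<in>{1..N}. G j"
  let ?T = "\<Pi>\<^sub>M m\<in>{1..N}. P0"
  let ?c = "\<lambda>S. \<lambda>j\<in>{1..d}. \<lambda>m\<in>{1..N}. S (j, m)"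
  have T: "prob_space ?T" using P0 by (intro prob_space_PiM)
  have c: "?c \<in> ?F \<rightarrow>\<^sub>M ?N" using measurable_curry[of d "\<lambda>j _. G j" "{1..N}"] d G sets_G by simp
  have N: "?N = distr ?F ?N ?c" using flatten_jumps[of d "\<lambda>j _. G j" "{1..N}"] d G sets_G by simp
  have nd: "\<And>j. j \<in> {1..d} \<Longrightarrow> prob_space (G j) \<and> sets (G j) = sets lpos" using G sets_G by auto
  have "prob_space (distr ?F ?N ?c)"
    unfolding N[symmetric] using G by (intro prob_space_PiM)
  \<comment> \<open>The locations are written as an image under the identity; with both factors in
    the form of images, currying can act on the pair.\<close>
  then have "?N \<Otimes>\<^sub>M ?T = distr ?F ?N ?c \<Otimes>\<^sub>M distr ?T ?T (\<lambda>x. x)"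
    by (simp add: N[symmetric] distr_id2)
  also have "\<dots> = distr (?F \<Otimes>\<^sub>M ?T) (?N \<Otimes>\<^sub>M ?T) (\<lambda>(x, y). (?c x, y))"
    using T by (intro pair_measure_distr c) (auto simp: distr_id2 intro: prob_space_imp_sigma_finite)
  finally have *: "?N \<Otimes>\<^sub>M ?T = \<dots>" .
  have m: "(\<lambda>(x, y). (?c x, y)) \<in> ?F \<Otimes>\<^sub>M ?T \<rightarrow>\<^sub>M ?N \<Otimes>\<^sub>M ?T"
    using c by measurable
  show ?thesis
    apply (subst *)
    apply (subst distr_distr[OF measurable_vec_dirac_sum[OF sets_G] m])
     apply assumption
    apply (rule distr_cong[OF refl refl])
    apply (auto simp: vec_atoms_def intro!: restrict_ext dirac_sum_cong)
    done
qed

text \<open>The form in which both the prior and the non-allocated part are used: a series over the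
  number of components whose terms are integrals over flat jumps and locations.\<close>

lemma nn_integral_vec_ifpp:
  assumes d: "d \<ge> 1" and P0: "prob_space P0"
    and G: "\<And>j. j \<in> {1..d} \<Longrightarrow> prob_space (G j)" and sets_G: "\<And>j. j \<in> {1..d} \<Longrightarrow> sets (G j) = sets lpos"
    and f[measurable]: "f \<in> borel_measurable (vec_measures d P0)"
  shows "(\<integral>\<^sup>+ \<mu>. f \<mu> \<partial>vec_ifpp d q G P0) =
    (\<Sum>N. ennreal (pmf q N) * (\<integral>\<^sup>+ z. f (vec_atoms d P0 {1..N} (fst z) (snd z))
       \<partial>((\<Pi>\<^sub>M (j, m)\<in>{1..d} \<times> {1..N}. G j) \<Otimes>\<^sub>M (\<Pi>\<^sub>M m\<in>{1..N}. P0))))"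
proof -
  let ?K = "\<lambda>N. distr ((\<Pi>\<^sub>M (j, m)\<in>{1..d} \<times> {1..N}. G j) \<Otimes>\<^sub>M (\<Pi>\<^sub>M m\<in>{1..N}. P0)) (vec_measures d P0)
         (\<lambda>(S, \<tau>). vec_atoms d P0 {1..N} S \<tau>)"
  let ?F = "\<lambda>N. \<Pi>\<^sub>M (j, m)\<in>{1..d} \<times> {1..N}. G j"
  let ?T = "\<lambda>N. \<Pi>\<^sub>M m\<in>{1..N}. P0"
  have V: "vec_ifpp d q G P0 = measure_pmf q \<bind> ?K"
    unfolding vec_ifpp_def using vec_ifpp_kernel_flat[OF d P0 G sets_G] by simp
  have sF: "sets (?F N) = sets (jumps d {1..N})" for N
    using sets_flat[OF d, of "\<lambda>j _. G j"] G sets_G by auto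
  have pF: "prob_space (?F N)" for N
    by (rule prob_space_PiM) (auto intro: G)
  have m: "(\<lambda>(S, \<tau>). vec_atoms d P0 {1..N} S \<tau>) \<in> (?F N) \<Otimes>\<^sub>M (?T N) \<rightarrow>\<^sub>M vec_measures d P0" for N
    by (rule measurable_vec_atoms_pair[OF _ sF]) simp
  have "prob_space (?K N)" for N
    by (intro prob_space.prob_space_distr prob_space_pair pF prob_space_PiM P0 m)
  then have K: "?K \<in> measure_pmf q \<rightarrow>\<^sub>M subprob_algebra (vec_measures d P0)"
    by (auto simp: space_subprob_algebra prob_space_imp_subprob_space)
  have "(\<integral>\<^sup>+ \<mu>. f \<mu> \<partial>vec_ifpp d q G P0) = (\<integral>\<^sup>+ N. \<integral>\<^sup>+ \<mu>. f \<mu> \<partial>?K N \<partial>measure_pmf q)"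
    unfolding V by (rule nn_integral_bind[OF f K])
  also have "\<dots> = (\<integral>\<^sup>+ N. (\<integral>\<^sup>+ z. f (vec_atoms d P0 {1..N} (fst z) (snd z))
       \<partial>((?F N) \<Otimes>\<^sub>M (?T N))) \<partial>measure_pmf q)"
    by (intro nn_integral_cong) (simp add: nn_integral_distr[OF m] split_beta)
  finally show ?thesis
    by (simp add: nn_integral_measure_pmf nn_integral_count_space_nat)
qed

subsection \<open>Exponential tilting of the jumps\<close>

lemma sigma_finite_lpos: "sigma_finite_measure lpos"
  by (rule sigma_finite_measure_restrict_space[OF lborel.sigma_finite_measure_axioms]) simp

lemma borel_measurable_lpos: "f \<in> borel_measurable borel \<Longrightarrow> f \<in> borel_measurable lpos"
  by (intro measurable_restrict_space1) simp

text \<open>The expectation of \<open>S ^ c * exp (- u * S)\<close> when \<open>S\<close> has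
  density \<open>f\<close>. It is the normalising constant of an allocated jump; for
  \<open>c = 0\<close> it is the Laplace transform.\<close>

definition moment :: "(real \<Rightarrow> real) \<Rightarrow> nat \<Rightarrow> real \<Rightarrow> real" where
  "moment f c u = (LINT s|lpos. exp (- u * s) * s ^ c * f s)"

text \<open>A single term of the exponential series is bounded by its sum.\<close>

lemma power_le_fact_exp: "0 \<le> x \<Longrightarrow> x ^ n \<le> fact n * exp (x::real)"
proof -
  assume "0 \<le> x"
  then have "(\<Sum>k\<in>{n}. x ^ k / fact k) \<le> (\<Sum>k. x ^ k / fact k)"
    using summable_exp[of x] by (intro sum_le_suminf) (auto simp: field_simps)
  then show ?thesis
    by (simp add: exp_def scaleR_conv_of_real field_simps)
qed

context
  fixes f :: "real \<Rightarrow> real"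
  assumes f: "pos_density f"
begin

lemma pos_density_measurable: "f \<in> borel_measurable lpos"
  and pos_density_nonneg: "0 < s \<Longrightarrow> 0 \<le> f s"
  and nn_integral_pos_density: "(\<integral>\<^sup>+ s. ennreal (f s) \<partial>lpos) = 1"
  using f by (auto simp: pos_density_def)

lemma integrable_pos_density: "integrable lpos f"
  using nn_integral_pos_density by (intro integrableI_nonneg)
    (auto simp: pos_density_nonneg pos_density_measurable)

lemma pos_density_not_AE_zero: "\<not> (AE s in lpos. f s = 0)"
proof
  assume "AE s in lpos. f s = 0"
  then have "AE s in lpos. ennreal (f s) = 0"
    by eventually_elim simp
  then have "(\<integral>\<^sup>+ s. ennreal (f s) \<partial>lpos) = 0"
    by (subst nn_integral_0_iff_AE) (auto intro: measurable_compose[OF pos_density_measurable])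
  then show False by (simp add: nn_integral_pos_density)
qed

text \<open>For \<open>u > 0\<close> the tilt \<open>exp (- u * s) * s ^ c\<close> is bounded on the
  half line, so the integral exists even if \<open>f\<close> has infinite moments.\<close>

lemma integrable_moment:
  assumes u: "0 < u"
  shows "integrable lpos (\<lambda>s. exp (- u * s) * s ^ c * f s)"
proof (rule Bochner_Integration.integrable_bound)
  show "integrable lpos (\<lambda>s. (fact c / u ^ c) * f s)"
    by (intro integrable_mult_right integrable_pos_density)
  note [measurable] = pos_density_measurable
  have [measurable]: "(\<lambda>s. exp (- u * s) * s ^ c) \<in> borel_measurable lpos"
    by (rule borel_measurable_lpos) measurable
  show "(\<lambda>s. exp (- u * s) * s ^ c * f s) \<in> borel_measurable lpos"
    by measurable
  show "AE s in lpos. norm (exp (- u * s) * s ^ c * f s) \<le> norm (fact c / u ^ c * f s)"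
  proof (intro AE_I2)
    fix s assume "s \<in> space lpos"
    then have s: "0 < s" by simp
    \<comment> \<open>The bound \<open>fact c / u ^ c\<close> for the tilt comes from the
      exponential series at \<open>u * s\<close>.\<close>
    have "(u * s) ^ c \<le> fact c * exp (u * s)"
      using u s by (intro power_le_fact_exp) simp
    then have *: "exp (- u * s) * s ^ c \<le> fact c / u ^ c"
      using u by (simp add: exp_minus field_simps power_mult_distrib)
    then show "norm (exp (- u * s) * s ^ c * f s) \<le> norm (fact c / u ^ c * f s)"
      using s u mult_right_mono[OF * abs_ge_zero[of "f s"]] by (simp add: abs_mult)
  qed
qed

text \<open>The tilt is strictly positive on the half line: a vanishing integral would make
  \<open>f\<close> vanish almost everywhere, against its total mass 1.\<close>

lemma moment_pos:
  assumes u: "0 < u"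
  shows "0 < moment f c u"
proof -
  have "AE s in lpos. 0 \<le> exp (- u * s) * s ^ c * f s"
    by (intro AE_I2) (auto simp: pos_density_nonneg)
  note * = integral_nonneg_eq_0_iff_AE[OF integrable_moment[OF u, of c] this]
    integral_nonneg_AE[OF this]
  have "AE s in lpos. f s = 0" if "AE s in lpos. exp (- u * s) * s ^ c * f s = 0"
    using that AE_space by eventually_elim auto
  then show ?thesis
    using * pos_density_not_AE_zero unfolding moment_def by force
qed

lemma laplace_eq_moment: "laplace f u = moment f 0 u"
  by (simp add: laplace_def moment_def)

text \<open>The factor \<open>1 - exp (- u * s)\<close> is positive on the whole half line, so the
  difference to the total mass 1 is strict. The strictness yields the geometric decay of the weights
  of \<open>q_star\<close>.\<close>

lemma laplace_less_1:
  assumes u: "0 < u"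
  shows "laplace f u < 1"
proof -
  have i0: "integrable lpos (\<lambda>s. exp (- u * s) * f s)"
    using integrable_moment[OF u, of 0] by simp
  then have i: "integrable lpos (\<lambda>s. f s - exp (- u * s) * f s)"
    by (intro Bochner_Integration.integrable_diff integrable_pos_density)
  have nn: "AE s in lpos. 0 \<le> f s - exp (- u * s) * f s"
  proof (intro AE_I2)
    fix s assume "s \<in> space lpos"
    then have "exp (- u * s) * f s \<le> 1 * f s"
      using u by (intro mult_right_mono) (auto simp: pos_density_nonneg)
    then show "0 \<le> f s - exp (- u * s) * f s" by simp
  qed
  have "(AE s in lpos. f s - exp (- u * s) * f s = 0) \<Longrightarrow> (AE s in lpos. f s = 0)"
  proof (erule AE_mp, intro AE_I2 impI)
    fix s assume "s \<in> space lpos" and "f s - exp (- u * s) * f s = 0"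
    then have "(1 - exp (- u * s)) * f s = 0" and s: "0 < s"
      by (simp_all add: algebra_simps)
    moreover have "exp (- u * s) < 1" using u s by simp
    ultimately show "f s = 0" by (metis mult_eq_0_iff diff_eq_eq add_0 less_irrefl)
  qed
  then have "0 < (LINT s|lpos. f s - exp (- u * s) * f s)"
    using integral_nonneg_eq_0_iff_AE[OF i nn] integral_nonneg_AE[OF nn] pos_density_not_AE_zero by force
  also have "\<dots> = (LINT s|lpos. f s) - laplace f u"
    unfolding laplace_def by (rule Bochner_Integration.integral_diff[OF integrable_pos_density i0])
  also have "(LINT s|lpos. f s) = 1"
    using nn_integral_pos_density pos_density_nonneg
    by (subst integral_eq_nn_integral) (auto simp: pos_density_measurable)
  finally show ?thesis by simp
qed

end

definition tilted :: "(real \<Rightarrow> real) \<Rightarrow> nat \<Rightarrow> real \<Rightarrow> real measure" where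
  "tilted f c u = density_propto lpos (\<lambda>s. exp (- u * s) * s ^ c * f s)"

lemma H_star_eq_tilted: "H_star f u = tilted f 0 u"
  by (simp add: H_star_def tilted_def)

lemma tilted_eq_density:
  "tilted f c u = density lpos (\<lambda>s. ennreal (exp (- u * s) * s ^ c * f s / moment f c u))"
  by (simp add: tilted_def density_propto_def moment_def)

lemma pos_density_tilted:
  assumes f: "pos_density f" and u: "0 < u"
  shows "pos_density (\<lambda>s. exp (- u * s) * s ^ c * f s / moment f c u)"
proof -
  have i: "integrable lpos (\<lambda>s. exp (- u * s) * s ^ c * f s / moment f c u)"
    using integrable_moment[OF f u] by (intro integrable_divide_zero) simp
  have nn: "\<forall>s>0. 0 \<le> exp (- u * s) * s ^ c * f s / moment f c u"
    using pos_density_nonneg[OF f] moment_pos[OF f u, of c] by simp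
  have "(\<integral>\<^sup>+ s. ennreal (exp (- u * s) * s ^ c * f s / moment f c u) \<partial>lpos)
      = ennreal (LINT s|lpos. exp (- u * s) * s ^ c * f s / moment f c u)"
    using nn by (intro nn_integral_eq_integral i AE_I2) simp
  also have "(LINT s|lpos. exp (- u * s) * s ^ c * f s / moment f c u) = 1"
    using moment_pos[OF f u, of c]
    by (subst Bochner_Integration.integral_divide_zero) (simp add: moment_def del: mult_minus_left)
  finally show ?thesis
    using i nn by (simp add: pos_density_def borel_measurable_integrable)
qed

lemma prob_space_tilted: "pos_density f \<Longrightarrow> 0 < u \<Longrightarrow> prob_space (tilted f c u)"
  unfolding tilted_eq_density by (intro prob_space_density_pos pos_density_tilted)

lemma sets_tilted: "sets (tilted f c u) = sets lpos"
  by (simp add: tilted_def density_propto_def)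

text \<open>Change of measure, coordinate by coordinate: the tilt times the density
  \<open>f i\<close> is the moment times the normalised tilted density. The moments are constants
  and leave the integral.\<close>

lemma nn_integral_tilt:
  assumes "finite I" and f: "\<And>i. i \<in> I \<Longrightarrow> pos_density (f i)" and u: "\<And>i. i \<in> I \<Longrightarrow> 0 < u i"
    and F[measurable]: "F \<in> borel_measurable (\<Pi>\<^sub>M i\<in>I. lpos)"
  shows "(\<integral>\<^sup>+ S. (\<Prod>i\<in>I. ennreal (exp (- u i * S i) * S i ^ c i)) * F S
      \<partial>(\<Pi>\<^sub>M i\<in>I. density lpos (\<lambda>s. ennreal (f i s))))
    = ennreal (\<Prod>i\<in>I. moment (f i) (c i) (u i)) * (\<integral>\<^sup>+ S. F S \<partial>(\<Pi>\<^sub>M i\<in>I. tilted (f i) (c i) (u i)))"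
proof -
  let ?L = "\<Pi>\<^sub>M i\<in>I. lpos"
  let ?g = "\<lambda>i s. exp (- u i * s) * s ^ c i * f i s / moment (f i) (c i) (u i)"
  let ?w = "\<lambda>S. \<Prod>i\<in>I. ennreal (exp (- u i * S i) * S i ^ c i)"
  let ?Z = "ennreal (\<Prod>i\<in>I. moment (f i) (c i) (u i))"
  let ?pg = "\<lambda>S. \<Prod>i\<in>I. ennreal (?g i (S i))"
  let ?pf = "\<lambda>S. \<Prod>i\<in>I. ennreal (f i (S i))"
  let ?H = "\<Pi>\<^sub>M i\<in>I. density lpos (\<lambda>s. ennreal (f i s))"
  let ?T = "\<Pi>\<^sub>M i\<in>I. tilted (f i) (c i) (u i)"
  have fm: "f i \<in> borel_measurable lpos" and gm: "?g i \<in> borel_measurable lpos" if "i \<in> I" for i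
    by (rule pos_density_measurable[OF f[OF that]],
        rule pos_density_measurable[OF pos_density_tilted[OF f[OF that] u[OF that]]])
  have prod_m: "(\<lambda>S. \<Prod>i\<in>I. ennreal (g i (S i))) \<in> borel_measurable ?L"
    if "\<And>i. i \<in> I \<Longrightarrow> g i \<in> borel_measurable lpos" for g :: "_ \<Rightarrow> real \<Rightarrow> real"
  proof (rule borel_measurable_prod_ennreal)
    fix i assume i: "i \<in> I"
    show "(\<lambda>S. ennreal (g i (S i))) \<in> borel_measurable ?L"
      using measurable_compose[OF measurable_component_singleton[OF i] that[OF i]] by simp
  qed
  have [measurable]: "(\<lambda>S. \<Prod>i\<in>I. ennreal (exp (- u i * S i) * S i ^ c i)) \<in> borel_measurable ?L"
    by (rule prod_m, rule borel_measurable_lpos) measurable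
  note [measurable] = prod_m[OF gm] prod_m[OF fm]
  have 1: "?H = density ?L (\<lambda>S. \<Prod>i\<in>I. ennreal (f i (S i)))"
  proof (rule density_PiM[symmetric])
    show "sigma_finite_measure (density lpos (\<lambda>s. ennreal (f i s)))" if "i \<in> I" for i
      using that by (intro prob_space_imp_sigma_finite prob_space_density_pos f)
    show "(\<lambda>s. ennreal (f i s)) \<in> borel_measurable lpos" if "i \<in> I" for i
      using fm[OF that] by simp
  qed (simp_all add: sigma_finite_lpos \<open>finite I\<close>)
  have 2: "?T = density ?L (\<lambda>S. \<Prod>i\<in>I. ennreal (?g i (S i)))"
    unfolding tilted_eq_density
  proof (rule density_PiM[symmetric])
    show "sigma_finite_measure (density lpos (\<lambda>s. ennreal (?g i s)))" if "i \<in> I" for i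
      using that by (intro prob_space_imp_sigma_finite prob_space_density_pos pos_density_tilted f u)
    show "(\<lambda>s. ennreal (?g i s)) \<in> borel_measurable lpos" if "i \<in> I" for i
      using gm[OF that] by simp
  qed (simp_all add: sigma_finite_lpos \<open>finite I\<close>)
  have "(\<integral>\<^sup>+ S. (?w S) * F S
      \<partial>?H)
    = (\<integral>\<^sup>+ S. (?pf S) * ((?w S) * F S) \<partial>?L)"
    unfolding 1 by (rule nn_integral_density) measurable
  also have "\<dots> = (\<integral>\<^sup>+ S. ?Z * ((?pg S) * F S) \<partial>?L)"
  proof (rule nn_integral_cong)
    fix S assume "S \<in> space ?L"
    \<comment> \<open>Positivity of the jumps holds only on the space of the product; there the real
      factors are nonnegative and \<open>ennreal\<close> may be moved through their product.\<close>
    then have S: "\<And>i. i \<in> I \<Longrightarrow> 0 < S i" by (auto simp: space_PiM)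
    have "(?pf S) * (?w S)
        = (\<Prod>i\<in>I. ennreal (moment (f i) (c i) (u i)) * ennreal (?g i (S i)))"
      unfolding prod.distrib[symmetric]
    proof (rule prod.cong[OF refl])
      fix i assume i: "i \<in> I"
      define e where "e = exp (- u i * S i) * S i ^ c i"
      have "0 < moment (f i) (c i) (u i)" by (rule moment_pos[OF f[OF i] u[OF i]])
      moreover have "0 \<le> e" using S[OF i] by (simp add: e_def)
      moreover have "0 \<le> f i (S i)" by (rule pos_density_nonneg[OF f[OF i] S[OF i]])
      ultimately show "ennreal (f i (S i)) * ennreal (exp (- u i * S i) * S i ^ c i)
          = ennreal (moment (f i) (c i) (u i)) * ennreal (?g i (S i))"
        unfolding e_def[symmetric] by (simp add: ennreal_mult[symmetric])
    qed
    also have "\<dots> = ?Z * (?pg S)"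
    proof -
      have "(\<Prod>i\<in>I. ennreal (moment (f i) (c i) (u i))) = ?Z"
        by (rule prod_ennreal) (rule less_imp_le[OF moment_pos[OF f u]])
      then show ?thesis by (simp only: prod.distrib)
    qed
    finally show "(?pf S) * ((?w S) * F S)
        = ?Z * ((?pg S) * F S)"
      by (simp add: mult.assoc[symmetric])
  qed
  also have "\<dots> = ?Z * (\<integral>\<^sup>+ S. (?pg S) * F S \<partial>?L)"
    by (rule nn_integral_cmult) measurable
  also have "(\<integral>\<^sup>+ S. (?pg S) * F S \<partial>?L) = (\<integral>\<^sup>+ S. F S \<partial>?T)"
    unfolding 2 by (rule nn_integral_density[symmetric]) measurable
  finally show ?thesis .
qed

text \<open>Ratio test: consecutive terms have ratio \<open>x + k * x / (m + 1)\<close>, which tends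
  to \<open>x < 1\<close>. The midpoint \<open>(1 + x) / 2\<close> between \<open>x\<close> and 1
  serves as the bound.\<close>

lemma summable_fact_quotient_power:
  fixes x :: real
  assumes "0 \<le> x" "x < 1"
  shows "summable (\<lambda>m. fact (m + k) / fact m * x ^ m)"
proof -
  \<comment> \<open>From \<open>N\<close> on, the excess \<open>k * x / (m + 1)\<close> of the ratio
    over \<open>x\<close> is at most \<open>(1 - x) / 2\<close>.\<close>
  obtain N where N: "real k * x / ((1 - x) / 2) \<le> real N"
    using real_arch_simple by blast
  show ?thesis
  proof (rule summable_ratio_test[where c = "(1 + x) / 2" and N = N])
    show "(1 + x) / 2 < 1" using assms by simp
    fix m assume "N \<le> m"
    then have "real k * x / ((1 - x) / 2) \<le> real m + 1" using N by linarith
    then have *: "real k * x \<le> (1 - x) / 2 * (real m + 1)"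
      using assms by (simp add: field_simps)
    have eq: "fact (Suc m + k) / fact (Suc m) * x ^ Suc m
        = (real m + 1 + real k) / (real m + 1) * x * (fact (m + k) / fact m * x ^ m)"
      by (simp add: field_simps)
    have "(real m + 1 + real k) / (real m + 1) * x \<le> (1 + x) / 2"
      using * assms by (simp add: field_simps)
    then have "(real m + 1 + real k) / (real m + 1) * x * (fact (m + k) / fact m * x ^ m)
        \<le> (1 + x) / 2 * (fact (m + k) / fact m * x ^ m)"
      using assms by (intro mult_right_mono) auto
    then show "norm (fact (Suc m + k) / fact (Suc m) * x ^ Suc m)
        \<le> (1 + x) / 2 * norm (fact (m + k) / fact m * x ^ m)"
      unfolding eq using assms by simp
  qed
qed

section \<open>Normalisation of the weights for the number of non-allocated components\<close>

context
  fixes d k :: nat and q :: "nat pmf" and h :: "nat \<Rightarrow> real \<Rightarrow> real" and u :: "nat \<Rightarrow> real"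
  assumes d: "d \<ge> 1" and h: "\<And>j. j \<in> {1..d} \<Longrightarrow> pos_density (h j)"
    and u: "\<And>j. j \<in> {1..d} \<Longrightarrow> 0 < u j"
begin

lemma q_star_weight_nonneg: "0 \<le> q_star_weight d q h k u m"
proof -
  have "0 \<le> (\<Prod>j\<in>{1..d}. laplace (h j) (u j) ^ m)"
    by (intro prod_nonneg zero_le_power ballI) (simp add: laplace_eq_moment[OF h] less_imp_le[OF moment_pos[OF h u]])
  then show ?thesis by (simp add: q_star_weight_def)
qed

text \<open>The values of \<open>pmf\<close> are at most 1 and the product of the Laplace transforms
  is less than 1; the weights are dominated by a series whose ratios tend to that product.\<close>

lemma summable_q_star_weight: "summable (q_star_weight d q h k u)"
proof (rule summable_comparison_test')
  let ?x = "\<Prod>j\<in>{1..d}. laplace (h j) (u j)"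
  have l: "0 \<le> laplace (h j) (u j)" "laplace (h j) (u j) < 1" if "j \<in> {1..d}" for j
    using less_imp_le[OF moment_pos[OF h[OF that] u[OF that], of 0]] laplace_less_1[OF h[OF that] u[OF that]]
    by (simp_all add: laplace_eq_moment[OF h[OF that]])
  \<comment> \<open>Since \<open>d \<ge> 1\<close> there is a first factor, which is strictly below
    1; the others are at most 1.\<close>
  have "?x = laplace (h 1) (u 1) * (\<Prod>j\<in>{1..d} - {1}. laplace (h j) (u j))"
    using d by (intro prod.remove) auto
  also have "\<dots> \<le> laplace (h 1) (u 1) * 1"
    using l d by (intro mult_left_mono prod_le_1) (auto simp: less_imp_le)
  also have "\<dots> < 1" using l[of 1] d by simp
  finally have "?x < 1" .
  moreover have "0 \<le> ?x" using l by (intro prod_nonneg) auto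
  ultimately show "summable (\<lambda>m. fact (m + k) / fact m * ?x ^ m)"
    by (intro summable_fact_quotient_power)
  fix m
  have "q_star_weight d q h k u m = pmf q (m + k) * (fact (m + k) / fact m * ?x ^ m)"
    by (simp add: q_star_weight_def prod_power_distrib)
  also have "\<dots> \<le> 1 * (fact (m + k) / fact m * ?x ^ m)"
    using \<open>0 \<le> ?x\<close> by (intro mult_right_mono) (auto simp: pmf_le_1)
  finally show "norm (q_star_weight d q h k u m) \<le> fact (m + k) / fact m * ?x ^ m"
    using q_star_weight_nonneg[of m] by simp
qed

text \<open>The hypothesis says that \<open>k\<close> distinct values are compatible with the prior
  on the number of components; the term with \<open>m = N - k\<close> is then positive.\<close>

lemma suminf_q_star_weight_pos:
  assumes N: "N \<ge> k" "0 < pmf q N"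
  shows "0 < (\<Sum>m. q_star_weight d q h k u m)"
proof (rule suminf_pos2[OF summable_q_star_weight q_star_weight_nonneg])
  show "0 < q_star_weight d q h k u (N - k)"
    unfolding q_star_weight_def
  proof (intro mult_pos_pos prod_pos zero_less_power ballI)
    show "0 < laplace (h j) (u j)" if "j \<in> {1..d}" for j
      unfolding laplace_eq_moment[OF h[OF that]] by (rule moment_pos[OF h[OF that] u[OF that]])
  qed (use N in auto)
qed

lemma pmf_q_star:
  assumes "0 < (\<Sum>m. q_star_weight d q h k u m)"
  shows "pmf (q_star d q h k u) m = q_star_weight d q h k u m / (\<Sum>m. q_star_weight d q h k u m)"
  unfolding q_star_def
proof (rule pmf_embed_pmf)
  let ?Z = "\<Sum>m. q_star_weight d q h k u m"
  show nn: "0 \<le> q_star_weight d q h k u m / ?Z" for m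
    using assms q_star_weight_nonneg by (auto intro: divide_nonneg_pos)
  have "(\<lambda>m. q_star_weight d q h k u m / ?Z) sums (?Z / ?Z)"
    by (intro sums_divide summable_sums summable_q_star_weight)
  then have "(\<Sum>m. ennreal (q_star_weight d q h k u m / ?Z)) = ennreal 1"
    using assms nn by (intro suminf_ennreal_eq) auto
  then show "(\<integral>\<^sup>+ m. ennreal (q_star_weight d q h k u m / ?Z) \<partial>count_space UNIV) = 1"
    by (simp add: nn_integral_count_space_nat)
qed

end

subsection \<open>The posterior law as a mixture over the number of components\<close>

text \<open>The likelihood of the atoms in \<open>I\<close> as a function of their jumps: the
  exponentials come from the auxiliary variables, and every observation at an atom contributes one
  factor equal to its jump.\<close>

definition tilt_weight :: "nat \<Rightarrow> nat set \<Rightarrow> (nat \<Rightarrow> nat \<Rightarrow> nat) \<Rightarrow> (nat \<Rightarrow> real) \<Rightarrow> (nat \<times> nat \<Rightarrow> real) \<Rightarrow> ennreal" where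
  "tilt_weight d I c u S = (\<Prod>p\<in>{1..d} \<times> I. ennreal (exp (- u (fst p) * S p) * S p ^ c (fst p) (snd p)))"

definition vec_superpose :: "nat \<Rightarrow> (nat \<Rightarrow> 'a measure) \<Rightarrow> (nat \<Rightarrow> 'a measure) \<Rightarrow> nat \<Rightarrow> 'a measure" where
  "vec_superpose d a b = (\<lambda>j\<in>{1..d}. superpose (a j) (b j))"

lemma measurable_vec_superpose_compose:
  assumes "f \<in> M \<rightarrow>\<^sub>M vec_measures d T" "g \<in> M \<rightarrow>\<^sub>M vec_measures d T"
  shows "(\<lambda>x. vec_superpose d (f x) (g x)) \<in> M \<rightarrow>\<^sub>M vec_measures d T"
  using measurable_compose[OF measurable_Pair[OF assms] measurable_vec_superpose]
  by (simp add: vec_superpose_def)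

lemma measurable_jump:
  assumes "S \<in> M \<rightarrow>\<^sub>M jumps d I" "p \<in> {1..d} \<times> I"
  shows "(\<lambda>x. S x p) \<in> borel_measurable M"
  using measurable_compose[OF assms(1) measurable_component_singleton[OF assms(2)]]
  by (rule measurable_lpos_borel)

lemma measurable_tilt_weight:
  assumes u: "\<And>j. j \<in> {1..d} \<Longrightarrow> (\<lambda>x. u x j) \<in> borel_measurable M" and S: "S \<in> M \<rightarrow>\<^sub>M jumps d I"
  shows "(\<lambda>x. tilt_weight d I c (u x) (S x)) \<in> borel_measurable M"
  unfolding tilt_weight_def
proof (rule borel_measurable_prod_ennreal)
  fix p assume p: "p \<in> {1..d} \<times> I"
  have [measurable]: "(\<lambda>x. S x p) \<in> borel_measurable M" by (rule measurable_jump[OF S p])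
  have [measurable]: "(\<lambda>x. u x (fst p)) \<in> borel_measurable M" using u p by auto
  show "(\<lambda>x. ennreal (exp (- u x (fst p) * S x p) * S x p ^ c (fst p) (snd p))) \<in> borel_measurable M"
    by measurable
qed

text \<open>The condition \<open>pmf q 0 = 0\<close> excludes the null vector of measures, for which
  the observations would have no law.\<close>

locale vec_mixture =
  fixes d :: nat and n :: "nat \<Rightarrow> nat" and h :: "nat \<Rightarrow> real \<Rightarrow> real" and q :: "nat pmf" and P0 :: "'a measure"
  assumes d: "d \<ge> 1" and n: "\<And>j. j \<in> {1..d} \<Longrightarrow> n j \<ge> 1"
    and h: "\<And>j. j \<in> {1..d} \<Longrightarrow> pos_density (h j)"
    and q_0: "pmf q 0 = 0" and P0: "prob_space P0"
begin

abbreviation V :: "(nat \<Rightarrow> 'a measure) measure" where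
  "V \<equiv> vec_measures d P0"

abbreviation Y_space :: "((nat \<Rightarrow> nat \<Rightarrow> 'a) \<times> (nat \<Rightarrow> real)) measure" where
  "Y_space \<equiv> obs_space d n P0 \<Otimes>\<^sub>M aux_space d"

abbreviation atoms :: "nat set \<Rightarrow> (nat \<times> nat \<Rightarrow> real) \<Rightarrow> (nat \<Rightarrow> 'a) \<Rightarrow> nat \<Rightarrow> 'a measure" where
  "atoms \<equiv> vec_atoms d P0"

abbreviation exp_weight :: "nat set \<Rightarrow> (nat \<Rightarrow> real) \<Rightarrow> (nat \<times> nat \<Rightarrow> real) \<Rightarrow> ennreal" where
  "exp_weight I \<equiv> tilt_weight d I (\<lambda>_ _. 0)"

definition base :: "nat set \<Rightarrow> (nat \<times> nat \<Rightarrow> real) measure" where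
  "base I = (\<Pi>\<^sub>M p\<in>{1..d} \<times> I. density lpos (\<lambda>s. ennreal (h (fst p) s)))"

definition tilted_jumps :: "nat set \<Rightarrow> (nat \<Rightarrow> nat \<Rightarrow> nat) \<Rightarrow> (nat \<Rightarrow> real) \<Rightarrow> (nat \<times> nat \<Rightarrow> real) measure" where
  "tilted_jumps I c u = (\<Pi>\<^sub>M p\<in>{1..d} \<times> I. tilted (h (fst p)) (c (fst p) (snd p)) (u (fst p)))"

abbreviation locs :: "nat set \<Rightarrow> (nat \<Rightarrow> 'a) measure" where
  "locs I \<equiv> \<Pi>\<^sub>M m\<in>I. P0"

lemma prob_locs: "prob_space (locs I)"
  using P0 by (intro prob_space_PiM)

lemma sets_base: "sets (base I) = sets (jumps d I)"
  unfolding base_def by (rule sets_PiM_cong) auto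

lemma prob_base: "prob_space (base I)"
  unfolding base_def by (intro prob_space_PiM prob_space_density_pos h) auto

lemma sets_tilted_jumps: "sets (tilted_jumps I c u) = sets (jumps d I)"
  unfolding tilted_jumps_def by (rule sets_PiM_cong) (auto simp: sets_tilted)

lemma prob_tilted_jumps: "(\<And>j. j \<in> {1..d} \<Longrightarrow> 0 < u j) \<Longrightarrow> prob_space (tilted_jumps I c u)"
  unfolding tilted_jumps_def by (intro prob_space_PiM prob_space_tilted h) auto

lemmas sigma_finite_locs = prob_space_imp_sigma_finite[OF prob_locs]
lemmas sigma_finite_base = prob_space_imp_sigma_finite[OF prob_base]

definition moment_prod :: "nat set \<Rightarrow> (nat \<Rightarrow> nat \<Rightarrow> nat) \<Rightarrow> (nat \<Rightarrow> real) \<Rightarrow> real" where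
  "moment_prod I c u = (\<Prod>p\<in>{1..d} \<times> I. moment (h (fst p)) (c (fst p) (snd p)) (u (fst p)))"

lemma moment_prod_pos: "(\<And>j. j \<in> {1..d} \<Longrightarrow> 0 < u j) \<Longrightarrow> 0 < moment_prod I c u"
  unfolding moment_prod_def by (intro prod_pos ballI moment_pos h) auto

lemma moment_prod_0:
  "moment_prod {1..m} (\<lambda>_ _. 0) u = (\<Prod>j\<in>{1..d}. laplace (h j) (u j) ^ m)"
proof -
  have "moment_prod {1..m} (\<lambda>_ _. 0) u = (\<Prod>j\<in>{1..d}. \<Prod>i\<in>{1..m}. moment (h j) 0 (u j))"
    unfolding moment_prod_def by (subst prod.Sigma) (auto simp: split_beta)
  then show ?thesis
    by (simp add: laplace_eq_moment[OF h])
qed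

lemma nn_integral_tilt_base:
  assumes "finite I" "\<And>j. j \<in> {1..d} \<Longrightarrow> 0 < u j" "F \<in> borel_measurable (jumps d I)"
  shows "(\<integral>\<^sup>+ S. tilt_weight d I c u S * F S \<partial>base I)
    = ennreal (moment_prod I c u) * (\<integral>\<^sup>+ S. F S \<partial>tilted_jumps I c u)"
  unfolding tilt_weight_def base_def tilted_jumps_def moment_prod_def
  using assms by (intro nn_integral_tilt h) auto

abbreviation rest_integral :: "nat \<Rightarrow> nat \<Rightarrow> ((nat \<Rightarrow> 'a measure) \<Rightarrow> ennreal)
    \<Rightarrow> (nat \<times> nat \<Rightarrow> real) \<Rightarrow> (nat \<Rightarrow> 'a) \<Rightarrow> (nat \<times> nat \<Rightarrow> real) \<Rightarrow> ennreal" where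
  "rest_integral k m f S t S' \<equiv>
    (\<integral>\<^sup>+ \<tau>. f (vec_superpose d (atoms {1..k} S t) (atoms {1..m} S' \<tau>)) \<partial>locs {1..m})"

lemma measurable_inner_integral:
  assumes S: "S \<in> M \<rightarrow>\<^sub>M jumps d {1..k}" and t: "t \<in> M \<rightarrow>\<^sub>M locs {1..k}"
    and f: "f \<in> borel_measurable (V)"
    and Q: "sigma_finite_measure Q" "sets Q = sets (jumps d {1..m})"
  shows "(\<lambda>x. \<integral>\<^sup>+ S'. (rest_integral k m f (S x) (t x) S') \<partial>Q) \<in> borel_measurable M"
proof (rule sigma_finite_measure.borel_measurable_nn_integral[OF Q(1)])
  let ?M = "(M \<Otimes>\<^sub>M Q) \<Otimes>\<^sub>M locs {1..m}"
  have S': "(\<lambda>z. snd (fst z)) \<in> ?M \<rightarrow>\<^sub>M jumps d {1..m}"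
    using measurable_compose[OF measurable_fst measurable_snd, of "M" Q "locs {1..m}"]
    by (simp add: measurable_cong_sets[OF refl Q(2)[symmetric]])
  have "(\<lambda>z. f (vec_superpose d (atoms {1..k} (S (fst (fst z))) (t (fst (fst z))))
      (atoms {1..m} (snd (fst z)) (snd z)))) \<in> borel_measurable ?M"
    by (intro measurable_compose[OF measurable_vec_superpose_compose f] measurable_vec_atoms S'
        measurable_compose[OF _ S] measurable_compose[OF _ t]) measurable
  then have "(\<lambda>(z, \<tau>). f (vec_superpose d (atoms {1..k} (S (fst z)) (t (fst z)))
      (atoms {1..m} (snd z) \<tau>))) \<in> borel_measurable ?M"
    by (simp add: case_prod_beta')
  from sigma_finite_measure.borel_measurable_nn_integral[OF sigma_finite_locs this]
  show "(\<lambda>(x, S'). rest_integral k m f (S x) (t x) S')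
    \<in> borel_measurable (M \<Otimes>\<^sub>M Q)"
    by (simp add: case_prod_beta')
qed

text \<open>The unnormalised posterior expectation of \<open>f\<close> for labelled atoms at
  \<open>t\<close> with counts \<open>c\<close> and \<open>m\<close> further atoms. Jumps have their
  prior law here, and the likelihood appears as a weight.\<close>

definition marked_integral ::
    "nat \<Rightarrow> (nat \<Rightarrow> nat \<Rightarrow> nat) \<Rightarrow> (nat \<Rightarrow> 'a) \<Rightarrow> (nat \<Rightarrow> real) \<Rightarrow> nat \<Rightarrow> ((nat \<Rightarrow> 'a measure) \<Rightarrow> ennreal) \<Rightarrow> ennreal" where
  "marked_integral k c t u m f =
    (\<integral>\<^sup>+ S. tilt_weight d {1..k} c u S * (\<integral>\<^sup>+ S'. exp_weight {1..m} u S' *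
      (rest_integral k m f S t S')
        \<partial>base {1..m}) \<partial>base {1..k})"

definition post :: "nat \<Rightarrow> (nat \<Rightarrow> nat \<Rightarrow> nat) \<Rightarrow> (nat \<Rightarrow> 'a) \<Rightarrow> (nat \<Rightarrow> real) \<Rightarrow> (nat \<Rightarrow> 'a measure) measure" where
  "post k c t u = superposition_law d P0 (allocated_law d P0 h k t c u)
     (vec_ifpp d (q_star d q h k u) (\<lambda>j. H_star (h j) (u j)) P0)"

context
  fixes k :: nat and c :: "nat \<Rightarrow> nat \<Rightarrow> nat" and t :: "nat \<Rightarrow> 'a" and u :: "nat \<Rightarrow> real"
  assumes u: "\<And>j. j \<in> {1..d} \<Longrightarrow> 0 < u j" and t: "t \<in> space (locs {1..k})"
begin

lemma allocated_law_flat: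
  "allocated_law d P0 h k t c u = distr (tilted_jumps {1..k} c u) (V) (\<lambda>S. atoms {1..k} S t)"
  unfolding allocated_law_def tilted_jumps_def tilted_def[symmetric]
  using distr_nested_vec_atoms[of d "\<lambda>j k. tilted (h j) (c j k) (u j)" "{1..k}" t P0] d t
  by (simp add: prob_space_tilted h u sets_tilted case_prod_beta')

lemma measurable_vec_atoms_t:
  "sets M = sets (jumps d {1..k}) \<Longrightarrow> (\<lambda>S. atoms {1..k} S t) \<in> M \<rightarrow>\<^sub>M V"
  using t by (intro measurable_vec_atoms) (auto cong: measurable_cong_sets)

lemma prob_allocated_law: "prob_space (allocated_law d P0 h k t c u)"
  unfolding allocated_law_flat
  by (intro prob_space.prob_space_distr prob_tilted_jumps u measurable_vec_atoms_t sets_tilted_jumps)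

lemma sets_allocated_law: "sets (allocated_law d P0 h k t c u) = sets (V)"
  by (simp add: allocated_law_def)

lemma
  fixes q' :: "nat pmf"
  shows prob_non_allocated: "prob_space (vec_ifpp d q' (\<lambda>j. H_star (h j) (u j)) P0)"
    and sets_non_allocated: "sets (vec_ifpp d q' (\<lambda>j. H_star (h j) (u j)) P0) = sets (V)"
  unfolding H_star_eq_tilted
  by (rule prob_space_vec_ifpp[OF P0], simp add: prob_space_tilted h u sets_tilted)
    (rule sets_vec_ifpp[OF P0], simp add: prob_space_tilted h u sets_tilted)

lemma prob_post: "prob_space (post k c t u)"
  unfolding post_def superposition_law_def
  using measurable_vec_superpose
  by (intro prob_space.prob_space_distr prob_space_pair prob_allocated_law prob_non_allocated)
    (simp add: sets_allocated_law sets_non_allocated cong: measurable_cong_sets sets_pair_measure_cong)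

lemma measurable_inner_integral_t:
  assumes "f \<in> borel_measurable (V)" "sets M = sets (jumps d {1..k})"
  shows "(\<lambda>S. \<integral>\<^sup>+ S'. (rest_integral k m f S t S') \<partial>tilted_jumps {1..m} (\<lambda>_ _. 0) u) \<in> borel_measurable M"
  using t assms(2)
  by (intro measurable_inner_integral[OF _ _ assms(1) prob_space_imp_sigma_finite[OF prob_tilted_jumps] sets_tilted_jumps] u)
    (auto cong: measurable_cong_sets)

text \<open>Brings the claimed law into the shape of \<open>marked_integral\<close>: both integrate
  \<open>rest_integral\<close> over the jumps of the allocated and of the remaining atoms, so
  comparing them reduces to comparing constants.\<close>

lemma nn_integral_post:
  assumes f: "f \<in> borel_measurable (V)"
  shows "(\<integral>\<^sup>+ \<mu>. f \<mu> \<partial>post k c t u) = (\<Sum>m. ennreal (pmf (q_star d q h k u) m) *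
    (\<integral>\<^sup>+ S. (\<integral>\<^sup>+ S'. (rest_integral k m f S t S') \<partial>tilted_jumps {1..m} (\<lambda>_ _. 0) u) \<partial>tilted_jumps {1..k} c u))"
proof -
  let ?A = "allocated_law d P0 h k t c u" and ?q = "q_star d q h k u"
  let ?V = "V"
  let ?B = "vec_ifpp d ?q (\<lambda>j. H_star (h j) (u j)) P0"
  let ?T = "tilted_jumps {1..k} c u" and ?T' = "\<lambda>m. tilted_jumps {1..m} (\<lambda>_ _. 0) u"
  interpret B: prob_space ?B by (rule prob_non_allocated)
  have sup: "(\<lambda>(a, b). vec_superpose d a b) \<in> ?A \<Otimes>\<^sub>M ?B \<rightarrow>\<^sub>M ?V"
    using measurable_vec_superpose[of d P0] unfolding vec_superpose_def
    by (simp add: sets_allocated_law sets_non_allocated cong: measurable_cong_sets sets_pair_measure_cong)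
  have f2: "(\<lambda>(a, b). f (vec_superpose d a b)) \<in> borel_measurable (?A \<Otimes>\<^sub>M ?B)"
    using measurable_compose[OF sup f] by (simp add: split_beta)
  have "(\<integral>\<^sup>+ \<mu>. f \<mu> \<partial>post k c t u) = (\<integral>\<^sup>+ z. f (vec_superpose d (fst z) (snd z)) \<partial>(?A \<Otimes>\<^sub>M ?B))"
    unfolding post_def superposition_law_def vec_superpose_def[symmetric]
    by (subst nn_integral_distr[OF sup]) (simp_all add: f case_prod_beta')
  also have "\<dots> = (\<integral>\<^sup>+ a. \<integral>\<^sup>+ b. f (vec_superpose d a b) \<partial>?B \<partial>?A)"
    using B.nn_integral_fst[OF f2] by (simp add: case_prod_beta')
  also have "\<dots> = (\<integral>\<^sup>+ S. \<integral>\<^sup>+ b. f (vec_superpose d (atoms {1..k} S t) b) \<partial>?B \<partial>?T)"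
  proof -
    have "(\<lambda>a. \<integral>\<^sup>+ b. f (vec_superpose d a b) \<partial>?B) \<in> borel_measurable ?V"
      using B.borel_measurable_nn_integral[OF f2]
      by (simp add: sets_allocated_law cong: measurable_cong_sets)
    then show ?thesis
      unfolding allocated_law_flat
      by (subst nn_integral_distr) (auto intro!: measurable_vec_atoms_t sets_tilted_jumps)
  qed
  also have "\<dots> = (\<integral>\<^sup>+ S. (\<Sum>m. ennreal (pmf ?q m) *
      (\<integral>\<^sup>+ S'. (rest_integral k m f S t S') \<partial>?T' m)) \<partial>?T)"
  proof (rule nn_integral_cong)
    fix S assume "S \<in> space ?T"
    then have a: "atoms {1..k} S t \<in> space ?V"
      by (rule measurable_space[OF measurable_vec_atoms_t[OF sets_tilted_jumps]])
    let ?f = "\<lambda>b. f (vec_superpose d (atoms {1..k} S t) b)"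
    have f': "?f \<in> borel_measurable ?V"
      using a by (intro measurable_compose[OF measurable_vec_superpose_compose f]) auto
    have "(\<integral>\<^sup>+ b. ?f b \<partial>?B) = (\<Sum>m. ennreal (pmf ?q m) *
        (\<integral>\<^sup>+ z. ?f (atoms {1..m} (fst z) (snd z)) \<partial>(?T' m \<Otimes>\<^sub>M locs {1..m})))"
      unfolding H_star_eq_tilted tilted_jumps_def
      using nn_integral_vec_ifpp[OF d P0 _ _ f', of "\<lambda>j. tilted (h j) 0 (u j)" ?q]
      by (simp add: prob_space_tilted h u sets_tilted case_prod_beta')
    also have "\<dots> = (\<Sum>m. ennreal (pmf ?q m) * (\<integral>\<^sup>+ S'. (\<integral>\<^sup>+ \<tau>. ?f (atoms {1..m} S' \<tau>)
        \<partial>locs {1..m}) \<partial>?T' m))"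
    proof -
      have "(\<integral>\<^sup>+ z. ?f (atoms {1..m} (fst z) (snd z)) \<partial>(?T' m \<Otimes>\<^sub>M locs {1..m}))
          = (\<integral>\<^sup>+ S'. (\<integral>\<^sup>+ \<tau>. ?f (atoms {1..m} S' \<tau>) \<partial>locs {1..m}) \<partial>?T' m)" for m
        using measurable_compose[OF measurable_vec_atoms_pair[OF _ sets_tilted_jumps] f']
        by (subst sigma_finite_measure.nn_integral_fst[OF sigma_finite_locs, symmetric]) (simp_all add: split_beta)
      then show ?thesis by simp
    qed
    finally show "(\<integral>\<^sup>+ b. ?f b \<partial>?B) = \<dots>" .
  qed
  also have "\<dots> = (\<Sum>m. (\<integral>\<^sup>+ S. ennreal (pmf ?q m) *
      (\<integral>\<^sup>+ S'. (rest_integral k m f S t S') \<partial>?T' m) \<partial>?T))"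
    by (intro nn_integral_suminf borel_measurable_times_ennreal borel_measurable_const
        measurable_inner_integral_t[OF f] sets_tilted_jumps)
  finally show ?thesis
    by (simp add: nn_integral_cmult measurable_inner_integral_t[OF f] sets_tilted_jumps)
qed

text \<open>The change of measure is applied twice. The inner one, with all counts 0, produces the
  powers of the Laplace transforms; the outer one produces the moments of the allocated jumps, which
  depend neither on \<open>m\<close> nor on \<open>f\<close>.\<close>

lemma marked_integral_eq:
  assumes f: "f \<in> borel_measurable (V)"
  shows "marked_integral k c t u m f =
    ennreal (moment_prod {1..k} c u) * (ennreal (\<Prod>j\<in>{1..d}. laplace (h j) (u j) ^ m) *
    (\<integral>\<^sup>+ S. (\<integral>\<^sup>+ S'. (rest_integral k m f S t S') \<partial>tilted_jumps {1..m} (\<lambda>_ _. 0) u) \<partial>tilted_jumps {1..k} c u))"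
proof -
  let ?l = "ennreal (\<Prod>j\<in>{1..d}. laplace (h j) (u j) ^ m)"
  let ?F = "\<lambda>S S'. (rest_integral k m f S t S')"
  let ?T' = "tilted_jumps {1..m} (\<lambda>_ _. 0) u"
  have "marked_integral k c t u m f = (\<integral>\<^sup>+ S. tilt_weight d {1..k} c u S * (?l * (\<integral>\<^sup>+ S'. ?F S S' \<partial>?T')) \<partial>base {1..k})"
    unfolding marked_integral_def
  proof (intro nn_integral_cong arg_cong2[where f = times] refl)
    fix S assume S: "S \<in> space (base {1..k})"
    have a: "atoms {1..k} S t \<in> space (V)"
      by (rule measurable_space[OF measurable_vec_atoms_t[OF sets_base] S])
    have "(\<lambda>z. f (vec_superpose d (atoms {1..k} S t) (atoms {1..m} (fst z) (snd z))))
        \<in> borel_measurable (jumps d {1..m} \<Otimes>\<^sub>M locs {1..m})"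
      by (intro measurable_compose[OF measurable_vec_superpose_compose f] measurable_const a
          measurable_vec_atoms measurable_fst measurable_snd) simp
    then have "?F S \<in> borel_measurable (jumps d {1..m})"
      by (intro sigma_finite_measure.borel_measurable_nn_integral[OF sigma_finite_locs]) (simp add: case_prod_beta')
    then show "(\<integral>\<^sup>+ S'. exp_weight {1..m} u S' * ?F S S' \<partial>base {1..m}) = ?l * (\<integral>\<^sup>+ S'. ?F S S' \<partial>?T')"
      by (subst nn_integral_tilt_base) (simp_all add: u moment_prod_0)
  qed
  also have "\<dots> = ennreal (moment_prod {1..k} c u) * (\<integral>\<^sup>+ S. ?l * (\<integral>\<^sup>+ S'. ?F S S' \<partial>?T') \<partial>tilted_jumps {1..k} c u)"
    using measurable_inner_integral_t[OF f, of "jumps d {1..k}" m] by (intro nn_integral_tilt_base u) simp_all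
  finally show ?thesis
    by (simp add: nn_integral_cmult measurable_inner_integral_t[OF f] sets_tilted_jumps)
qed

text \<open>The Laplace powers combine with the prior and factorial factors to the weights of
  \<open>q_star\<close>, up to their sum. The constant in front of the posterior integral is
  independent of \<open>f\<close>, so it cancels in the quotient of joint and marginal mass. The
  hypothesis on \<open>N\<close> makes the sum of the weights positive, as \<open>pmf_q_star\<close>
  demands.\<close>

lemma sum_marked_integral:
  assumes f: "f \<in> borel_measurable (V)" and N: "k \<le> N" "0 < pmf q N"
  shows "(\<Sum>m. ennreal (pmf q (m + k) * (fact (m + k) / fact m)) * marked_integral k c t u m f)
    = ennreal (moment_prod {1..k} c u) * ennreal (\<Sum>m. q_star_weight d q h k u m) * (\<integral>\<^sup>+ \<mu>. f \<mu> \<partial>post k c t u)"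
proof -
  let ?Z = "\<Sum>m. q_star_weight d q h k u m" and ?C = "ennreal (moment_prod {1..k} c u)"
  let ?I = "\<lambda>m. (\<integral>\<^sup>+ S. (\<integral>\<^sup>+ S'. (rest_integral k m f S t S') \<partial>tilted_jumps {1..m} (\<lambda>_ _. 0) u) \<partial>tilted_jumps {1..k} c u)"
  have Z: "0 < ?Z" by (rule suminf_q_star_weight_pos[OF d h u N])
  have "ennreal (pmf q (m + k) * (fact (m + k) / fact m)) * marked_integral k c t u m f
      = ?C * ennreal ?Z * (ennreal (pmf (q_star d q h k u) m) * ?I m)" for m
  proof -
    have l: "0 \<le> (\<Prod>j\<in>{1..d}. laplace (h j) (u j) ^ m)"
      unfolding moment_prod_0[symmetric] by (rule less_imp_le[OF moment_prod_pos[OF u]])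
    have "ennreal (pmf q (m + k) * (fact (m + k) / fact m)) * ennreal (\<Prod>j\<in>{1..d}. laplace (h j) (u j) ^ m)
        = ennreal (q_star_weight d q h k u m)"
      using l by (simp add: q_star_weight_def ennreal_mult[symmetric])
    also have "\<dots> = ennreal ?Z * ennreal (pmf (q_star d q h k u) m)"
      using Z q_star_weight_nonneg[of d h u q k m, OF d h u]
      by (subst pmf_q_star[OF d h u Z]) (simp_all add: ennreal_mult[symmetric])
    finally have *: "ennreal (pmf q (m + k) * (fact (m + k) / fact m)) * ennreal (\<Prod>j\<in>{1..d}. laplace (h j) (u j) ^ m)
        = ennreal ?Z * ennreal (pmf (q_star d q h k u) m)" .
    have "ennreal (pmf q (m + k) * (fact (m + k) / fact m)) * marked_integral k c t u m f
        = ?C * (ennreal (pmf q (m + k) * (fact (m + k) / fact m)) * ennreal (\<Prod>j\<in>{1..d}. laplace (h j) (u j) ^ m)) * ?I m"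
      unfolding marked_integral_eq[OF f] by (simp only: mult_ac)
    then show ?thesis unfolding * by (simp only: mult_ac)
  qed
  then show ?thesis
    by (simp add: nn_integral_post[OF f])
qed

end

end

subsection \<open>The law of the observations given the atoms\<close>

lemma sigma_finite_PiM_lborel: "sigma_finite_measure (\<Pi>\<^sub>M j\<in>{1..d::nat}. (lborel :: real measure))"
proof -
  interpret product_sigma_finite "\<lambda>_::nat. lborel :: real measure"
    by standard
  show ?thesis by (rule sigma_finite) simp
qed

text \<open>The power \<open>r ^ n\<close> is set apart because \<open>r\<close> will be the total
  mass of a random measure and is to cancel the denominators of the normalised jumps. The indicator
  of the positive half line later forces \<open>u j > 0\<close>.\<close>

lemma gamma_dist_eq_density:
  assumes "0 < r" "1 \<le> n"
  shows "gamma_dist n r = density lborel (\<lambda>x. ennreal (r ^ n) *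
    (ennreal (indicator {0<..} x * x ^ (n - 1) / fact (n - 1)) * ennreal (exp (- x * r))))"
  unfolding gamma_dist_def
proof (rule density_cong)
  \<comment> \<open>For \<open>n = 1\<close> the two densities differ at 0, where the Erlang density
    is \<open>r\<close> and the indicator is 0.\<close>
  have "AE x in lborel. x \<noteq> (0::real)" by (rule AE_lborel_singleton)
  then show "AE x in lborel. ennreal (erlang_density (n - 1) r x) = ennreal (r ^ n) *
    (ennreal (indicator {0<..} x * x ^ (n - 1) / fact (n - 1)) * ennreal (exp (- x * r)))"
  proof eventually_elim
    case (elim x)
    show ?case
      using assms elim
      by (cases "x < 0") (simp_all add: erlang_density_def ennreal_mult[symmetric] mult_ac)
  qed
qed auto

lemma prob_space_gamma_dist: "0 < r \<Longrightarrow> prob_space (gamma_dist n r)"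
  unfolding gamma_dist_def by (rule prob_space_erlang_density)

text \<open>With \<open>N \<ge> 1\<close> and positive jumps the total mass is positive and finite,
  so rescaling by its inverse gives a probability in which the mass at label \<open>m\<close> is its
  share of the total.\<close>

lemma
  fixes S :: "nat \<times> nat \<Rightarrow> real"
  assumes S: "\<And>m. m \<in> {1..N} \<Longrightarrow> 0 < S (j, m)" and \<tau>: "\<And>m. m \<in> {1..N} \<Longrightarrow> \<tau> m \<in> space T" and N: "1 \<le> N"
  shows emeasure_normalize_dirac_sum: "A \<in> sets T \<Longrightarrow>
      emeasure (normalize_measure (dirac_sum T {1..N} (\<lambda>m. S (j, m)) \<tau>)) A
        = (\<Sum>m\<in>{1..N}. ennreal (S (j, m) / (\<Sum>m\<in>{1..N}. S (j, m))) * indicator A (\<tau> m))" (is "_ \<Longrightarrow> ?e A")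
    and prob_space_normalize_dirac_sum:
      "prob_space (normalize_measure (dirac_sum T {1..N} (\<lambda>m. S (j, m)) \<tau>))"
    and measure_dirac_sum_space:
      "measure (dirac_sum T {1..N} (\<lambda>m. S (j, m)) \<tau>) (space (dirac_sum T {1..N} (\<lambda>m. S (j, m)) \<tau>))
        = (\<Sum>m\<in>{1..N}. S (j, m))"
proof -
  let ?\<mu> = "dirac_sum T {1..N} (\<lambda>m. S (j, m)) \<tau>" and ?t = "\<Sum>m\<in>{1..N}. S (j, m)"
  have t: "0 < ?t" using S N by (intro sum_pos) auto
  have "emeasure ?\<mu> (space ?\<mu>) = (\<Sum>m\<in>{1..N}. ennreal (S (j, m)))"
    unfolding space_dirac_sum emeasure_dirac_sum[OF finite_atLeastAtMost sets.top]
    by (intro sum.cong refl) (simp add: \<tau>)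
  also have "\<dots> = ennreal ?t"
    using S by (intro sum_ennreal less_imp_le) auto
  finally have tot: "emeasure ?\<mu> (space ?\<mu>) = ennreal ?t" .
  then show "measure ?\<mu> (space ?\<mu>) = ?t"
    using t by (simp add: measure_def)
  show *: "?e A" if "A \<in> sets T" for A
  proof -
    have "emeasure (normalize_measure ?\<mu>) A = ennreal (1 / ?t) * emeasure ?\<mu> A"
      using t by (simp add: normalize_measure_def tot inverse_ennreal inverse_eq_divide)
    also have "\<dots> = (\<Sum>m\<in>{1..N}. ennreal (1 / ?t) * (ennreal (S (j, m)) * indicator A (\<tau> m)))"
      using that by (simp add: emeasure_dirac_sum sum_distrib_left del: sum_mult_indicator)
    also have "\<dots> = (\<Sum>m\<in>{1..N}. ennreal (S (j, m) / ?t) * indicator A (\<tau> m))"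
      using S t by (intro sum.cong refl) (simp add: mult.assoc[symmetric] ennreal_mult[symmetric] less_imp_le)
    finally show ?thesis .
  qed
  have "emeasure (normalize_measure ?\<mu>) (space T) = (\<Sum>m\<in>{1..N}. ennreal (S (j, m) / ?t))"
    unfolding *[OF sets.top] by (intro sum.cong refl) (simp add: \<tau>)
  also have "\<dots> = ennreal (\<Sum>m\<in>{1..N}. S (j, m) / ?t)"
    using S t by (intro sum_ennreal divide_nonneg_pos less_imp_le) auto
  also have "\<dots> = 1" using t by (simp add: sum_divide_distrib[symmetric])
  finally show "prob_space (normalize_measure ?\<mu>)"
    by (intro prob_spaceI) (simp add: normalize_measure_def space_scale_measure space_dirac_sum)
qed

lemma sets_normalize_measure: "sets (normalize_measure \<mu>) = sets \<mu>"
  by (simp add: normalize_measure_def)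

context vec_mixture
begin

abbreviation obs_index :: "(nat \<times> nat) set" where
  "obs_index \<equiv> SIGMA j:{1..d}. {1..n j}"

abbreviation leb :: "(nat \<Rightarrow> real) measure" where
  "leb \<equiv> \<Pi>\<^sub>M j\<in>{1..d}. lborel"

definition data :: "(nat \<times> nat \<Rightarrow> nat) \<Rightarrow> (nat \<Rightarrow> 'a) \<Rightarrow> nat \<Rightarrow> nat \<Rightarrow> 'a" where
  "data c \<tau> = (\<lambda>j\<in>{1..d}. \<lambda>i\<in>{1..n j}. \<tau> (c (j, i)))"

text \<open>The part of the Gamma densities that depends on \<open>u\<close> alone. What is left of
  them are powers of the total masses and the exponentials collected in
  \<open>exp_weight\<close>.\<close>

definition aux_weight :: "(nat \<Rightarrow> real) \<Rightarrow> ennreal" where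
  "aux_weight u = (\<Prod>j\<in>{1..d}. ennreal (indicator {0<..} (u j) * u j ^ (n j - 1) / fact (n j - 1)))"

definition pick :: "(nat \<times> nat \<Rightarrow> nat) \<Rightarrow> (nat \<times> nat \<Rightarrow> real) \<Rightarrow> ennreal" where
  "pick c S = (\<Prod>l\<in>obs_index. ennreal (S (fst l, c l)))"

lemma sets_aux_space: "sets (aux_space d) = sets leb"
  unfolding aux_space_def by (rule sets_PiM_cong) auto

text \<open>In each group the exponents add up to the total mass of the random measure, which is the
  form in which the Gamma density supplies them.\<close>

lemma tilt_weight_0:
  "finite I \<Longrightarrow> exp_weight I u S = (\<Prod>j\<in>{1..d}. ennreal (exp (- u j * (\<Sum>m\<in>I. S (j, m)))))"
proof -
  assume "finite I"
  have "exp_weight I u S = (\<Prod>j\<in>{1..d}. \<Prod>m\<in>I. ennreal (exp (- u j * S (j, m))))"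
    unfolding tilt_weight_def using \<open>finite I\<close> by (subst prod.Sigma) (auto simp: split_beta)
  also have "\<dots> = (\<Prod>j\<in>{1..d}. ennreal (exp (- u j * (\<Sum>m\<in>I. S (j, m)))))"
    using \<open>finite I\<close> by (simp add: prod_ennreal exp_sum[symmetric] sum_distrib_left sum_negf)
  finally show ?thesis .
qed

text \<open>The auxiliary variables are integrated with the data fixed, which leaves a function
  \<open>\<phi>\<close> of the data and a constant. The data have a discrete law; its expansion over
  allocations is applied to \<open>\<phi>\<close>.\<close>

lemma sampling_law_vec_atoms:
  assumes N: "1 \<le> N" and S: "S \<in> space (base {1..N})" and \<tau>: "\<tau> \<in> space (locs {1..N})"
    and B: "B \<in> sets Y_space"
  shows "emeasure (sampling_law d n (atoms {1..N} S \<tau>)) B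
    = (\<Sum>c\<in>obs_index \<rightarrow>\<^sub>E {1..N}. pick c S * (\<integral>\<^sup>+ u. aux_weight u *
        (exp_weight {1..N} u S * indicator B (data c \<tau>, u)) \<partial>leb))"
proof -
  define \<mu> where "\<mu> = (\<lambda>j. dirac_sum P0 {1..N} (\<lambda>m. S (j, m)) \<tau>)"
  define t where "t = (\<lambda>j. \<Sum>m\<in>{1..N}. S (j, m))"
  have "S \<in> space (jumps d {1..N})"
    using S by (simp add: sets_eq_imp_space_eq[OF sets_base])
  then have S: "0 < S (j, m)" if "j \<in> {1..d}" "m \<in> {1..N}" for j m
    using that by (auto simp: space_PiM PiE_iff)
  have \<tau>: "\<tau> m \<in> space P0" if "m \<in> {1..N}" for m
    using \<tau> that by (auto simp: space_PiM)
  have t: "0 < t j" if "j \<in> {1..d}" for j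
    unfolding t_def using S[OF that] N by (intro sum_pos) auto
  have nS: "emeasure (normalize_measure (\<mu> j)) A = (\<Sum>m\<in>{1..N}. ennreal (S (j, m) / t j) * indicator A (\<tau> m))"
    if "j \<in> {1..d}" "A \<in> sets P0" for j A
    unfolding \<mu>_def t_def by (rule emeasure_normalize_dirac_sum[where S = S and \<tau> = \<tau>, OF S[OF that(1)] \<tau> N that(2)])
  have pS: "prob_space (normalize_measure (\<mu> j))" if "j \<in> {1..d}" for j
    unfolding \<mu>_def by (rule prob_space_normalize_dirac_sum[where S = S and \<tau> = \<tau>, OF S[OF that] \<tau> N])
  have mS: "measure (\<mu> j) (space (\<mu> j)) = t j" if "j \<in> {1..d}" for j
    unfolding \<mu>_def t_def by (rule measure_dirac_sum_space[where S = S and \<tau> = \<tau>, OF S[OF that] \<tau> N])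
  have [measurable]: "(\<lambda>u. u j) \<in> borel_measurable leb" if "j \<in> {1..d}" for j
    using measurable_component_singleton[OF that, of "\<lambda>_. lborel :: real measure"] by simp
  let ?O = "\<Pi>\<^sub>M j\<in>{1..d}. \<Pi>\<^sub>M i\<in>{1..n j}. normalize_measure (\<mu> j)"
  let ?G = "\<Pi>\<^sub>M j\<in>{1..d}. gamma_dist (n j) (t j)"
  let ?w = "\<lambda>j x. ennreal (indicator {0<..} x * x ^ (n j - 1) / fact (n j - 1))"
  let ?C = "ennreal (\<Prod>j\<in>{1..d}. t j ^ n j)"
  have law: "sampling_law d n (atoms {1..N} S \<tau>) = ?O \<Otimes>\<^sub>M ?G"
    unfolding sampling_law_def by (intro arg_cong2[where f = pair_measure] PiM_cong refl)
      (simp_all add: vec_atoms_def \<mu>_def[symmetric] mS)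
  have sO: "sets ?O = sets (obs_space d n P0)"
    unfolding obs_space_def by (intro sets_PiM_cong refl) (simp add: sets_normalize_measure \<mu>_def sets_dirac_sum)
  have sG: "sets ?G = sets (aux_space d)"
    unfolding aux_space_def by (intro sets_PiM_cong refl) (simp add: gamma_dist_def)
  have [measurable]: "(\<lambda>u. \<Prod>j\<in>{1..d}. ennreal (t j ^ n j) * (?w j (u j) * ennreal (exp (- u j * t j)))) \<in> borel_measurable leb"
    by (rule borel_measurable_prod_ennreal) measurable
  have G: "?G = density leb (\<lambda>u. \<Prod>j\<in>{1..d}. ennreal (t j ^ n j) * (?w j (u j) * ennreal (exp (- u j * t j))))"
  proof -
    have "?G = PiM {1..d} (\<lambda>j. density lborel (\<lambda>x. ennreal (t j ^ n j) * (?w j x * ennreal (exp (- x * t j)))))"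
      by (intro PiM_cong refl gamma_dist_eq_density t n)
    also have "\<dots> = density leb (\<lambda>u. \<Prod>j\<in>{1..d}. ennreal (t j ^ n j) * (?w j (u j) * ennreal (exp (- u j * t j))))"
    proof (rule density_PiM[symmetric])
      show "sigma_finite_measure (density lborel (\<lambda>x. ennreal (t j ^ n j) * (?w j x * ennreal (exp (- x * t j)))))"
        if "j \<in> {1..d}" for j
        unfolding gamma_dist_eq_density[OF t[OF that] n[OF that], symmetric]
        by (intro prob_space_imp_sigma_finite prob_space_gamma_dist t that)
    qed (simp_all add: lborel.sigma_finite_measure_axioms)
    finally show ?thesis .
  qed
  have w_eq: "(\<Prod>j\<in>{1..d}. ennreal (t j ^ n j) * (?w j (u j) * ennreal (exp (- u j * t j))))
      = ?C * (aux_weight u * exp_weight {1..N} u S)" for u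
  proof -
    have "(\<Prod>j\<in>{1..d}. ennreal (t j ^ n j)) = ?C"
      by (intro prod_ennreal zero_le_power less_imp_le t)
    then show ?thesis
      by (simp add: prod.distrib aux_weight_def tilt_weight_0 t_def mult_ac)
  qed
  have pG: "prob_space ?G"
    by (intro prob_space_PiM prob_space_gamma_dist t)
  define \<phi> where "\<phi> = (\<lambda>x. \<integral>\<^sup>+ u. aux_weight u * (exp_weight {1..N} u S * indicator B (x, u)) \<partial>leb)"
  have Bm[measurable]: "B \<in> sets (obs_space d n P0 \<Otimes>\<^sub>M leb)"
    using B sets_aux_space by (simp cong: sets_pair_measure_cong)
  have [measurable]: "aux_weight \<in> borel_measurable leb"
    unfolding aux_weight_def by (rule borel_measurable_prod_ennreal) measurable
  have [measurable]: "(\<lambda>u. exp_weight {1..N} u S) \<in> borel_measurable leb"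
    unfolding tilt_weight_0[OF finite_atLeastAtMost] by (rule borel_measurable_prod_ennreal) measurable
  have \<phi>: "\<phi> \<in> borel_measurable (obs_space d n P0)"
    unfolding \<phi>_def by (rule sigma_finite_measure.borel_measurable_nn_integral[OF sigma_finite_PiM_lborel]) measurable
  have "emeasure (sampling_law d n (atoms {1..N} S \<tau>)) B = (\<integral>\<^sup>+ x. \<integral>\<^sup>+ u. indicator B (x, u) \<partial>?G \<partial>?O)"
    unfolding law using B sO sG
    by (intro sigma_finite_measure.emeasure_pair_measure prob_space_imp_sigma_finite pG)
      (simp cong: sets_pair_measure_cong)
  also have "\<dots> = (\<integral>\<^sup>+ x. ?C * \<phi> x \<partial>?O)"
  proof (rule nn_integral_cong)
    fix x assume "x \<in> space ?O"
    then have x[measurable]: "x \<in> space (obs_space d n P0)" using sets_eq_imp_space_eq[OF sO] by simp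
    have "(\<integral>\<^sup>+ u. indicator B (x, u) \<partial>?G) = (\<integral>\<^sup>+ u. ?C * (aux_weight u * exp_weight {1..N} u S) * indicator B (x, u) \<partial>leb)"
      unfolding G by (subst nn_integral_density, measurable) (simp only: w_eq)
    also have "\<dots> = ?C * \<phi> x"
      unfolding \<phi>_def by (subst nn_integral_cmult[symmetric]) (auto simp: mult.assoc)
    finally show "(\<integral>\<^sup>+ u. indicator B (x, u) \<partial>?G) = ?C * \<phi> x" .
  qed
  also have "\<dots> = ?C * (\<integral>\<^sup>+ x. \<phi> x \<partial>?O)"
    by (rule nn_integral_cmult) (simp add: measurable_cong_sets[OF sO refl] \<phi>)
  also have "(\<integral>\<^sup>+ x. \<phi> x \<partial>?O) = (\<Sum>c\<in>obs_index \<rightarrow>\<^sub>E {1..N}. (\<Prod>l\<in>obs_index. ennreal (S (fst l, c l) / t (fst l))) * \<phi> (data c \<tau>))"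
  proof -
    let ?P = "PiM obs_index (\<lambda>(j, i). normalize_measure (\<mu> j))"
    let ?nest = "\<lambda>\<omega>. \<lambda>j\<in>{1..d}. \<lambda>i\<in>{1..n j}. \<omega> (j, i)"
    have nest: "?nest \<in> PiM obs_index (\<lambda>_. P0) \<rightarrow>\<^sub>M obs_space d n P0"
      unfolding obs_space_def by (intro measurable_restrict measurable_component_singleton) auto
    have sP: "sets ?P = sets (PiM obs_index (\<lambda>_. P0))"
      by (intro sets_PiM_cong refl) (auto simp: sets_normalize_measure \<mu>_def sets_dirac_sum)
    have O: "?O = distr ?P ?O ?nest"
      using d by (intro PiM_curry[symmetric] pS) auto
    have "(\<integral>\<^sup>+ x. \<phi> x \<partial>?O) = (\<integral>\<^sup>+ \<omega>. \<phi> (?nest \<omega>) \<partial>?P)"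
      using nest \<phi> by (subst O, subst nn_integral_distr) (simp_all add: measurable_cong_sets[OF sP sO] measurable_cong_sets[OF sO refl])
    also have "\<dots> = (\<Sum>c\<in>obs_index \<rightarrow>\<^sub>E {1..N}. (\<Prod>l\<in>obs_index. ennreal (S (fst l, c l) / t (fst l)))
        * \<phi> (?nest (\<lambda>l\<in>obs_index. \<tau> (c l))))"
    proof (rule PiM_point_mass)
      show "(\<lambda>\<omega>. \<phi> (?nest \<omega>)) \<in> borel_measurable (PiM obs_index (\<lambda>_. P0))"
        by (rule measurable_compose[OF nest \<phi>])
      show "\<tau> m \<in> space P0" if "m \<in> {1..N}" for m by (rule \<tau>[OF that])
      fix l assume "l \<in> obs_index"
      then obtain j i where l: "l = (j, i)" "j \<in> {1..d}" by auto
      show "sets (case l of (j, i) \<Rightarrow> normalize_measure (\<mu> j)) = sets P0"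
        by (simp add: l sets_normalize_measure \<mu>_def sets_dirac_sum)
      show "sigma_finite_measure (case l of (j, i) \<Rightarrow> normalize_measure (\<mu> j))"
        using l by (auto intro!: prob_space_imp_sigma_finite pS)
      show "emeasure (case l of (j, i) \<Rightarrow> normalize_measure (\<mu> j)) A
          = (\<Sum>m\<in>{1..N}. ennreal (S (fst l, m) / t (fst l)) * indicator A (\<tau> m))" if "A \<in> sets P0" for A
        unfolding l using nS[OF l(2) that] by simp
    qed simp_all
    also have "(\<lambda>c. ?nest (\<lambda>l\<in>obs_index. \<tau> (c l))) = (\<lambda>c. data c \<tau>)"
      unfolding data_def by (intro ext restrict_ext) auto
    finally show ?thesis .
  qed
  also have "?C * (\<Sum>c\<in>obs_index \<rightarrow>\<^sub>E {1..N}. (\<Prod>l\<in>obs_index. ennreal (S (fst l, c l) / t (fst l))) * \<phi> (data c \<tau>))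
      = (\<Sum>c\<in>obs_index \<rightarrow>\<^sub>E {1..N}. pick c S * \<phi> (data c \<tau>))"
    unfolding sum_distrib_left
  proof (rule sum.cong[OF refl])
    fix c assume c: "c \<in> obs_index \<rightarrow>\<^sub>E {1..N}"
    \<comment> \<open>Group \<open>j\<close> has \<open>n j\<close> observations, so the constant
      supplies exactly one factor \<open>t j\<close> to each of them.\<close>
    have 1: "(\<Prod>l\<in>obs_index. t (fst l)) = (\<Prod>j\<in>{1..d}. t j ^ n j)"
      by (subst prod.Sigma[symmetric, where g = "\<lambda>j i. t j", unfolded case_prod_beta']) auto
    have "?C * (\<Prod>l\<in>obs_index. ennreal (S (fst l, c l) / t (fst l))) = (\<Prod>l\<in>obs_index. ennreal (t (fst l)) * ennreal (S (fst l, c l) / t (fst l)))"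
      using t by (subst 1[symmetric], subst prod_ennreal[symmetric]) (auto simp: prod.distrib less_imp_le)
    also have "\<dots> = pick c S"
      unfolding pick_def
    proof (rule prod.cong[OF refl])
      fix l assume l: "l \<in> obs_index"
      then have "fst l \<in> {1..d}" "c l \<in> {1..N}" using c by auto
      then have "0 < t (fst l)" "0 < S (fst l, c l)" by (auto intro: t S)
      then show "ennreal (t (fst l)) * ennreal (S (fst l, c l) / t (fst l)) = ennreal (S (fst l, c l))"
        by (simp add: ennreal_mult[symmetric])
    qed
    finally show "?C * ((\<Prod>l\<in>obs_index. ennreal (S (fst l, c l) / t (fst l))) * \<phi> (data c \<tau>)) = pick c S * \<phi> (data c \<tau>)"
      by (simp add: mult.assoc[symmetric])
  qed
  finally show ?thesis unfolding \<phi>_def .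
qed

end

subsection \<open>Allocations of observations to atoms\<close>

lemma nn_integral_swap:
  assumes "sigma_finite_measure M" "sigma_finite_measure N"
    and "(\<lambda>(x, y). f x y) \<in> borel_measurable (M \<Otimes>\<^sub>M N)"
  shows "(\<integral>\<^sup>+ x. \<integral>\<^sup>+ y. f x y \<partial>N \<partial>M) = (\<integral>\<^sup>+ y. \<integral>\<^sup>+ x. f x y \<partial>M \<partial>N)"
proof -
  interpret pair_sigma_finite M N using assms by (simp add: pair_sigma_finite_def)
  show ?thesis using Fubini'[OF assms(3)] by simp
qed

text \<open>\<open>R\<close> and \<open>{1..k}\<close> have equal cardinality, and so have their
  complements in \<open>{1..N}\<close>; bijections of both pairs are put together.\<close>

lemma ex_permutes_image:
  assumes R: "R \<subseteq> {1..N::nat}" "card R = k"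
  obtains \<sigma> where "\<sigma> permutes {1..N}" "\<sigma> ` {1..k} = R"
proof -
  have finR: "finite R" using R finite_subset by auto
  have k: "k \<le> N" using R card_mono[of "{1..N}" R] by simp
  obtain f where f: "bij_betw f {1..k} R"
    using finR R finite_same_card_bij[of "{1..k}" R] by auto
  have "card ({1..N} - {1..k}) = card ({1..N} - R)"
    using R k finR by (simp add: card_Diff_subset)
  then obtain g where g: "bij_betw g ({1..N} - {1..k}) ({1..N} - R)"
    using finite_same_card_bij[of "{1..N} - {1..k}" "{1..N} - R"] by auto
  define \<sigma> where "\<sigma> = (\<lambda>x. if x \<in> {1..k} then f x else if x \<in> {1..N} then g x else x)"
  have b1: "bij_betw \<sigma> {1..k} R"
    using f by (rule bij_betw_cong[THEN iffD1, rotated]) (simp add: \<sigma>_def)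
  have b2: "bij_betw \<sigma> ({1..N} - {1..k}) ({1..N} - R)"
    using g by (rule bij_betw_cong[THEN iffD1, rotated]) (simp add: \<sigma>_def)
  have "bij_betw \<sigma> ({1..k} \<union> ({1..N} - {1..k})) (R \<union> ({1..N} - R))"
    by (rule bij_betw_combine[OF b1 b2]) auto
  moreover have "{1..k} \<union> ({1..N} - {1..k}) = {1..N}" "R \<union> ({1..N} - R) = {1..N}"
    using k R by auto
  ultimately have "bij_betw \<sigma> {1..N} {1..N}" by simp
  then have "\<sigma> permutes {1..N}"
    by (rule bij_imp_permutes) (use k in \<open>auto simp: \<sigma>_def\<close>)
  with that b1 show thesis by (simp add: bij_betw_def)
qed

abbreviation surjections :: "'i set \<Rightarrow> nat \<Rightarrow> ('i \<Rightarrow> nat) set" where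
  "surjections L k \<equiv> {\<pi> \<in> L \<rightarrow>\<^sub>E {1..k}. \<pi> ` L = {1..k}}"

text \<open>The range of \<open>k\<close> does not depend on \<open>N\<close>, since for
  \<open>k > N\<close> the binomial coefficient is 0. This allows a series over \<open>N\<close> to
  be exchanged with the finite sum over \<open>k\<close> and the surjections.\<close>

lemma sum_functions_by_image:
  fixes \<Phi> :: "('i \<Rightarrow> nat) \<Rightarrow> ennreal"
  assumes L: "finite L"
    and inv: "\<And>\<sigma> c. \<sigma> permutes {1..N} \<Longrightarrow> c \<in> L \<rightarrow>\<^sub>E {1..N} \<Longrightarrow> \<Phi> (\<lambda>l\<in>L. \<sigma> (c l)) = \<Phi> c"
  shows "(\<Sum>c\<in>L \<rightarrow>\<^sub>E {1..N}. \<Phi> c)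
    = (\<Sum>k\<in>{..card L}. of_nat (N choose k) * (\<Sum>\<pi>\<in>surjections L k. \<Phi> \<pi>))"
proof -
  let ?F = "L \<rightarrow>\<^sub>E {1..N}"
  have fin: "finite ?F" using L by (intro finite_PiE) auto
  \<comment> \<open>a permutation mapping \<open>{1..k}\<close> onto \<open>R\<close> identifies the functions with image \<open>R\<close> with the surjections\<close>
  have img: "(\<Sum>c\<in>{c \<in> ?F. c ` L = R}. \<Phi> c) = (\<Sum>\<pi>\<in>surjections L k. \<Phi> \<pi>)"
    if R: "R \<subseteq> {1..N}" "card R = k" for R k
  proof -
    obtain \<sigma> where \<sigma>: "\<sigma> permutes {1..N}" "\<sigma> ` {1..k} = R"
      using ex_permutes_image[OF R] .
    have k: "k \<le> N" using R card_mono[of "{1..N}" R] by simp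
    have inj: "inj \<sigma>" using \<sigma>(1) by (rule permutes_inj)
    note inv\<sigma> = permutes_inverses[OF \<sigma>(1)]
    show ?thesis
    proof (rule sum.reindex_bij_witness[where i = "\<lambda>\<pi>. \<lambda>l\<in>L. \<sigma> (\<pi> l)" and j = "\<lambda>c. \<lambda>l\<in>L. inv \<sigma> (c l)"])
      fix c assume c: "c \<in> {c \<in> ?F. c ` L = R}"
      show "(\<lambda>l\<in>L. \<sigma> ((\<lambda>l\<in>L. inv \<sigma> (c l)) l)) = c"
        using c by (auto simp: fun_eq_iff inv\<sigma> PiE_iff extensional_def)
      have "(\<lambda>l\<in>L. inv \<sigma> (c l)) ` L = inv \<sigma> ` R"
        using c by auto
      also have "\<dots> = {1..k}" using \<sigma>(2) inj by (metis inv_f_f image_inv_f_f)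
      finally have "(\<lambda>l\<in>L. inv \<sigma> (c l)) ` L = {1..k}" .
      moreover from this have "(\<lambda>l\<in>L. inv \<sigma> (c l)) \<in> L \<rightarrow>\<^sub>E {1..k}"
        by auto
      ultimately show "(\<lambda>l\<in>L. inv \<sigma> (c l)) \<in> surjections L k" by simp
      show "\<Phi> (\<lambda>l\<in>L. inv \<sigma> (c l)) = \<Phi> c"
        using c by (intro inv permutes_inv \<sigma>(1)) auto
    next
      fix \<pi> assume \<pi>: "\<pi> \<in> surjections L k"
      show "(\<lambda>l\<in>L. inv \<sigma> ((\<lambda>l\<in>L. \<sigma> (\<pi> l)) l)) = \<pi>"
        using \<pi> by (auto simp: fun_eq_iff inv\<sigma> PiE_iff extensional_def)
      have "(\<lambda>l\<in>L. \<sigma> (\<pi> l)) ` L = \<sigma> ` (\<pi> ` L)" by auto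
      also have "\<dots> = R" using \<pi> \<sigma>(2) by simp
      finally have "(\<lambda>l\<in>L. \<sigma> (\<pi> l)) ` L = R" .
      moreover from this have "(\<lambda>l\<in>L. \<sigma> (\<pi> l)) \<in> ?F"
        using R(1) by (auto simp del: atLeastAtMost_iff)
      ultimately show "(\<lambda>l\<in>L. \<sigma> (\<pi> l)) \<in> {c \<in> ?F. c ` L = R}" by simp
    qed
  qed
  have "(\<Sum>c\<in>?F. \<Phi> c) = (\<Sum>k\<in>{..card L}. \<Sum>c\<in>{c \<in> ?F. card (c ` L) = k}. \<Phi> c)"
    using fin L by (intro sum.group[symmetric]) (auto intro: card_image_le)
  also have "\<dots> = (\<Sum>k\<in>{..card L}. of_nat (N choose k) * (\<Sum>\<pi>\<in>surjections L k. \<Phi> \<pi>))"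
  proof (rule sum.cong[OF refl])
    fix k
    let ?\<R> = "{R. R \<subseteq> {1..N} \<and> card R = k}"
    have "(\<Sum>c\<in>{c \<in> ?F. card (c ` L) = k}. \<Phi> c)
        = (\<Sum>R\<in>?\<R>. \<Sum>c\<in>{c \<in> {c \<in> ?F. card (c ` L) = k}. c ` L = R}. \<Phi> c)"
      using fin by (intro sum.group[symmetric]) auto
    also have "\<dots> = (\<Sum>R\<in>?\<R>. \<Sum>\<pi>\<in>surjections L k. \<Phi> \<pi>)"
    proof (rule sum.cong[OF refl])
      fix R assume R: "R \<in> ?\<R>"
      then have "{c \<in> {c \<in> ?F. card (c ` L) = k}. c ` L = R} = {c \<in> ?F. c ` L = R}" by auto
      then show "(\<Sum>c\<in>{c \<in> {c \<in> ?F. card (c ` L) = k}. c ` L = R}. \<Phi> c) = (\<Sum>\<pi>\<in>surjections L k. \<Phi> \<pi>)"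
        using img R by simp
    qed
    also have "\<dots> = of_nat (N choose k) * (\<Sum>\<pi>\<in>surjections L k. \<Phi> \<pi>)"
      using n_subsets[of "{1..N}" k] by simp
    finally show "(\<Sum>c\<in>{c \<in> ?F. card (c ` L) = k}. \<Phi> c) = of_nat (N choose k) * (\<Sum>\<pi>\<in>surjections L k. \<Phi> \<pi>)" .
  qed
  finally show ?thesis .
qed

context vec_mixture
begin

text \<open>For a fixed number of atoms and a fixed allocation, the density in \<open>u\<close>, up
  to \<open>aux_weight\<close>, of the joint law on the event \<open>B\<close> integrated against
  \<open>f\<close>.\<close>

definition mark_int :: "nat \<Rightarrow> (nat \<times> nat \<Rightarrow> nat) \<Rightarrow> ((nat \<Rightarrow> 'a measure) \<Rightarrow> ennreal)
    \<Rightarrow> ((nat \<Rightarrow> nat \<Rightarrow> 'a) \<times> (nat \<Rightarrow> real)) set \<Rightarrow> (nat \<Rightarrow> real) \<Rightarrow> ennreal" where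
  "mark_int N c f B u =
    (\<integral>\<^sup>+ z. exp_weight {1..N} u (fst z) * pick c (fst z) * indicator B (data c (snd z), u)
      * f (atoms {1..N} (fst z) (snd z)) \<partial>(base {1..N} \<Otimes>\<^sub>M locs {1..N}))"

lemma measurable_leb_component: "j \<in> {1..d} \<Longrightarrow> (\<lambda>u. u j) \<in> borel_measurable leb"
  using measurable_component_singleton[of j "{1..d}" "\<lambda>_. lborel :: real measure"] by simp

lemma measurable_aux_weight: "aux_weight \<in> borel_measurable leb"
  unfolding aux_weight_def
proof (rule borel_measurable_prod_ennreal)
  fix j assume "j \<in> {1..d}"
  then have [measurable]: "(\<lambda>u. u j) \<in> borel_measurable leb" by (rule measurable_leb_component)
  show "(\<lambda>u. ennreal (indicator {0<..} (u j) * u j ^ (n j - 1) / fact (n j - 1))) \<in> borel_measurable leb"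
    by measurable
qed

lemma measurable_data:
  assumes "c \<in> obs_index \<rightarrow> I"
  shows "data c \<in> locs I \<rightarrow>\<^sub>M obs_space d n P0"
  unfolding data_def obs_space_def
  by (intro measurable_restrict measurable_component_singleton) (use assms in auto)

lemma measurable_pick:
  assumes "c \<in> obs_index \<rightarrow> I" "S \<in> M \<rightarrow>\<^sub>M jumps d I"
  shows "(\<lambda>x. pick c (S x)) \<in> borel_measurable M"
  unfolding pick_def
proof (rule borel_measurable_prod_ennreal)
  fix l assume "l \<in> obs_index"
  then have "(\<lambda>x. S x (fst l, c l)) \<in> borel_measurable M"
    using assms by (intro measurable_jump[OF assms(2)]) auto
  then show "(\<lambda>x. ennreal (S x (fst l, c l))) \<in> borel_measurable M" by simp
qed

lemma measurable_indicator_data: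
  assumes "c \<in> obs_index \<rightarrow> I" "\<tau> \<in> M \<rightarrow>\<^sub>M locs I" "u \<in> M \<rightarrow>\<^sub>M leb"
    and "B \<in> sets Y_space"
  shows "(\<lambda>x. indicator B (data c (\<tau> x), u x) :: ennreal) \<in> borel_measurable M"
proof -
  have B': "B \<in> sets (obs_space d n P0 \<Otimes>\<^sub>M leb)"
    using assms(4) sets_aux_space by (simp cong: sets_pair_measure_cong)
  have "(\<lambda>x. (data c (\<tau> x), u x)) \<in> M \<rightarrow>\<^sub>M obs_space d n P0 \<Otimes>\<^sub>M leb"
    by (intro measurable_Pair measurable_compose[OF assms(2) measurable_data[OF assms(1)]] assms(3))
  from measurable_compose[OF this borel_measurable_indicator[OF B']] show ?thesis .
qed

lemma measurable_base: "f \<in> M \<rightarrow>\<^sub>M base I \<longleftrightarrow> f \<in> M \<rightarrow>\<^sub>M jumps d I"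
  by (simp add: measurable_cong_sets[OF refl sets_base])

lemma measurable_mark:
  assumes c: "c \<in> obs_index \<rightarrow> {1..N}" and f: "f \<in> borel_measurable (V)"
    and B: "B \<in> sets Y_space"
    and S: "S \<in> M \<rightarrow>\<^sub>M base {1..N}" and \<tau>: "\<tau> \<in> M \<rightarrow>\<^sub>M locs {1..N}" and u: "u \<in> M \<rightarrow>\<^sub>M leb"
  shows "(\<lambda>x. exp_weight {1..N} (u x) (S x) * pick c (S x) * indicator B (data c (\<tau> x), u x)
      * f (atoms {1..N} (S x) (\<tau> x))) \<in> borel_measurable M"
proof -
  note S = S[unfolded measurable_base]
  show ?thesis
    by (intro borel_measurable_times_ennreal measurable_pick[OF c S] measurable_indicator_data[OF c \<tau> u B]
        measurable_tilt_weight[OF _ S] measurable_compose[OF u measurable_leb_component]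
        measurable_compose[OF measurable_vec_atoms[OF _ S \<tau>] f]) auto
qed

lemma measurable_mark_int:
  assumes "c \<in> obs_index \<rightarrow> {1..N}" "f \<in> borel_measurable (V)"
    and "B \<in> sets Y_space"
  shows "mark_int N c f B \<in> borel_measurable leb"
  unfolding mark_int_def case_prod_beta'
proof (rule sigma_finite_measure.borel_measurable_nn_integral)
  show "sigma_finite_measure (base {1..N} \<Otimes>\<^sub>M locs {1..N})"
    by (intro prob_space_imp_sigma_finite prob_space_pair prob_base prob_locs)
  show "(\<lambda>(u, z). exp_weight {1..N} u (fst z) * pick c (fst z) * indicator B (data c (snd z), u)
      * f (atoms {1..N} (fst z) (snd z))) \<in> borel_measurable (leb \<Otimes>\<^sub>M (base {1..N} \<Otimes>\<^sub>M locs {1..N}))"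
    unfolding case_prod_beta' by (rule measurable_mark[OF assms]) measurable
qed

text \<open>The integral over \<open>u\<close> is brought outside, so that permuting and splitting
  the atoms can be carried out for fixed \<open>u\<close>.\<close>

lemma nn_integral_sampling_law:
  assumes N: "1 \<le> N" and f: "f \<in> borel_measurable (V)"
    and B: "B \<in> sets Y_space"
  shows "(\<integral>\<^sup>+ z. f (atoms {1..N} (fst z) (snd z)) *
      emeasure (sampling_law d n (atoms {1..N} (fst z) (snd z))) B \<partial>(base {1..N} \<Otimes>\<^sub>M locs {1..N}))
    = (\<integral>\<^sup>+ u. aux_weight u * (\<Sum>c\<in>obs_index \<rightarrow>\<^sub>E {1..N}. mark_int N c f B u) \<partial>leb)"
proof -
  let ?Z = "base {1..N} \<Otimes>\<^sub>M locs {1..N}"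
  let ?X = "\<lambda>c u z. exp_weight {1..N} u (fst z) * pick c (fst z) * indicator B (data c (snd z), u)
      * f (atoms {1..N} (fst z) (snd z))"
  have \<sigma>: "sigma_finite_measure ?Z"
    by (intro prob_space_imp_sigma_finite prob_space_pair prob_base prob_locs)
  have X: "(\<lambda>(z, u). aux_weight u * ?X c u z) \<in> borel_measurable (?Z \<Otimes>\<^sub>M leb)" if "c \<in> obs_index \<rightarrow>\<^sub>E {1..N}" for c
    unfolding case_prod_beta'
    by (intro borel_measurable_times_ennreal measurable_compose[OF measurable_snd measurable_aux_weight]
        measurable_mark[OF _ f B]) (use that in auto)
  have "(\<integral>\<^sup>+ z. f (atoms {1..N} (fst z) (snd z)) *
      emeasure (sampling_law d n (atoms {1..N} (fst z) (snd z))) B \<partial>?Z)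
    = (\<integral>\<^sup>+ z. (\<Sum>c\<in>obs_index \<rightarrow>\<^sub>E {1..N}. \<integral>\<^sup>+ u. aux_weight u * ?X c u z \<partial>leb) \<partial>?Z)"
  proof (rule nn_integral_cong)
    fix z assume z: "z \<in> space ?Z"
    then have S: "fst z \<in> space (base {1..N})" and \<tau>: "snd z \<in> space (locs {1..N})"
      by (auto simp: space_pair_measure)
    show "f (atoms {1..N} (fst z) (snd z)) *
      emeasure (sampling_law d n (atoms {1..N} (fst z) (snd z))) B
      = (\<Sum>c\<in>obs_index \<rightarrow>\<^sub>E {1..N}. \<integral>\<^sup>+ u. aux_weight u * ?X c u z \<partial>leb)"
      unfolding sampling_law_vec_atoms[OF N S \<tau> B] sum_distrib_left
    proof (rule sum.cong[OF refl])
      fix c assume c: "c \<in> obs_index \<rightarrow>\<^sub>E {1..N}"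
      have m: "(\<lambda>u. aux_weight u * (exp_weight {1..N} u (fst z) * indicator B (data c (snd z), u))) \<in> borel_measurable leb"
      proof (intro borel_measurable_times_ennreal measurable_aux_weight)
        show "(\<lambda>u. exp_weight {1..N} u (fst z)) \<in> borel_measurable leb"
          using S by (intro measurable_tilt_weight measurable_leb_component measurable_const)
            (simp_all add: sets_eq_imp_space_eq[OF sets_base])
        show "(\<lambda>u. indicator B (data c (snd z), u) :: ennreal) \<in> borel_measurable leb"
          using c \<tau> by (intro measurable_indicator_data[where I = "{1..N}", OF _ _ _ B]) auto
      qed
      have "f (atoms {1..N} (fst z) (snd z)) * (pick c (fst z) * (\<integral>\<^sup>+ u. aux_weight u *
          (exp_weight {1..N} u (fst z) * indicator B (data c (snd z), u)) \<partial>leb))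
        = (f (atoms {1..N} (fst z) (snd z)) * pick c (fst z)) * (\<integral>\<^sup>+ u. aux_weight u *
          (exp_weight {1..N} u (fst z) * indicator B (data c (snd z), u)) \<partial>leb)"
        by (simp only: mult.assoc)
      also have "\<dots> = (\<integral>\<^sup>+ u. aux_weight u * ?X c u z \<partial>leb)"
        unfolding nn_integral_cmult[OF m, symmetric] by (intro nn_integral_cong) (simp only: mult_ac)
      finally show "f (atoms {1..N} (fst z) (snd z)) * (pick c (fst z) * (\<integral>\<^sup>+ u. aux_weight u *
          (exp_weight {1..N} u (fst z) * indicator B (data c (snd z), u)) \<partial>leb))
        = (\<integral>\<^sup>+ u. aux_weight u * ?X c u z \<partial>leb)" .
    qed
  qed
  also have "\<dots> = (\<Sum>c\<in>obs_index \<rightarrow>\<^sub>E {1..N}. \<integral>\<^sup>+ z. \<integral>\<^sup>+ u. aux_weight u * ?X c u z \<partial>leb \<partial>?Z)"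
    by (intro nn_integral_sum sigma_finite_measure.borel_measurable_nn_integral[OF sigma_finite_PiM_lborel] X)
  also have "\<dots> = (\<Sum>c\<in>obs_index \<rightarrow>\<^sub>E {1..N}. \<integral>\<^sup>+ u. \<integral>\<^sup>+ z. aux_weight u * ?X c u z \<partial>?Z \<partial>leb)"
    by (intro sum.cong refl nn_integral_swap \<sigma> sigma_finite_PiM_lborel X)
  also have "\<dots> = (\<Sum>c\<in>obs_index \<rightarrow>\<^sub>E {1..N}. \<integral>\<^sup>+ u. aux_weight u * mark_int N c f B u \<partial>leb)"
  proof (intro sum.cong refl nn_integral_cong)
    fix c u assume c: "c \<in> obs_index \<rightarrow>\<^sub>E {1..N}" and u: "u \<in> space leb"
    have "(\<lambda>z. ?X c u z) \<in> borel_measurable ?Z"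
      by (rule measurable_mark[OF _ f B]) (use c u in auto)
    then show "(\<integral>\<^sup>+ z. aux_weight u * ?X c u z \<partial>?Z) = aux_weight u * mark_int N c f B u"
      unfolding mark_int_def by (rule nn_integral_cmult)
  qed
  also have "\<dots> = (\<integral>\<^sup>+ u. (\<Sum>c\<in>obs_index \<rightarrow>\<^sub>E {1..N}. aux_weight u * mark_int N c f B u) \<partial>leb)"
    by (intro nn_integral_sum[symmetric] borel_measurable_times_ennreal measurable_aux_weight measurable_mark_int f B) auto
  finally show ?thesis by (simp add: sum_distrib_left)
qed

end

section \<open>Exchangeability of the labels, and separation of allocated from remaining
  atoms\<close>

lemma sum_atLeastAtMost_append:
  fixes f :: "nat \<Rightarrow> _ :: comm_monoid_add"
  shows "(\<Sum>i\<in>{1..m + k}. f i) = (\<Sum>i\<in>{1..k}. f i) + (\<Sum>i\<in>{1..m}. f (i + k))"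
  by (induction m) (simp_all add: add_ac)

text \<open>A finite sum over atoms does not depend on their labels, provided jumps and locations
  are permuted together.\<close>

lemma vec_atoms_permute:
  assumes \<sigma>: "\<sigma> permutes {1..N}"
  shows "vec_atoms d T {1..N} (\<lambda>p\<in>{1..d} \<times> {1..N}. S (fst p, \<sigma> (snd p))) (\<lambda>m\<in>{1..N}. \<tau> (\<sigma> m))
    = vec_atoms d T {1..N} S \<tau>" (is "vec_atoms d T ?I ?s ?t = _")
  unfolding vec_atoms_def
proof (intro restrict_ext measure_eqI)
  fix j A assume j: "j \<in> {1..d}"
  assume "A \<in> sets (dirac_sum T ?I (\<lambda>m. ?s (j, m)) ?t)"
  then have A: "A \<in> sets T" by (simp add: sets_dirac_sum)
  show "emeasure (dirac_sum T ?I (\<lambda>m. ?s (j, m)) ?t) A = emeasure (dirac_sum T ?I (\<lambda>m. S (j, m)) \<tau>) A"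
    using sum.permute[OF \<sigma>, of "\<lambda>m. ennreal (S (j, m)) * indicator A (\<tau> m)"] j
    by (simp add: emeasure_dirac_sum A comp_def del: sum_mult_indicator)
qed (simp add: sets_dirac_sum)

context vec_mixture
begin

text \<open>Relabelling the marks in the integrand amounts to composing the allocation with
  \<open>\<sigma>\<close>, while the law of the marks is invariant: locations are identically
  distributed, and so are the jumps of one group.\<close>

lemma mark_int_permute:
  assumes \<sigma>: "\<sigma> permutes {1..N}" and c: "c \<in> obs_index \<rightarrow>\<^sub>E {1..N}"
    and f: "f \<in> borel_measurable (V)"
    and B: "B \<in> sets Y_space" and u: "u \<in> space leb"
  shows "mark_int N (\<lambda>l\<in>obs_index. \<sigma> (c l)) f B u = mark_int N c f B u"
proof -
  let ?I = "{1..N}" and ?Z = "base {1..N} \<Otimes>\<^sub>M locs {1..N}"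
  let ?X = "\<lambda>c z. exp_weight {1..N} u (fst z) * pick c (fst z) * indicator B (data c (snd z), u)
      * f (atoms {1..N} (fst z) (snd z))"
  let ?s = "\<lambda>S::nat \<times> nat \<Rightarrow> real. \<lambda>p\<in>{1..d} \<times> ?I. S (fst p, \<sigma> (snd p))"
  let ?t = "\<lambda>\<tau>::nat \<Rightarrow> 'a. \<lambda>m\<in>?I. \<tau> (\<sigma> m)"
  have \<sigma>I: "\<sigma> m \<in> ?I" if "m \<in> ?I" for m using permutes_in_image[OF \<sigma>] that by simp
  have inj: "inj \<sigma>" by (rule permutes_inj[OF \<sigma>])
  \<comment> \<open>Only the atom index is permuted. The law of a jump depends on the group index
    alone, so the reindexed factors are the original ones.\<close>
  have bs: "distr (base ?I) (base ?I) ?s = base ?I"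
  proof -
    let ?g = "\<lambda>p::nat \<times> nat. density lpos (\<lambda>s. ennreal (h (fst p) s))"
    have "distr (PiM ({1..d} \<times> ?I) ?g) (\<Pi>\<^sub>M p\<in>{1..d} \<times> ?I. ?g (fst p, \<sigma> (snd p))) ?s
        = (\<Pi>\<^sub>M p\<in>{1..d} \<times> ?I. ?g (fst p, \<sigma> (snd p)))"
    proof (rule distr_PiM_reindex)
      show "prob_space (?g p)" if "p \<in> {1..d} \<times> ?I" for p
        by (rule prob_space_density_pos, rule h) (use that in \<open>simp add: mem_Times_iff\<close>)
      show "inj_on (\<lambda>p. (fst p, \<sigma> (snd p))) ({1..d} \<times> ?I)"
        by (rule inj_onI) (simp add: inj_eq[OF inj] prod_eq_iff)
      show "(\<lambda>p. (fst p, \<sigma> (snd p))) \<in> {1..d} \<times> ?I \<rightarrow> {1..d} \<times> ?I"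
        using \<sigma>I by (intro funcsetI) (simp add: mem_Times_iff)
    qed
    then show ?thesis by (simp add: base_def)
  qed
  have bt: "distr (locs ?I) (locs ?I) ?t = locs ?I"
    by (rule distr_PiM_reindex[of ?I "\<lambda>_. P0" \<sigma> ?I]) (use \<sigma>I inj in \<open>simp_all add: P0 inj_on_subset[OF _ subset_UNIV]\<close>)
  have ms: "?s \<in> base ?I \<rightarrow>\<^sub>M base ?I"
    unfolding base_def
  proof (intro measurable_restrict)
    fix p assume "p \<in> {1..d} \<times> ?I"
    then have "(fst p, \<sigma> (snd p)) \<in> {1..d} \<times> ?I" using \<sigma>I by auto
    from measurable_component_singleton[OF this, of "\<lambda>p. density lpos (\<lambda>s. ennreal (h (fst p) s))"]
    show "(\<lambda>S. S (fst p, \<sigma> (snd p))) \<in> (\<Pi>\<^sub>M p\<in>{1..d} \<times> ?I. density lpos (\<lambda>s. ennreal (h (fst p) s)))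
        \<rightarrow>\<^sub>M density lpos (\<lambda>s. ennreal (h (fst p) s))" by simp
  qed
  have mt: "?t \<in> locs ?I \<rightarrow>\<^sub>M locs ?I"
    using \<sigma>I by (intro measurable_restrict measurable_component_singleton)
  have Z: "?Z = distr ?Z ?Z (\<lambda>(S, \<tau>). (?s S, ?t \<tau>))"
    using pair_measure_distr[OF ms mt] by (simp add: bs bt sigma_finite_locs)
  have mst: "(\<lambda>(S, \<tau>). (?s S, ?t \<tau>)) \<in> ?Z \<rightarrow>\<^sub>M ?Z"
    unfolding case_prod_beta' by (intro measurable_Pair measurable_compose[OF measurable_fst ms] measurable_compose[OF measurable_snd mt])
  have "(\<lambda>z. ?X c z) \<in> borel_measurable ?Z"
    by (rule measurable_mark[OF _ f B]) (use c u in auto)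
  then have "(\<integral>\<^sup>+ z. ?X c z \<partial>?Z) = (\<integral>\<^sup>+ z. ?X c (?s (fst z), ?t (snd z)) \<partial>?Z)"
    by (subst Z, subst nn_integral_distr[OF mst]) (simp_all add: case_prod_beta' Z[symmetric])
  also have "\<dots> = (\<integral>\<^sup>+ z. ?X (\<lambda>l\<in>obs_index. \<sigma> (c l)) z \<partial>?Z)"
  proof (rule nn_integral_cong)
    fix z :: "(nat \<times> nat \<Rightarrow> real) \<times> (nat \<Rightarrow> 'a)"
    obtain S \<tau> where z: "z = (S, \<tau>)" by (cases z)
    have "(\<Sum>m\<in>?I. ?s S (j, m)) = (\<Sum>m\<in>?I. S (j, m))" if "j \<in> {1..d}" for j
      using sum.permute[OF \<sigma>, of "\<lambda>m. S (j, m)"] that by (simp add: comp_def)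
    then have 1: "exp_weight ?I u (?s S) = exp_weight ?I u S"
      unfolding tilt_weight_0[OF finite_atLeastAtMost] by (intro prod.cong refl) simp
    have 2: "pick c (?s S) = pick (\<lambda>l\<in>obs_index. \<sigma> (c l)) S"
      unfolding pick_def using c by (intro prod.cong refl) auto
    have 3: "data c (?t \<tau>) = data (\<lambda>l\<in>obs_index. \<sigma> (c l)) \<tau>"
      unfolding data_def
    proof (intro restrict_ext)
      fix j i assume "j \<in> {1..d}" "i \<in> {1..n j}"
      then have "(j, i) \<in> obs_index" by auto
      moreover from this have "c (j, i) \<in> ?I" using c by (rule PiE_mem[rotated])
      ultimately show "?t \<tau> (c (j, i)) = \<tau> ((\<lambda>l\<in>obs_index. \<sigma> (c l)) (j, i))" by simp
    qed
    have 4: "atoms ?I (?s S) (?t \<tau>) = atoms ?I S \<tau>"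
      by (rule vec_atoms_permute[OF \<sigma>])
    show "?X c (?s (fst z), ?t (snd z)) = ?X (\<lambda>l\<in>obs_index. \<sigma> (c l)) z"
      by (simp only: z fst_conv snd_conv 1 2 3 4)
  qed
  finally show ?thesis unfolding mark_int_def by simp
qed

definition counts :: "(nat \<times> nat \<Rightarrow> nat) \<Rightarrow> nat \<Rightarrow> nat \<Rightarrow> nat" where
  "counts \<pi> j k = card {i \<in> {1..n j}. \<pi> (j, i) = k}"

text \<open>Grouping the observations by the atom they sit on turns the product of their jumps into
  the powers \<open>S (j, m) ^ counts \<pi> j m\<close>.\<close>

lemma tilt_weight_counts:
  assumes \<pi>: "\<pi> \<in> obs_index \<rightarrow> {1..k}" and S: "S \<in> space (base {1..k})"
  shows "exp_weight {1..k} u S * pick \<pi> S = tilt_weight d {1..k} (counts \<pi>) u S"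
proof -
  have "S \<in> space (jumps d {1..k})"
    using S by (simp add: sets_eq_imp_space_eq[OF sets_base])
  then have pos: "0 < S p" if "p \<in> {1..d} \<times> {1..k}" for p
    using that by (auto simp: space_PiM PiE_iff)
  have "pick \<pi> S = (\<Prod>j\<in>{1..d}. \<Prod>i\<in>{1..n j}. ennreal (S (j, \<pi> (j, i))))"
    unfolding pick_def by (subst prod.Sigma) (auto simp: split_beta)
  also have "\<dots> = (\<Prod>j\<in>{1..d}. \<Prod>m\<in>{1..k}. ennreal (S (j, m)) ^ counts \<pi> j m)"
  proof (rule prod.cong[OF refl])
    fix j assume j: "j \<in> {1..d}"
    have "(\<Prod>i\<in>{1..n j}. ennreal (S (j, \<pi> (j, i))))
        = (\<Prod>m\<in>{1..k}. \<Prod>i\<in>{i \<in> {1..n j}. \<pi> (j, i) = m}. ennreal (S (j, \<pi> (j, i))))"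
      using \<pi> j by (intro prod.group[symmetric]) (auto simp: Pi_iff)
    also have "\<dots> = (\<Prod>m\<in>{1..k}. ennreal (S (j, m)) ^ counts \<pi> j m)"
      unfolding counts_def by (intro prod.cong refl) simp
    finally show "(\<Prod>i\<in>{1..n j}. ennreal (S (j, \<pi> (j, i)))) = \<dots>" .
  qed
  also have "\<dots> = (\<Prod>p\<in>{1..d} \<times> {1..k}. ennreal (S p) ^ counts \<pi> (fst p) (snd p))"
    by (subst prod.Sigma) (auto simp: split_beta)
  finally have "exp_weight {1..k} u S * pick \<pi> S
      = (\<Prod>p\<in>{1..d} \<times> {1..k}. ennreal (exp (- u (fst p) * S p)) * ennreal (S p) ^ counts \<pi> (fst p) (snd p))"
    by (simp add: tilt_weight_def prod.distrib)
  also have "\<dots> = tilt_weight d {1..k} (counts \<pi>) u S"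
    unfolding tilt_weight_def
    by (intro prod.cong refl) (simp add: ennreal_power ennreal_mult[symmetric] less_imp_le[OF pos])
  finally show ?thesis .
qed

lemma data_cong: "(\<And>l. l \<in> obs_index \<Longrightarrow> \<tau> (c l) = \<tau>' (c' l)) \<Longrightarrow> data c \<tau> = data c' \<tau>'"
  unfolding data_def by (intro restrict_ext) auto

lemma pick_cong: "(\<And>l. l \<in> obs_index \<Longrightarrow> S (fst l, c l) = S' (fst l, c' l)) \<Longrightarrow> pick c S = pick c' S'"
  unfolding pick_def by (intro prod.cong) auto

definition join_jumps :: "nat \<Rightarrow> nat \<Rightarrow> (nat \<times> nat \<Rightarrow> real) \<times> (nat \<times> nat \<Rightarrow> real) \<Rightarrow> nat \<times> nat \<Rightarrow> real" where
  "join_jumps k m = (\<lambda>(S, S'). \<lambda>p\<in>{1..d} \<times> {1..m + k}. if snd p \<le> k then S p else S' (fst p, snd p - k))"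

definition join_locs :: "nat \<Rightarrow> nat \<Rightarrow> (nat \<Rightarrow> 'a) \<times> (nat \<Rightarrow> 'a) \<Rightarrow> nat \<Rightarrow> 'a" where
  "join_locs k m = (\<lambda>(t, \<tau>). \<lambda>i\<in>{1..m + k}. if i \<le> k then t i else \<tau> (i - k))"

lemma measurable_join_jumps: "join_jumps k m \<in> base {1..k} \<Otimes>\<^sub>M base {1..m} \<rightarrow>\<^sub>M base {1..m + k}"
  unfolding join_jumps_def base_def case_prod_beta'
proof (intro measurable_restrict)
  fix p assume p: "p \<in> {1..d} \<times> {1..m + k}"
  let ?g = "\<lambda>p. density lpos (\<lambda>s. ennreal (h (fst p) s))"
  show "(\<lambda>z. if snd p \<le> k then fst z p else snd z (fst p, snd p - k))
      \<in> PiM ({1..d} \<times> {1..k}) ?g \<Otimes>\<^sub>M PiM ({1..d} \<times> {1..m}) ?g \<rightarrow>\<^sub>M ?g p"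
  proof (cases "snd p \<le> k")
    case True
    then show ?thesis
      using p measurable_compose[OF measurable_fst measurable_component_singleton[of p "{1..d} \<times> {1..k}" ?g]]
      by (auto simp: mem_Times_iff)
  next
    case False
    then have "(fst p, snd p - k) \<in> {1..d} \<times> {1..m}"
      using p by auto
    from measurable_compose[OF measurable_snd measurable_component_singleton[OF this, of ?g]] False
    show ?thesis by simp
  qed
qed

lemma measurable_join_locs: "join_locs k m \<in> locs {1..k} \<Otimes>\<^sub>M locs {1..m} \<rightarrow>\<^sub>M locs {1..m + k}"
  unfolding join_locs_def case_prod_beta'
proof (intro measurable_restrict)
  fix i assume i: "i \<in> {1..m + k}"
  show "(\<lambda>z. if i \<le> k then fst z i else snd z (i - k)) \<in> locs {1..k} \<Otimes>\<^sub>M locs {1..m} \<rightarrow>\<^sub>M P0"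
  proof (cases "i \<le> k")
    case True
    then show ?thesis
      using i measurable_compose[OF measurable_fst measurable_component_singleton[of i "{1..k}" "\<lambda>_. P0"]] by auto
  next
    case False
    then have "i - k \<in> {1..m}" using i by auto
    from measurable_compose[OF measurable_snd measurable_component_singleton[OF this, of "\<lambda>_. P0"]] False
    show ?thesis by simp
  qed
qed

text \<open>Independent families of jumps for the two kinds of atoms form one family with
  \<open>m + k\<close> labels, those of the second kind being shifted by \<open>k\<close>. The law
  of a jump does not change under this shift, as it depends on the group only.\<close>

lemma distr_join_jumps: "distr (base {1..k} \<Otimes>\<^sub>M base {1..m}) (base {1..m + k}) (join_jumps k m) = base {1..m + k}"
proof -
  let ?g = "\<lambda>p::nat \<times> nat. density lpos (\<lambda>s. ennreal (h (fst p) s))"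
  let ?b = "\<lambda>p::nat \<times> nat. (fst p, snd p + k)"
  have 1: "{1..d} \<times> {1..m + k} = id ` ({1..d} \<times> {1..k}) \<union> ?b ` ({1..d} \<times> {1..m})"
  proof (intro equalityI subsetI)
    fix p assume p: "p \<in> {1..d} \<times> {1..m + k}"
    show "p \<in> id ` ({1..d} \<times> {1..k}) \<union> ?b ` ({1..d} \<times> {1..m})"
    proof (cases "snd p \<le> k")
      case False
      then have "(fst p, snd p - k) \<in> {1..d} \<times> {1..m}"
        using p by auto
      from imageI[OF this, of ?b] False show ?thesis by simp
    qed (use p in \<open>auto simp: mem_Times_iff\<close>)
  qed auto
  have "distr (PiM ({1..d} \<times> {1..k}) (\<lambda>i. ?g (id i)) \<Otimes>\<^sub>M PiM ({1..d} \<times> {1..m}) (\<lambda>i. ?g (?b i)))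
      (PiM ({1..d} \<times> {1..m + k}) ?g) (join_jumps k m) = PiM ({1..d} \<times> {1..m + k}) ?g"
  proof (rule distr_PiM_join[OF _ _ _ _ _ 1])
    show "join_jumps k m \<in> PiM ({1..d} \<times> {1..k}) (\<lambda>i. ?g (id i)) \<Otimes>\<^sub>M PiM ({1..d} \<times> {1..m}) (\<lambda>i. ?g (?b i))
        \<rightarrow>\<^sub>M PiM ({1..d} \<times> {1..m + k}) ?g"
      using measurable_join_jumps by (simp add: base_def)
    show "prob_space (?g p)" if "p \<in> {1..d} \<times> {1..m + k}" for p
      by (rule prob_space_density_pos, rule h) (use that in \<open>simp add: mem_Times_iff\<close>)
    show "inj_on ?b ({1..d} \<times> {1..m})"
      by (rule inj_onI) (simp add: prod_eq_iff)
    show "id ` ({1..d} \<times> {1..k}) \<inter> ?b ` ({1..d} \<times> {1..m}) = {}"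
      by auto
    show "join_jumps k m (x, y) (id p) = x p" if "p \<in> {1..d} \<times> {1..k}" for x y p
      using that by (simp add: join_jumps_def mem_Times_iff)
    show "join_jumps k m (x, y) (?b p) = y p" if "p \<in> {1..d} \<times> {1..m}" for x y p
      using that by (simp add: join_jumps_def mem_Times_iff)
  qed simp_all
  then show ?thesis by (simp add: base_def)
qed

lemma distr_join_locs: "distr (locs {1..k} \<Otimes>\<^sub>M locs {1..m}) (locs {1..m + k}) (join_locs k m) = locs {1..m + k}"
proof -
  have 1: "{1..m + k} = id ` {1..k} \<union> (\<lambda>i. i + k) ` {1..m}"
  proof (intro equalityI subsetI)
    fix i assume i: "i \<in> {1..m + k}"
    show "i \<in> id ` {1..k} \<union> (\<lambda>i. i + k) ` {1..m}"
    proof (cases "i \<le> k")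
      case False
      then have "i = (i - k) + k" "i - k \<in> {1..m}" using i by auto
      then show ?thesis by blast
    qed (use i in auto)
  qed auto
  show ?thesis
    by (rule distr_PiM_join[OF _ _ _ _ _ 1, of "\<lambda>_. P0" "join_locs k m"])
      (auto simp: P0 intro: measurable_join_locs, auto simp: join_locs_def)
qed

lemma tilt_weight_join:
  "exp_weight {1..m + k} u (join_jumps k m (S, S'))
    = exp_weight {1..k} u S * exp_weight {1..m} u S'"
proof -
  have "(\<Sum>i\<in>{1..m + k}. join_jumps k m (S, S') (j, i)) = (\<Sum>i\<in>{1..k}. S (j, i)) + (\<Sum>i\<in>{1..m}. S' (j, i))"
    if "j \<in> {1..d}" for j
    using sum_atLeastAtMost_append[of "\<lambda>i. join_jumps k m (S, S') (j, i)" m k] that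
    by (simp add: join_jumps_def)
  then show ?thesis
    unfolding tilt_weight_0[OF finite_atLeastAtMost] prod.distrib[symmetric]
    by (intro prod.cong refl) (simp add: distrib_left mult_exp_exp ennreal_mult[symmetric])
qed

text \<open>The two processes of the claim arise here: the sum over \<open>m + k\<close> atoms
  breaks into the first \<open>k\<close> labels and the rest.\<close>

lemma vec_atoms_join:
  "atoms {1..m + k} (join_jumps k m (S, S')) (join_locs k m (t, \<tau>))
    = vec_superpose d (atoms {1..k} S t) (atoms {1..m} S' \<tau>)"
  unfolding vec_superpose_def
  unfolding vec_atoms_def
proof (intro restrict_ext measure_eqI)
  fix j A assume j: "j \<in> {1..d}"
  let ?l = "dirac_sum P0 {1..m + k} (\<lambda>i. join_jumps k m (S, S') (j, i)) (join_locs k m (t, \<tau>))"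
  let ?a = "dirac_sum P0 {1..k} (\<lambda>i. S (j, i)) t" and ?b = "dirac_sum P0 {1..m} (\<lambda>i. S' (j, i)) \<tau>"
  show "sets ?l = sets (superpose ((\<lambda>j\<in>{1..d}. dirac_sum P0 {1..k} (\<lambda>i. S (j, i)) t) j)
      ((\<lambda>j\<in>{1..d}. dirac_sum P0 {1..m} (\<lambda>i. S' (j, i)) \<tau>) j))"
    using j by (simp add: sets_dirac_sum superpose_def space_dirac_sum)
  assume "A \<in> sets ?l"
  then have A: "A \<in> sets P0" by (simp add: sets_dirac_sum)
  have "emeasure ?l A = (\<Sum>i\<in>{1..m + k}. ennreal (join_jumps k m (S, S') (j, i)) * indicator A (join_locs k m (t, \<tau>) i))"
    using A by (simp add: emeasure_dirac_sum del: sum_mult_indicator)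
  also have "\<dots> = (\<Sum>i\<in>{1..k}. ennreal (S (j, i)) * indicator A (t i)) + (\<Sum>i\<in>{1..m}. ennreal (S' (j, i)) * indicator A (\<tau> i))"
    using sum_atLeastAtMost_append[of "\<lambda>i. ennreal (join_jumps k m (S, S') (j, i)) * indicator A (join_locs k m (t, \<tau>) i)" m k] j
    by (simp add: join_jumps_def join_locs_def del: sum_mult_indicator)
  also have "\<dots> = emeasure (superpose ?a ?b) A"
    using A by (subst emeasure_superpose) (simp_all add: sets_dirac_sum emeasure_dirac_sum del: sum_mult_indicator)
  finally show "emeasure ?l A = emeasure (superpose ((\<lambda>j\<in>{1..d}. dirac_sum P0 {1..k} (\<lambda>i. S (j, i)) t) j)
      ((\<lambda>j\<in>{1..d}. dirac_sum P0 {1..m} (\<lambda>i. S' (j, i)) \<tau>) j)) A"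
    using j by simp
qed

lemma measurable_tilt_weight_base:
  assumes "S \<in> M \<rightarrow>\<^sub>M base I" and "\<And>j. j \<in> {1..d} \<Longrightarrow> (\<lambda>x. u x j) \<in> borel_measurable M"
  shows "(\<lambda>x. tilt_weight d I c (u x) (S x)) \<in> borel_measurable M"
  using assms by (intro measurable_tilt_weight) (auto simp: measurable_base)

lemma measurable_superposed:
  assumes f: "f \<in> borel_measurable (V)"
    and S: "S \<in> M \<rightarrow>\<^sub>M base {1..k}" and S': "S' \<in> M \<rightarrow>\<^sub>M base {1..m}"
    and t: "t \<in> M \<rightarrow>\<^sub>M locs {1..k}" and \<tau>: "\<tau> \<in> M \<rightarrow>\<^sub>M locs {1..m}"
  shows "(\<lambda>x. f (vec_superpose d (atoms {1..k} (S x) (t x)) (atoms {1..m} (S' x) (\<tau> x))))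
    \<in> borel_measurable M"
  using S S'
  by (intro measurable_compose[OF measurable_vec_superpose_compose f] measurable_vec_atoms t \<tau>)
    (simp_all add: measurable_base)

text \<open>The integrand of \<open>mark_int\<close> after separation of the atoms, with the
  remaining locations already integrated out. Data and powers of jumps involve the first
  \<open>k\<close> atoms only.\<close>

definition split_integrand where
  "split_integrand \<pi> k m f B u S S' t = indicator B (data \<pi> t, u) * (tilt_weight d {1..k} (counts \<pi>) u S *
    (exp_weight {1..m} u S' *
      (rest_integral k m f S t S')))"

lemma measurable_non_allocated_integral:
  assumes f: "f \<in> borel_measurable (V)"
    and S: "S \<in> M \<rightarrow>\<^sub>M base {1..k}" and S': "S' \<in> M \<rightarrow>\<^sub>M base {1..m}" and t: "t \<in> M \<rightarrow>\<^sub>M locs {1..k}"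
  shows "(\<lambda>x. rest_integral k m f (S x) (t x) (S' x)) \<in> borel_measurable M"
  by (rule sigma_finite_measure.borel_measurable_nn_integral[OF sigma_finite_locs], unfold case_prod_beta',
      intro measurable_superposed f measurable_compose[OF measurable_fst S] measurable_compose[OF measurable_fst S']
        measurable_compose[OF measurable_fst t] measurable_snd)

lemma measurable_split_integrand:
  assumes \<pi>: "\<pi> \<in> obs_index \<rightarrow> {1..k}" and f: "f \<in> borel_measurable (V)"
    and B: "B \<in> sets Y_space" and u: "u \<in> space leb"
    and S: "S \<in> M \<rightarrow>\<^sub>M base {1..k}" and S': "S' \<in> M \<rightarrow>\<^sub>M base {1..m}" and t: "t \<in> M \<rightarrow>\<^sub>M locs {1..k}"
  shows "(\<lambda>x. split_integrand \<pi> k m f B u (S x) (S' x) (t x)) \<in> borel_measurable M"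
  unfolding split_integrand_def
  using u by (intro borel_measurable_times_ennreal measurable_indicator_data[OF \<pi> t _ B] measurable_tilt_weight_base
      S S' measurable_non_allocated_integral f t) auto

text \<open>The allocation takes values in \<open>{1..k}\<close>, so neither the data nor the picked
  jumps see the remaining atoms. Once the integral over the locations \<open>t\<close> has been
  moved outside, what is left for fixed \<open>t\<close> is \<open>marked_integral\<close>.\<close>

lemma mark_int_split:
  assumes \<pi>: "\<pi> \<in> obs_index \<rightarrow> {1..k}" and f: "f \<in> borel_measurable (V)"
    and B: "B \<in> sets Y_space" and u: "u \<in> space leb"
  shows "mark_int (m + k) \<pi> f B u
    = (\<integral>\<^sup>+ t. indicator B (data \<pi> t, u) * marked_integral k (counts \<pi>) t u m f \<partial>locs {1..k})"
proof -
  let ?N = "{1..m + k}"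
  let ?bk = "base {1..k}" and ?bm = "base {1..m}" and ?lk = "locs {1..k}" and ?lm = "locs {1..m}"
  let ?Z = "base ?N \<Otimes>\<^sub>M locs ?N" and ?W = "(?bk \<Otimes>\<^sub>M ?bm) \<Otimes>\<^sub>M (?lk \<Otimes>\<^sub>M ?lm)"
  let ?J = "\<lambda>(w, v). (join_jumps k m w, join_locs k m v)"
  let ?X = "\<lambda>z. exp_weight ?N u (fst z) * pick \<pi> (fst z) * indicator B (data \<pi> (snd z), u)
      * f (atoms ?N (fst z) (snd z))"
  let ?Y = "\<lambda>S S' t \<tau>. f (vec_superpose d (atoms {1..k} S t) (atoms {1..m} S' \<tau>))"
  let ?a = "tilt_weight d {1..k} (counts \<pi>) u" and ?b = "exp_weight {1..m} u"
  let ?I = "\<lambda>t. indicator B (data \<pi> t, u) :: ennreal"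
  note meas_Q = measurable_split_integrand[OF \<pi> f B u]
  note sigma = sigma_finite_base sigma_finite_locs
  have \<pi>N: "\<pi> \<in> obs_index \<rightarrow> ?N" using \<pi> by (fastforce simp: Pi_iff)
  have Z: "?Z = distr ?W ?Z ?J"
    using pair_measure_distr[OF measurable_join_jumps[of k m] measurable_join_locs[of k m]]
    by (simp add: distr_join_jumps distr_join_locs sigma_finite_locs)
  have J: "?J \<in> ?W \<rightarrow>\<^sub>M ?Z"
    unfolding case_prod_beta' by (intro measurable_Pair measurable_compose[OF measurable_fst measurable_join_jumps]
        measurable_compose[OF measurable_snd measurable_join_locs])
  have X: "?X \<in> borel_measurable ?Z"
    by (rule measurable_mark[OF \<pi>N f B]) (use u in auto)
  have I: "?I \<in> borel_measurable ?lk"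
    using u by (intro measurable_indicator_data[OF \<pi> _ _ B]) auto
  have a: "?a \<in> borel_measurable ?bk" and b: "?b \<in> borel_measurable ?bm"
    by (rule measurable_tilt_weight_base; simp)+
  have "mark_int (m + k) \<pi> f B u = (\<integral>\<^sup>+ w. ?X (?J w) \<partial>?W)"
    unfolding mark_int_def using X by (subst Z, subst nn_integral_distr[OF J]) (simp_all add: Z[symmetric])
  also have "\<dots> = (\<integral>\<^sup>+ w. \<integral>\<^sup>+ v. ?X (?J (w, v)) \<partial>(?lk \<Otimes>\<^sub>M ?lm) \<partial>(?bk \<Otimes>\<^sub>M ?bm))"
    using measurable_compose[OF J X]
    by (intro sigma_finite_measure.nn_integral_fst[symmetric] prob_space_imp_sigma_finite prob_space_pair prob_locs)
  also have "\<dots> = (\<integral>\<^sup>+ S. \<integral>\<^sup>+ S'. \<integral>\<^sup>+ v. ?X (?J ((S, S'), v)) \<partial>(?lk \<Otimes>\<^sub>M ?lm) \<partial>?bm \<partial>?bk)"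
  proof (rule sigma_finite_measure.nn_integral_fst[symmetric, OF sigma_finite_base])
    have "(\<lambda>(w, v). ?X (?J (w, v))) \<in> borel_measurable ?W"
      using measurable_compose[OF J X] by (simp add: case_prod_beta')
    then show "(\<lambda>w. \<integral>\<^sup>+ v. ?X (?J (w, v)) \<partial>(?lk \<Otimes>\<^sub>M ?lm)) \<in> borel_measurable (?bk \<Otimes>\<^sub>M ?bm)"
      by (intro sigma_finite_measure.borel_measurable_nn_integral prob_space_imp_sigma_finite prob_space_pair prob_locs)
  qed
  also have "\<dots> = (\<integral>\<^sup>+ S. \<integral>\<^sup>+ S'. \<integral>\<^sup>+ t. split_integrand \<pi> k m f B u S S' t \<partial>?lk \<partial>?bm \<partial>?bk)"
  proof (intro nn_integral_cong)
    fix S S' assume S: "S \<in> space ?bk" and S': "S' \<in> space ?bm"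
    \<comment> \<open>Labels in the range of \<open>\<pi>\<close> are at most \<open>k\<close>,
      where joining keeps the allocated jump.\<close>
    have pick: "pick \<pi> (join_jumps k m (S, S')) = pick \<pi> S"
      using \<pi> by (intro pick_cong) (fastforce simp: join_jumps_def Pi_iff)
    have data: "data \<pi> (join_locs k m (t, \<tau>)) = data \<pi> t" for t \<tau>
      using \<pi> by (intro data_cong) (fastforce simp: join_locs_def Pi_iff)
    have eq: "?X (?J ((S, S'), (t, \<tau>))) = ?I t * (?a S * (?b S' * ?Y S S' t \<tau>))" for t \<tau>
    proof -
      have "?X (?J ((S, S'), (t, \<tau>))) = exp_weight {1..k} u S * ?b S' * pick \<pi> S * ?I t * ?Y S S' t \<tau>"
        by (simp only: fst_conv snd_conv prod.case tilt_weight_join vec_atoms_join pick data)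
      also have "\<dots> = ?I t * ((exp_weight {1..k} u S * pick \<pi> S) * (?b S' * ?Y S S' t \<tau>))"
        by (simp only: mult_ac)
      finally show ?thesis unfolding tilt_weight_counts[OF \<pi> S] .
    qed
    have "(\<lambda>v. ?X (?J ((S, S'), v))) \<in> borel_measurable (?lk \<Otimes>\<^sub>M ?lm)"
      using S S' by (intro measurable_compose[OF _ measurable_compose[OF J X]]) (simp add: space_pair_measure)
    then have "(\<integral>\<^sup>+ v. ?X (?J ((S, S'), v)) \<partial>(?lk \<Otimes>\<^sub>M ?lm)) = (\<integral>\<^sup>+ t. \<integral>\<^sup>+ \<tau>. ?X (?J ((S, S'), (t, \<tau>))) \<partial>?lm \<partial>?lk)"
      by (rule sigma_finite_measure.nn_integral_fst[symmetric, OF sigma_finite_locs])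
    also have "\<dots> = (\<integral>\<^sup>+ t. split_integrand \<pi> k m f B u S S' t \<partial>?lk)"
    proof (rule nn_integral_cong)
      fix t assume t: "t \<in> space ?lk"
      have "?Y S S' t \<in> borel_measurable ?lm"
        using S S' t by (intro measurable_superposed f) auto
      then show "(\<integral>\<^sup>+ \<tau>. ?X (?J ((S, S'), (t, \<tau>))) \<partial>?lm) = split_integrand \<pi> k m f B u S S' t"
        unfolding eq split_integrand_def by (simp add: nn_integral_cmult)
    qed
    finally show "(\<integral>\<^sup>+ v. ?X (?J ((S, S'), v)) \<partial>(?lk \<Otimes>\<^sub>M ?lm)) = \<dots>" .
  qed
  \<comment> \<open>The integral over \<open>t\<close> passes the one over the remaining jumps here,
    and the one over the allocated jumps in the next step.\<close>
  also have "\<dots> = (\<integral>\<^sup>+ S. \<integral>\<^sup>+ t. \<integral>\<^sup>+ S'. split_integrand \<pi> k m f B u S S' t \<partial>?bm \<partial>?lk \<partial>?bk)"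
  proof (intro nn_integral_cong nn_integral_swap sigma)
    fix S assume "S \<in> space ?bk"
    then show "(\<lambda>(S', t). split_integrand \<pi> k m f B u S S' t) \<in> borel_measurable (?bm \<Otimes>\<^sub>M ?lk)"
      unfolding case_prod_beta' by (intro meas_Q) auto
  qed
  also have "\<dots> = (\<integral>\<^sup>+ t. \<integral>\<^sup>+ S. \<integral>\<^sup>+ S'. split_integrand \<pi> k m f B u S S' t \<partial>?bm \<partial>?bk \<partial>?lk)"
  proof (intro nn_integral_swap sigma)
    have "(\<lambda>(z, S'). split_integrand \<pi> k m f B u (fst z) S' (snd z)) \<in> borel_measurable ((?bk \<Otimes>\<^sub>M ?lk) \<Otimes>\<^sub>M ?bm)"
      unfolding case_prod_beta' by (intro meas_Q) measurable
    from sigma_finite_measure.borel_measurable_nn_integral[OF sigma_finite_base this]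
    show "(\<lambda>(S, t). \<integral>\<^sup>+ S'. split_integrand \<pi> k m f B u S S' t \<partial>?bm) \<in> borel_measurable (?bk \<Otimes>\<^sub>M ?lk)"
      by (simp add: case_prod_beta')
  qed
  also have "\<dots> = (\<integral>\<^sup>+ t. ?I t * marked_integral k (counts \<pi>) t u m f \<partial>?lk)"
  proof (rule nn_integral_cong)
    fix t assume t: "t \<in> space ?lk"
    let ?F = "\<lambda>S S'. \<integral>\<^sup>+ \<tau>. ?Y S S' t \<tau> \<partial>?lm"
    have m1: "(\<lambda>S'. ?b S' * ?F S S') \<in> borel_measurable ?bm" if "S \<in> space ?bk" for S
      using that t by (intro borel_measurable_times_ennreal b measurable_non_allocated_integral f) auto
    have m2: "(\<lambda>S. ?a S * (\<integral>\<^sup>+ S'. ?b S' * ?F S S' \<partial>?bm)) \<in> borel_measurable ?bk"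
      using t by (intro borel_measurable_times_ennreal a
          sigma_finite_measure.borel_measurable_nn_integral[OF sigma_finite_base], unfold case_prod_beta')
        (intro borel_measurable_times_ennreal measurable_compose[OF measurable_snd b] measurable_non_allocated_integral f
          measurable_fst measurable_snd measurable_const)
    have "(\<integral>\<^sup>+ S. \<integral>\<^sup>+ S'. split_integrand \<pi> k m f B u S S' t \<partial>?bm \<partial>?bk)
        = (\<integral>\<^sup>+ S. ?I t * (?a S * (\<integral>\<^sup>+ S'. ?b S' * ?F S S' \<partial>?bm)) \<partial>?bk)"
    proof (rule nn_integral_cong)
      fix S assume "S \<in> space ?bk"
      note m1[OF this]
      then show "(\<integral>\<^sup>+ S'. split_integrand \<pi> k m f B u S S' t \<partial>?bm) = ?I t * (?a S * (\<integral>\<^sup>+ S'. ?b S' * ?F S S' \<partial>?bm))"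
        unfolding split_integrand_def mult.assoc[symmetric, of "?I t"]
        by (subst nn_integral_cmult[symmetric]) simp_all
    qed
    also have "\<dots> = ?I t * marked_integral k (counts \<pi>) t u m f"
      unfolding marked_integral_def by (rule nn_integral_cmult[OF m2])
    finally show "(\<integral>\<^sup>+ S. \<integral>\<^sup>+ S'. split_integrand \<pi> k m f B u S S' t \<partial>?bm \<partial>?bk) = \<dots>" .
  qed
  finally show ?thesis .
qed

lemma measurable_marked_integral:
  assumes f: "f \<in> borel_measurable (V)"
    and t: "t \<in> M \<rightarrow>\<^sub>M locs {1..k}" and u: "\<And>j. j \<in> {1..d} \<Longrightarrow> (\<lambda>x. u x j) \<in> borel_measurable M"
  shows "(\<lambda>x. marked_integral k c (t x) (u x) m f) \<in> borel_measurable M"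
  unfolding marked_integral_def
proof (rule sigma_finite_measure.borel_measurable_nn_integral[OF sigma_finite_base], unfold case_prod_beta',
    intro borel_measurable_times_ennreal measurable_tilt_weight_base measurable_snd)
  show "(\<lambda>x. u (fst x) j) \<in> borel_measurable (M \<Otimes>\<^sub>M base {1..k})" if "j \<in> {1..d}" for j
    using measurable_compose[OF measurable_fst u[OF that]] .
  have "(\<lambda>x. u (fst (fst x)) j) \<in> borel_measurable ((M \<Otimes>\<^sub>M base {1..k}) \<Otimes>\<^sub>M base {1..m})" if "j \<in> {1..d}" for j
    using measurable_compose[OF measurable_fst measurable_compose[OF measurable_fst u[OF that]]] .
  then show "(\<lambda>x. \<integral>\<^sup>+ S'. exp_weight {1..m} (u (fst x)) S' *
      (rest_integral k m f (snd x) (t (fst x)) S')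
        \<partial>base {1..m}) \<in> borel_measurable (M \<Otimes>\<^sub>M base {1..k})"
    by (intro sigma_finite_measure.borel_measurable_nn_integral[OF sigma_finite_base], unfold case_prod_beta')
      (intro borel_measurable_times_ennreal measurable_tilt_weight_base measurable_non_allocated_integral f
        measurable_snd measurable_compose[OF measurable_fst measurable_snd]
        measurable_compose[OF measurable_fst measurable_compose[OF measurable_fst t]], assumption)
qed

end

subsection \<open>The joint law of measures and observations\<close>

text \<open>The measure \<open>P\<close> is a finite sum of images under \<open>y i\<close> of
  measures with densities \<open>w i\<close>; the formula for sets extends to functions through
  linear combinations and monotone limits. It converts integrals over observations into integrals
  over label spaces.\<close>

lemma nn_integral_eq_sum_of_emeasure_eq_sum:
  assumes I: "finite I" and sets: "sets P = sets Y"
    and y: "\<And>i. i \<in> I \<Longrightarrow> y i \<in> R i \<rightarrow>\<^sub>M Y" and w: "\<And>i. i \<in> I \<Longrightarrow> w i \<in> borel_measurable (R i)"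
    and eq: "\<And>A. A \<in> sets Y \<Longrightarrow> emeasure P A = (\<Sum>i\<in>I. \<integral>\<^sup>+ r. w i r * indicator A (y i r) \<partial>R i)"
    and g: "g \<in> borel_measurable Y"
  shows "(\<integral>\<^sup>+ z. g z \<partial>P) = (\<Sum>i\<in>I. \<integral>\<^sup>+ r. w i r * g (y i r) \<partial>R i)"
  using g
proof (induct rule: borel_measurable_induct)
  case (cong f g)
  have "(\<integral>\<^sup>+ r. w i r * f (y i r) \<partial>R i) = (\<integral>\<^sup>+ r. w i r * g (y i r) \<partial>R i)" if "i \<in> I" for i
    using measurable_space[OF y[OF that]] cong(3) by (intro nn_integral_cong) simp
  moreover have "(\<integral>\<^sup>+ z. f z \<partial>P) = (\<integral>\<^sup>+ z. g z \<partial>P)"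
    using cong(3) sets_eq_imp_space_eq[OF sets] by (intro nn_integral_cong) simp
  ultimately show ?case using cong(4) by simp
next
  case (set A)
  then show ?case using eq[of A] sets by simp
next
  case (mult f c)
  have "(\<integral>\<^sup>+ r. w i r * (c * f (y i r)) \<partial>R i) = c * (\<integral>\<^sup>+ r. w i r * f (y i r) \<partial>R i)" if "i \<in> I" for i
  proof -
    have "(\<lambda>r. w i r * f (y i r)) \<in> borel_measurable (R i)"
      using measurable_compose[OF y[OF that] mult(2)] w[OF that] by simp
    from nn_integral_cmult[OF this, of c] show ?thesis by (simp add: mult_ac)
  qed
  moreover have "(\<integral>\<^sup>+ z. c * f z \<partial>P) = c * (\<integral>\<^sup>+ z. f z \<partial>P)"
    using mult(2) by (intro nn_integral_cmult) (simp add: measurable_cong_sets[OF sets refl])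
  ultimately show ?case using mult(4) by (simp add: sum_distrib_left)
next
  case (add f g)
  have "(\<integral>\<^sup>+ r. w i r * (g (y i r) + f (y i r)) \<partial>R i)
      = (\<integral>\<^sup>+ r. w i r * g (y i r) \<partial>R i) + (\<integral>\<^sup>+ r. w i r * f (y i r) \<partial>R i)" if "i \<in> I" for i
    using measurable_compose[OF y[OF that] add(1)] measurable_compose[OF y[OF that] add(4)] w[OF that]
    by (simp add: distrib_left nn_integral_add)
  moreover have "(\<integral>\<^sup>+ z. g z + f z \<partial>P) = (\<integral>\<^sup>+ z. g z \<partial>P) + (\<integral>\<^sup>+ z. f z \<partial>P)"
    using add(1,4) by (intro nn_integral_add) (simp_all add: measurable_cong_sets[OF sets refl])
  ultimately show ?case using add.hyps by (simp add: sum.distrib)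
next
  case (seq U)
  have "(\<integral>\<^sup>+ z. (SUP j. U j) z \<partial>P) = (\<integral>\<^sup>+ z. (SUP j. U j z) \<partial>P)"
    by (simp add: SUP_apply image_image)
  also have "\<dots> = (SUP j. \<integral>\<^sup>+ z. U j z \<partial>P)"
    using seq by (intro nn_integral_monotone_convergence_SUP) (simp_all add: measurable_cong_sets[OF sets refl])
  also have "\<dots> = (SUP j. \<Sum>i\<in>I. \<integral>\<^sup>+ r. w i r * U j (y i r) \<partial>R i)"
    using seq by simp
  \<comment> \<open>The sequence \<open>U\<close> increases, so the supremum passes through the
    finite sum.\<close>
  also have "\<dots> = (\<Sum>i\<in>I. SUP j. \<integral>\<^sup>+ r. w i r * U j (y i r) \<partial>R i)"
    using seq(4) by (intro ennreal_SUP_sum)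
      (auto simp: incseq_def le_fun_def intro!: nn_integral_mono mult_left_mono)
  also have "\<dots> = (\<Sum>i\<in>I. \<integral>\<^sup>+ r. w i r * (SUP j. U j) (y i r) \<partial>R i)"
  proof (rule sum.cong[OF refl])
    fix i assume i: "i \<in> I"
    have "(SUP j. \<integral>\<^sup>+ r. w i r * U j (y i r) \<partial>R i) = (\<integral>\<^sup>+ r. (SUP j. w i r * U j (y i r)) \<partial>R i)"
    proof (rule nn_integral_monotone_convergence_SUP[symmetric])
      show "incseq (\<lambda>j r. w i r * U j (y i r))"
        using seq(4) by (auto simp: incseq_def le_fun_def intro!: mult_left_mono)
      show "(\<lambda>r. w i r * U j (y i r)) \<in> borel_measurable (R i)" for j
        using measurable_compose[OF y[OF i] seq(1)] w[OF i] by simp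
    qed
    then show "(SUP j. \<integral>\<^sup>+ r. w i r * U j (y i r) \<partial>R i) = (\<integral>\<^sup>+ r. w i r * (SUP j. U j) (y i r) \<partial>R i)"
      by (simp add: SUP_apply SUP_mult_left_ennreal image_image)
  qed
  finally show ?case .
qed

context vec_mixture
begin

text \<open>The joint mass of \<open>f\<close> and a labelling at atoms \<open>t\<close> and
  auxiliary values \<open>u\<close>, up to \<open>aux_weight\<close>. The factor
  \<open>1 / fact k\<close> is what the binomial coefficient contributes besides
  \<open>fact (m + k) / fact m\<close>; \<open>f = 1\<close> gives the marginal mass.\<close>

definition post_mass where
  "post_mass k c t u f = ennreal (1 / fact k) *
    (\<Sum>m. ennreal (pmf q (m + k) * (fact (m + k) / fact m)) * marked_integral k c t u m f)"

abbreviation labellings :: "(nat \<times> (nat \<times> nat \<Rightarrow> nat)) set" where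
  "labellings \<equiv> SIGMA k:{..card obs_index}. surjections obs_index k"

lemma finite_labellings: "finite labellings"
proof -
  have "finite (obs_index \<rightarrow>\<^sub>E {1..k})" for k :: nat by (intro finite_PiE) auto
  then show ?thesis by (intro finite_SigmaI) auto
qed

lemma measurable_post_mass:
  assumes "f \<in> borel_measurable (V)"
    and "t \<in> M \<rightarrow>\<^sub>M locs {1..k}" "\<And>j. j \<in> {1..d} \<Longrightarrow> (\<lambda>x. u x j) \<in> borel_measurable M"
  shows "(\<lambda>x. post_mass k c (t x) (u x) f) \<in> borel_measurable M"
  unfolding post_mass_def
  by (intro borel_measurable_times_ennreal borel_measurable_const borel_measurable_suminf_order
      measurable_marked_integral assms)

lemma post_mass_eq_0:
  assumes "\<And>N. k \<le> N \<Longrightarrow> pmf q N = 0"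
  shows "post_mass k c t u f = 0"
  unfolding post_mass_def using assms[of "_ + k"] by simp

context
  fixes k N :: nat and t :: "nat \<Rightarrow> 'a" and u :: "nat \<Rightarrow> real"
  assumes u: "\<And>j. j \<in> {1..d} \<Longrightarrow> 0 < u j" and t: "t \<in> space (locs {1..k})" and N: "k \<le> N" "0 < pmf q N"
begin

text \<open>Bayes' formula for a single labelling: the same constant occurs for \<open>f\<close> and
  for 1, and the posterior has total mass 1.\<close>

lemma post_mass_eq:
  assumes "f \<in> borel_measurable (V)"
  shows "post_mass k c t u f = post_mass k c t u (\<lambda>_. 1) * (\<integral>\<^sup>+ \<mu>. f \<mu> \<partial>post k c t u)"
proof -
  have "(\<integral>\<^sup>+ \<mu>. 1 \<partial>post k c t u) = 1"
    using prob_space.emeasure_space_1[OF prob_post[OF u t]] by simp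
  then show ?thesis
    unfolding post_mass_def
    by (subst (1 2) sum_marked_integral[OF u t _ N]) (simp_all add: assms mult_ac)
qed

text \<open>Both facts serve division in \<open>ennreal\<close>: a marginal mass of 0 or infinity
  would not cancel.\<close>

lemma post_mass_1_pos: "0 < post_mass k c t u (\<lambda>_. 1)"
  and post_mass_1_finite: "post_mass k c t u (\<lambda>_. 1) < \<infinity>"
proof -
  have "(\<integral>\<^sup>+ \<mu>. 1 \<partial>post k c t u) = 1"
    using prob_space.emeasure_space_1[OF prob_post[OF u t]] by simp
  then have eq: "post_mass k c t u (\<lambda>_. 1) = ennreal (1 / fact k) *
      (ennreal (moment_prod {1..k} c u) * ennreal (\<Sum>m. q_star_weight d q h k u m))"
    unfolding post_mass_def by (subst sum_marked_integral[OF u t _ N]) simp_all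
  show "0 < post_mass k c t u (\<lambda>_. 1)"
    unfolding eq using moment_prod_pos[where u = u and c = c and I = "{1..k}", OF u] suminf_q_star_weight_pos[OF d h u N]
    by (simp add: ennreal_zero_less_mult_iff)
  show "post_mass k c t u (\<lambda>_. 1) < \<infinity>"
    unfolding eq by (simp add: ennreal_mult_less_top)
qed

text \<open>This quotient is the route to measurability of the posterior in \<open>t\<close> and
  \<open>u\<close>: \<open>post_mass\<close> is built from integrals of a jointly measurable
  integrand against fixed measures, whereas the factors of \<open>post\<close> change with the
  parameters.\<close>

lemma emeasure_post:
  assumes A: "A \<in> sets (V)"
  shows "emeasure (post k c t u) A = post_mass k c t u (indicator A) / post_mass k c t u (\<lambda>_. 1)"
proof -
  have "A \<in> sets (post k c t u)"
    using A by (simp add: post_def superposition_law_def)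
  then have "(\<integral>\<^sup>+ \<mu>. indicator A \<mu> \<partial>post k c t u) = emeasure (post k c t u) A"
    by (rule nn_integral_indicator)
  then have "post_mass k c t u (indicator A) = post_mass k c t u (\<lambda>_. 1) * emeasure (post k c t u) A"
    using A by (subst post_mass_eq) simp_all
  then show ?thesis
    using post_mass_1_pos[of c] post_mass_1_finite[of c]
    by (simp add: ennreal_mult_divide_eq mult.commute[of "post_mass k c t u (\<lambda>_. 1)"])
qed

end

lemma sum_binomial_shift:
  fixes g :: "nat \<Rightarrow> ennreal"
  shows "(\<Sum>N. ennreal (pmf q N) * (of_nat (N choose k) * g N))
    = ennreal (1 / fact k) * (\<Sum>m. ennreal (pmf q (m + k) * (fact (m + k) / fact m)) * g (m + k))"
proof -
  \<comment> \<open>The terms with \<open>N < k\<close> vanish with their binomial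
    coefficient.\<close>
  have "(\<Sum>N. ennreal (pmf q N) * (of_nat (N choose k) * g N))
      = (\<Sum>m. ennreal (pmf q (m + k)) * (of_nat ((m + k) choose k) * g (m + k)))"
    by (subst suminf_offset[of _ k]) (auto simp: binomial_eq_0)
  also have "\<dots> = (\<Sum>m. ennreal (1 / fact k) * (ennreal (pmf q (m + k) * (fact (m + k) / fact m)) * g (m + k)))"
  proof (rule suminf_cong)
    fix m
    have "real ((m + k) choose k) = 1 / fact k * (fact (m + k) / fact m)"
      by (simp add: binomial_fact field_simps)
    then have "ennreal (pmf q (m + k)) * of_nat ((m + k) choose k)
        = ennreal (1 / fact k) * ennreal (pmf q (m + k) * (fact (m + k) / fact m))"
      by (simp add: ennreal_of_nat_eq_real_of_nat ennreal_mult[symmetric] mult_ac)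
    then show "ennreal (pmf q (m + k)) * (of_nat ((m + k) choose k) * g (m + k))
        = ennreal (1 / fact k) * (ennreal (pmf q (m + k) * (fact (m + k) / fact m)) * g (m + k))"
      by (simp add: mult.assoc[symmetric])
  qed
  finally show ?thesis by simp
qed

text \<open>For every labelling the joint law has a density with respect to Lebesgue measure times
  the law of \<open>k\<close> locations; \<open>f\<close> tests the measures and \<open>B\<close>
  the observations. The whole series over the number of components is absorbed into
  \<open>post_mass\<close>, so only a finite sum remains.\<close>

lemma joint_formula:
  assumes f: "f \<in> borel_measurable (V)"
    and B: "B \<in> sets Y_space"
  shows "(\<Sum>N. ennreal (pmf q N) * (\<integral>\<^sup>+ z. f (atoms {1..N} (fst z) (snd z)) *
      emeasure (sampling_law d n (atoms {1..N} (fst z) (snd z))) B \<partial>(base {1..N} \<Otimes>\<^sub>M locs {1..N})))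
    = (\<Sum>i\<in>labellings. \<integral>\<^sup>+ r. aux_weight (fst r) * post_mass (fst i) (counts (snd i)) (snd r) (fst r) f
        * indicator B (data (snd i) (snd r), fst r) \<partial>(leb \<Otimes>\<^sub>M locs {1..fst i}))"
proof -
  let ?L = "obs_index"
  let ?S = "\<lambda>N u. \<Sum>c\<in>?L \<rightarrow>\<^sub>E {1..N}. mark_int N c f B u"
  let ?I = "\<lambda>\<pi> t u. indicator B (data \<pi> t, u) :: ennreal"
  let ?P = "\<lambda>i t u. post_mass (fst i) (counts (snd i)) t u f"
  let ?E = "\<lambda>i t u. aux_weight u * ?P i t u * ?I (snd i) t u"
  let ?J = "\<lambda>N. \<integral>\<^sup>+ z. f (atoms {1..N} (fst z) (snd z)) *
      emeasure (sampling_law d n (atoms {1..N} (fst z) (snd z))) B \<partial>(base {1..N} \<Otimes>\<^sub>M locs {1..N})"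
  have S_meas: "?S N \<in> borel_measurable leb" for N
    by (intro borel_measurable_sum measurable_mark_int f B) auto
  have "(\<Sum>N. ennreal (pmf q N) * ?J N)
    = (\<Sum>N. ennreal (pmf q N) * (\<integral>\<^sup>+ u. aux_weight u * ?S N u \<partial>leb))"
  proof (rule suminf_cong)
    fix N
    show "ennreal (pmf q N) * ?J N
      = ennreal (pmf q N) * (\<integral>\<^sup>+ u. aux_weight u * ?S N u \<partial>leb)"
    \<comment> \<open>For \<open>N = 0\<close> there is no atom to observe and the sampling law is
      meaningless; the prior gives this case probability 0.\<close>
    proof (cases "N = 0")
      case False
      then have "1 \<le> N" by simp
      from nn_integral_sampling_law[OF this f B] show ?thesis by simp
    qed (simp add: q_0)
  qed
  also have "\<dots> = (\<integral>\<^sup>+ u. aux_weight u * (\<Sum>N. ennreal (pmf q N) * ?S N u) \<partial>leb)"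
  proof -
    have m: "(\<lambda>u. aux_weight u * ?S N u) \<in> borel_measurable leb" for N
      by (intro borel_measurable_times_ennreal measurable_aux_weight S_meas)
    have "(\<Sum>N. ennreal (pmf q N) * (\<integral>\<^sup>+ u. aux_weight u * ?S N u \<partial>leb))
        = (\<integral>\<^sup>+ u. (\<Sum>N. ennreal (pmf q N) * (aux_weight u * ?S N u)) \<partial>leb)"
      unfolding nn_integral_cmult[OF m, symmetric]
      by (intro nn_integral_suminf[symmetric] borel_measurable_times_ennreal m borel_measurable_const)
    then show ?thesis
      by (simp add: mult.left_commute[of "ennreal _" "aux_weight _"])
  qed
  also have "\<dots> = (\<integral>\<^sup>+ u. (\<Sum>i\<in>labellings. \<integral>\<^sup>+ t. ?E i t u \<partial>locs {1..fst i}) \<partial>leb)"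
  proof (rule nn_integral_cong)
    fix u assume u: "u \<in> space leb"
    have mi: "(\<lambda>t. marked_integral k c t u m f) \<in> borel_measurable (locs {1..k})" for k c m
      by (intro measurable_marked_integral f) auto
    have pm: "(\<lambda>t. post_mass k c t u f) \<in> borel_measurable (locs {1..k})" for k c
      by (intro measurable_post_mass f) auto
    have I_meas: "(\<lambda>t. ?I \<pi> t u) \<in> borel_measurable (locs {1..k})" if "\<pi> \<in> obs_index \<rightarrow> {1..k}" for \<pi> k
      using u by (intro measurable_indicator_data[OF that _ _ B]) auto
    have "?S N u = (\<Sum>i\<in>labellings. of_nat (N choose fst i) * mark_int N (snd i) f B u)" for N
    proof -
      have "?S N u = (\<Sum>k\<in>{..card ?L}. of_nat (N choose k) * (\<Sum>\<pi>\<in>surjections ?L k. mark_int N \<pi> f B u))"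
        by (rule sum_functions_by_image) (auto intro!: mark_int_permute f B u)
      also have "\<dots> = (\<Sum>i\<in>labellings. of_nat (N choose fst i) * mark_int N (snd i) f B u)"
      proof -
        have "finite (surjections ?L k)" for k
          by (rule finite_subset[of _ "?L \<rightarrow>\<^sub>E {1..k}"]) (auto intro!: finite_PiE)
        then show ?thesis
          unfolding sum_distrib_left by (subst sum.Sigma) (auto simp: case_prod_beta')
      qed
      finally show ?thesis .
    qed
    then have "(\<Sum>N. ennreal (pmf q N) * ?S N u)
        = (\<Sum>N. \<Sum>i\<in>labellings. ennreal (pmf q N) * (of_nat (N choose fst i) * mark_int N (snd i) f B u))"
      by (simp add: sum_distrib_left)
    \<comment> \<open>The set of labellings is finite and the same for every \<open>N\<close>, so
      the series passes inside; each labelling is then treated by the shift from \<open>N\<close> to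
      \<open>m + k\<close>.\<close>
    also have "\<dots> = (\<Sum>i\<in>labellings. \<Sum>N. ennreal (pmf q N) * (of_nat (N choose fst i) * mark_int N (snd i) f B u))"
      by (intro suminf_sum) auto
    also have "\<dots> = (\<Sum>i\<in>labellings. \<integral>\<^sup>+ t. ?I (snd i) t u * ?P i t u \<partial>locs {1..fst i})"
    proof (rule sum.cong[OF refl])
      fix i assume "i \<in> labellings"
      then obtain k \<pi> where i: "i = (k, \<pi>)" and "\<pi> \<in> surjections ?L k" by auto
      then have \<pi>: "\<pi> \<in> ?L \<rightarrow> {1..k}" by auto
      let ?q = "\<lambda>m. ennreal (pmf q (m + k) * (fact (m + k) / fact m))"
      let ?M = "\<lambda>m t. ?I \<pi> t u * marked_integral k (counts \<pi>) t u m f"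
      have m: "(\<lambda>t. ?M m t) \<in> borel_measurable (locs {1..k})" for m
        by (intro borel_measurable_times_ennreal I_meas[OF \<pi>] mi)
      have m': "(\<lambda>t. \<Sum>m. ?q m * ?M m t)
          \<in> borel_measurable (locs {1..k})"
        by (intro borel_measurable_suminf_order borel_measurable_times_ennreal borel_measurable_const m)
      have "(\<Sum>N. ennreal (pmf q N) * (of_nat (N choose k) * mark_int N \<pi> f B u))
          = ennreal (1 / fact k) * (\<Sum>m. ?q m *
              (\<integral>\<^sup>+ t. ?M m t \<partial>locs {1..k}))"
        unfolding sum_binomial_shift mark_int_split[OF \<pi> f B u] ..
      also have "\<dots> = ennreal (1 / fact k) * (\<integral>\<^sup>+ t. (\<Sum>m. ?q m *
              ?M m t) \<partial>locs {1..k})"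
        unfolding nn_integral_cmult[OF m, symmetric]
        by (subst nn_integral_suminf) (intro borel_measurable_times_ennreal borel_measurable_const m, rule refl)
      also have "\<dots> = (\<integral>\<^sup>+ t. ?I \<pi> t u * post_mass k (counts \<pi>) t u f \<partial>locs {1..k})"
        unfolding nn_integral_cmult[OF m', symmetric] post_mass_def
        by (intro nn_integral_cong) (simp add: mult.left_commute[of _ "?I \<pi> _ u"])
      finally show "(\<Sum>N. ennreal (pmf q N) * (of_nat (N choose fst i) * mark_int N (snd i) f B u))
          = (\<integral>\<^sup>+ t. ?I (snd i) t u * ?P i t u \<partial>locs {1..fst i})"
        by (simp add: i)
    qed
    finally have "aux_weight u * (\<Sum>N. ennreal (pmf q N) * ?S N u)
        = (\<Sum>i\<in>labellings. aux_weight u * (\<integral>\<^sup>+ t. ?I (snd i) t u * ?P i t u \<partial>locs {1..fst i}))"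
      by (simp only: sum_distrib_left)
    also have "\<dots> = (\<Sum>i\<in>labellings. \<integral>\<^sup>+ t. ?E i t u \<partial>locs {1..fst i})"
    proof (rule sum.cong[OF refl])
      fix i assume "i \<in> labellings"
      then have \<pi>: "snd i \<in> ?L \<rightarrow> {1..fst i}" by auto
      have "(\<lambda>t. ?I (snd i) t u * ?P i t u) \<in> borel_measurable (locs {1..fst i})"
        by (intro borel_measurable_times_ennreal I_meas[OF \<pi>] pm)
      from nn_integral_cmult[OF this, of "aux_weight u"]
      show "aux_weight u * (\<integral>\<^sup>+ t. ?I (snd i) t u * ?P i t u \<partial>locs {1..fst i})
        = (\<integral>\<^sup>+ t. ?E i t u \<partial>locs {1..fst i})"
        by (simp add: mult_ac)
    qed
    finally show "aux_weight u * (\<Sum>N. ennreal (pmf q N) * ?S N u) = \<dots>" .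
  qed
  also have "\<dots> = (\<Sum>i\<in>labellings. \<integral>\<^sup>+ u. \<integral>\<^sup>+ t. ?E i t u \<partial>locs {1..fst i} \<partial>leb)"
  proof (rule nn_integral_sum)
    fix i assume "i \<in> labellings"
    then show "(\<lambda>u. \<integral>\<^sup>+ t. ?E i t u \<partial>locs {1..fst i})
        \<in> borel_measurable leb"
      by (intro sigma_finite_measure.borel_measurable_nn_integral[OF sigma_finite_locs], unfold case_prod_beta',
          intro borel_measurable_times_ennreal measurable_compose[OF measurable_fst measurable_aux_weight]
          measurable_post_mass f measurable_snd measurable_compose[OF measurable_fst measurable_leb_component]
          measurable_indicator_data[where I = "{1..fst i}", OF _ _ _ B] measurable_fst) auto
  qed
  also have "\<dots> = (\<Sum>i\<in>labellings. \<integral>\<^sup>+ r. ?E i (snd r) (fst r) \<partial>(leb \<Otimes>\<^sub>M locs {1..fst i}))"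
  proof (rule sum.cong[OF refl])
    fix i assume i: "i \<in> labellings"
    have "(\<lambda>r. ?E i (snd r) (fst r)) \<in> borel_measurable (leb \<Otimes>\<^sub>M locs {1..fst i})"
      using i by (intro borel_measurable_times_ennreal measurable_compose[OF measurable_fst measurable_aux_weight]
          measurable_post_mass f measurable_snd measurable_compose[OF measurable_fst measurable_leb_component]
          measurable_indicator_data[where I = "{1..fst i}", OF _ _ _ B] measurable_fst) auto
    from sigma_finite_measure.nn_integral_fst[OF sigma_finite_locs this]
    show "(\<integral>\<^sup>+ u. \<integral>\<^sup>+ t. ?E i t u \<partial>locs {1..fst i} \<partial>leb)
        = (\<integral>\<^sup>+ r. ?E i (snd r) (fst r) \<partial>(leb \<Otimes>\<^sub>M locs {1..fst i}))"
      by simp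
  qed
  finally show ?thesis .
qed

end

subsection \<open>A measurable version of the posterior kernel\<close>

locale vec_mixture_diffuse = vec_mixture +
  assumes diag: "Measurable.pred (P0 \<Otimes>\<^sub>M P0) (\<lambda>(x, y). x = y)"
    and diffuse: "\<And>x. x \<in> space P0 \<Longrightarrow> emeasure P0 {x} = 0"
begin

lemma allocated_law_cong:
  assumes "\<And>i. i \<in> {1..k} \<Longrightarrow> t i = t' i" "\<And>j i. j \<in> {1..d} \<Longrightarrow> i \<in> {1..k} \<Longrightarrow> c j i = c' j i"
  shows "allocated_law d P0 h k t c u = allocated_law d P0 h k t' c' u"
proof -
  have 1: "(\<Pi>\<^sub>M j\<in>{1..d}. \<Pi>\<^sub>M i\<in>{1..k}. density_propto lpos (\<lambda>s. exp (- u j * s) * s ^ c j i * h j s))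
      = (\<Pi>\<^sub>M j\<in>{1..d}. \<Pi>\<^sub>M i\<in>{1..k}. density_propto lpos (\<lambda>s. exp (- u j * s) * s ^ c' j i * h j s))"
    by (intro PiM_cong refl) (simp add: assms(2))
  have 2: "(\<lambda>j\<in>{1..d}. dirac_sum P0 {1..k} (S j) t) = (\<lambda>j\<in>{1..d}. dirac_sum P0 {1..k} (S j) t')" for S
    by (intro restrict_ext dirac_sum_cong) (auto simp: assms(1))
  show ?thesis unfolding allocated_law_def 1 2 ..
qed

lemma post_cong:
  assumes "\<And>i. i \<in> {1..k} \<Longrightarrow> t i = t' i" "\<And>j i. j \<in> {1..d} \<Longrightarrow> i \<in> {1..k} \<Longrightarrow> c j i = c' j i"
  shows "post k c t u = post k c' t' u"
  unfolding post_def using allocated_law_cong[of k t t' c c' u] assms by simp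

lemma tilted_jumps_permute:
  assumes \<sigma>: "\<sigma> permutes {1..k}" and u: "\<And>j. j \<in> {1..d} \<Longrightarrow> 0 < u j"
  shows "tilted_jumps {1..k} (\<lambda>j i. c j (\<sigma> i)) u = distr (tilted_jumps {1..k} c u) (tilted_jumps {1..k} (\<lambda>j i. c j (\<sigma> i)) u)
      (\<lambda>S. \<lambda>p\<in>{1..d} \<times> {1..k}. S (fst p, \<sigma> (snd p)))"
proof -
  let ?g = "\<lambda>p. tilted (h (fst p)) (c (fst p) (snd p)) (u (fst p))"
  have "distr (PiM ({1..d} \<times> {1..k}) ?g) (\<Pi>\<^sub>M p\<in>{1..d} \<times> {1..k}. ?g (fst p, \<sigma> (snd p)))
      (\<lambda>S. \<lambda>p\<in>{1..d} \<times> {1..k}. S (fst p, \<sigma> (snd p))) = (\<Pi>\<^sub>M p\<in>{1..d} \<times> {1..k}. ?g (fst p, \<sigma> (snd p)))"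
  proof (rule distr_PiM_reindex)
    show "prob_space (?g p)" if "p \<in> {1..d} \<times> {1..k}" for p
      using that by (intro prob_space_tilted h u) (simp_all add: mem_Times_iff)
    show "inj_on (\<lambda>p. (fst p, \<sigma> (snd p))) ({1..d} \<times> {1..k})"
      by (rule inj_onI) (simp add: inj_eq[OF permutes_inj[OF \<sigma>]] prod_eq_iff)
    show "(\<lambda>p. (fst p, \<sigma> (snd p))) \<in> {1..d} \<times> {1..k} \<rightarrow> {1..d} \<times> {1..k}"
      using permutes_in_image[OF \<sigma>] by (intro funcsetI) (simp add: mem_Times_iff)
  qed
  then show ?thesis by (simp add: tilted_jumps_def)
qed

text \<open>The posterior depends on the distinct values only as a set.\<close>

lemma post_enumeration:
  assumes u: "\<And>j. j \<in> {1..d} \<Longrightarrow> 0 < u j"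
    and t: "bij_betw t {1..k} D" and t': "bij_betw t' {1..k} D" and D: "D \<subseteq> space P0"
  shows "post k (\<lambda>j i. g j (t i)) t u = post k (\<lambda>j i. g j (t' i)) t' u"
proof -
  \<comment> \<open>The permutation that carries one enumeration into the other,
    \<open>t (\<sigma> i) = t' i\<close> on \<open>{1..k}\<close>; off this set it is the identity,
    as \<open>permutes\<close> demands.\<close>
  define \<sigma> where "\<sigma> = (\<lambda>i. if i \<in> {1..k} then inv_into {1..k} t (t' i) else i)"
  have "bij_betw (inv_into {1..k} t \<circ> t') {1..k} {1..k}"
    by (rule bij_betw_trans[OF t' bij_betw_inv_into[OF t]])
  then have "bij_betw \<sigma> {1..k} {1..k}"
    by (rule bij_betw_cong[THEN iffD1, rotated]) (simp add: \<sigma>_def)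
  then have \<sigma>: "\<sigma> permutes {1..k}"
    by (rule bij_imp_permutes) (auto simp: \<sigma>_def)
  have t\<sigma>: "t (\<sigma> i) = t' i" if "i \<in> {1..k}" for i
  proof -
    have "t' i \<in> t ` {1..k}"
      using imageI[OF that, of t'] t t' by (simp add: bij_betw_def)
    from f_inv_into_f[OF this] show ?thesis using that by (simp add: \<sigma>_def)
  qed
  \<comment> \<open>The flat form of the allocated law concerns elements of the product space, which
    are \<open>undefined\<close> off \<open>{1..k}\<close>; the law itself depends only on the
    values in \<open>{1..k}\<close>.\<close>
  let ?t = "restrict t {1..k}" and ?t' = "restrict t' {1..k}"
  let ?c = "\<lambda>j i. g j (t i)" and ?c' = "\<lambda>j i. g j (t (\<sigma> i))"
  have sp: "?t \<in> space (locs {1..k})" "?t' \<in> space (locs {1..k})"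
    using t t' D by (auto simp: space_PiM bij_betw_def)
  let ?p = "\<lambda>S::nat \<times> nat \<Rightarrow> real. \<lambda>p\<in>{1..d} \<times> {1..k}. S (fst p, \<sigma> (snd p))"
  have p: "?p \<in> tilted_jumps {1..k} ?c u \<rightarrow>\<^sub>M tilted_jumps {1..k} ?c' u"
    unfolding measurable_cong_sets[OF sets_tilted_jumps sets_tilted_jumps]
    using permutes_in_image[OF \<sigma>]
    by (intro measurable_restrict measurable_component_singleton) (simp add: mem_Times_iff)
  have "allocated_law d P0 h k t' (\<lambda>j i. g j (t' i)) u = allocated_law d P0 h k ?t' ?c' u"
    by (intro allocated_law_cong) (simp_all add: t\<sigma>)
  also have "\<dots> = distr (tilted_jumps {1..k} ?c' u) (V) (\<lambda>S. atoms {1..k} S ?t')"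
    by (rule allocated_law_flat[OF u sp(2)])
  also have "\<dots> = distr (tilted_jumps {1..k} ?c u) (V) (\<lambda>S. atoms {1..k} (?p S) ?t')"
    by (subst tilted_jumps_permute[OF \<sigma> u], assumption, subst distr_distr)
      (auto intro!: measurable_vec_atoms_t[OF u sp(2)] p simp: sets_tilted_jumps comp_def)
  also have "\<dots> = distr (tilted_jumps {1..k} ?c u) (V) (\<lambda>S. atoms {1..k} S ?t)"
  proof -
    have "?t' = (\<lambda>i\<in>{1..k}. ?t (\<sigma> i))"
      using permutes_in_image[OF \<sigma>] by (intro restrict_ext) (simp add: t\<sigma>)
    then show ?thesis by (simp only: vec_atoms_permute[OF \<sigma>])
  qed
  also have "\<dots> = allocated_law d P0 h k ?t ?c u"
    by (rule allocated_law_flat[OF u sp(1), symmetric])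
  also have "\<dots> = allocated_law d P0 h k t ?c u"
    by (intro allocated_law_cong) simp_all
  finally show ?thesis by (simp add: post_def)
qed

text \<open>The equality pattern of the data takes finitely many values. An enumeration of the distinct
  values through representatives that depend only on the pattern is therefore measurable. Outside
  the good set, which has probability one, the kernel is set to the prior.\<close>

definition pattern :: "(nat \<Rightarrow> nat \<Rightarrow> 'a) \<Rightarrow> ((nat \<times> nat) \<times> (nat \<times> nat)) set" where
  "pattern x = {p \<in> obs_index \<times> obs_index. x (fst (fst p)) (snd (fst p)) = x (fst (snd p)) (snd (snd p))}"

text \<open>For an equivalence relation \<open>E\<close> on the observations, a transversal together
  with the number of its classes.\<close>

definition is_reps :: "((nat \<times> nat) \<times> (nat \<times> nat)) set \<Rightarrow> nat \<times> (nat \<Rightarrow> nat \<times> nat) \<Rightarrow> bool" where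
  "is_reps E kr \<longleftrightarrow> snd kr \<in> {1..fst kr} \<rightarrow> obs_index \<and>
    (\<forall>l\<in>obs_index. \<exists>!i. i \<in> {1..fst kr} \<and> (l, snd kr i) \<in> E)"

definition reps where "reps E = (SOME kr. is_reps E kr)"

definition enum_at :: "nat \<Rightarrow> (nat \<Rightarrow> nat \<times> nat) \<Rightarrow> (nat \<Rightarrow> nat \<Rightarrow> 'a) \<Rightarrow> nat \<Rightarrow> 'a" where
  "enum_at k r x = (\<lambda>i\<in>{1..k}. x (fst (r i)) (snd (r i)))"

definition rep_counts :: "((nat \<times> nat) \<times> (nat \<times> nat)) set \<Rightarrow> (nat \<Rightarrow> nat \<times> nat) \<Rightarrow> nat \<Rightarrow> nat \<Rightarrow> nat" where
  "rep_counts E r j i = card {i' \<in> {1..n j}. ((j, i'), r i) \<in> E}"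

text \<open>For atoms in the space these conditions make the marginal mass positive and finite; the
  second one says that \<open>k\<close> distinct values can occur.\<close>

definition good :: "nat \<Rightarrow> (nat \<Rightarrow> real) \<Rightarrow> bool" where
  "good k u \<longleftrightarrow> (\<forall>j\<in>{1..d}. 0 < u j) \<and> (\<exists>N\<ge>k. 0 < pmf q N)"

definition prior where "prior = vec_ifpp d q (\<lambda>j. density lpos (\<lambda>s. ennreal (h j s))) P0"

definition kernel_at where
  "kernel_at E y = (let (k, r) = reps E in
    if good k (snd y) then post k (rep_counts E r) (enum_at k r (fst y)) (snd y) else prior)"

definition kernel where "kernel y = kernel_at (pattern (fst y)) y"

lemma distinct_values_eq_image: "distinct_values d n x = (\<lambda>l. x (fst l) (snd l)) ` obs_index"
proof (intro equalityI subsetI)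
  fix v assume "v \<in> distinct_values d n x"
  then obtain j i where ji: "(j, i) \<in> obs_index" "v = x j i" unfolding distinct_values_def by auto
  show "v \<in> (\<lambda>l. x (fst l) (snd l)) ` obs_index"
    by (rule image_eqI[of _ _ "(j, i)"]) (use ji in auto)
next
  fix v assume "v \<in> (\<lambda>l. x (fst l) (snd l)) ` obs_index"
  then obtain l where "v = x (fst l) (snd l)" "l \<in> obs_index" by (rule imageE)
  then have "v = x (fst l) (snd l) \<and> fst l \<in> {1..d} \<and> snd l \<in> {1..n (fst l)}" by auto
  then show "v \<in> distinct_values d n x" unfolding distinct_values_def by blast
qed

lemma finite_distinct_values: "finite (distinct_values d n x)"
  by (simp add: distinct_values_eq_image)

text \<open>For every distinct value an observation that takes it is chosen as representative;
  injectivity of \<open>t\<close> makes the representative of a class unique.\<close>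

lemma is_reps_pattern:
  assumes t: "bij_betw t {1..k} (distinct_values d n x)"
  shows "\<exists>r. is_reps (pattern x) (k, r)"
proof -
  have "\<exists>l\<in>obs_index. x (fst l) (snd l) = t i" if "i \<in> {1..k}" for i
  proof -
    have "t i \<in> distinct_values d n x" using bij_betwE[OF t] that by blast
    then obtain l where "t i = x (fst l) (snd l)" "l \<in> obs_index"
      unfolding distinct_values_eq_image by (rule imageE)
    then show ?thesis by (intro bexI[of _ l]) simp_all
  qed
  then obtain r where r: "\<And>i. i \<in> {1..k} \<Longrightarrow> r i \<in> obs_index \<and> x (fst (r i)) (snd (r i)) = t i"
    by metis
  have "\<exists>!i. i \<in> {1..k} \<and> (l, r i) \<in> pattern x" if l: "l \<in> obs_index" for l
  proof -
    have "x (fst l) (snd l) \<in> distinct_values d n x"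
      unfolding distinct_values_eq_image by (rule imageI[OF l])
    then have "x (fst l) (snd l) \<in> t ` {1..k}"
      using bij_betw_imp_surj_on[OF t] by simp
    then obtain i where i: "i \<in> {1..k}" "t i = x (fst l) (snd l)"
      by (metis imageE)
    show ?thesis
    proof (rule ex1I[of _ i])
      show "i \<in> {1..k} \<and> (l, r i) \<in> pattern x"
        using i l r[OF i(1)] by (simp add: pattern_def)
      fix i' assume i': "i' \<in> {1..k} \<and> (l, r i') \<in> pattern x"
      then have "t i' = t i" using r[of i'] i by (simp add: pattern_def)
      then show "i' = i" using inj_onD[OF bij_betw_imp_inj_on[OF t]] i i' by blast
    qed
  qed
  moreover have "r \<in> {1..k} \<rightarrow> obs_index" using r by (intro funcsetI) blast
  ultimately have "is_reps (pattern x) (k, r)" by (simp add: is_reps_def)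
  then show ?thesis by blast
qed

lemma is_reps_reps: "is_reps (pattern x) (reps (pattern x))"
proof -
  obtain t where "bij_betw t {1..card (distinct_values d n x)} (distinct_values d n x)"
    using finite_same_card_bij[of "{1..card (distinct_values d n x)}"] finite_distinct_values by auto
  from is_reps_pattern[OF this] show ?thesis
    unfolding reps_def by (metis someI_ex)
qed

text \<open>Uniqueness in \<open>is_reps\<close> gives injectivity, existence gives
  surjectivity.\<close>

lemma bij_betw_enum_at:
  assumes r: "is_reps (pattern x) (k, r)"
  shows "bij_betw (enum_at k r x) {1..k} (distinct_values d n x)"
proof -
  note r' = r[unfolded is_reps_def fst_conv snd_conv]
  have r1: "r i \<in> obs_index" if "i \<in> {1..k}" for i
    using funcset_mem[OF conjunct1[OF r'] that] .
  have r2: "\<exists>!i. i \<in> {1..k} \<and> (l, r i) \<in> pattern x" if "l \<in> obs_index" for l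
    using bspec[OF conjunct2[OF r'] that] .
  show ?thesis
    unfolding bij_betw_def
  proof
    show "inj_on (enum_at k r x) {1..k}"
    proof (rule inj_onI)
      fix i i' assume i: "i \<in> {1..k}" "i' \<in> {1..k}" and eq: "enum_at k r x i = enum_at k r x i'"
      have "(r i, r i) \<in> pattern x" "(r i, r i') \<in> pattern x"
        using i eq r1 by (simp_all add: pattern_def enum_at_def)
      then show "i = i'" using r2[OF r1[OF i(1)]] i by blast
    qed
    show "enum_at k r x ` {1..k} = distinct_values d n x"
    proof (intro equalityI subsetI)
      fix v assume "v \<in> enum_at k r x ` {1..k}"
      then obtain i where i: "i \<in> {1..k}" "v = x (fst (r i)) (snd (r i))" by (auto simp: enum_at_def)
      show "v \<in> distinct_values d n x"
        unfolding distinct_values_eq_image i(2) by (rule imageI[OF r1[OF i(1)]])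
    next
      fix v assume "v \<in> distinct_values d n x"
      then obtain l where l: "v = x (fst l) (snd l)" "l \<in> obs_index"
        unfolding distinct_values_eq_image by (rule imageE)
      from ex1_implies_ex[OF r2[OF l(2)]] obtain m where m: "m \<in> {1..k}" "(l, r m) \<in> pattern x" by blast
      then have "v = enum_at k r x m"
        using l by (simp add: pattern_def enum_at_def)
      then show "v \<in> enum_at k r x ` {1..k}" using m(1) by (rule image_eqI)
    qed
  qed
qed

lemma rep_counts_eq:
  assumes r: "is_reps (pattern x) (k, r)" and j: "j \<in> {1..d}" and i: "i \<in> {1..k}"
  shows "rep_counts (pattern x) r j i = group_count n x j (enum_at k r x i)"
proof -
  have "r i \<in> obs_index"
    using r i unfolding is_reps_def fst_conv snd_conv by blast
  then have "((j, i'), r i) \<in> pattern x \<longleftrightarrow> x j i' = enum_at k r x i" if "i' \<in> {1..n j}" for i'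
    using i j that by (simp add: pattern_def enum_at_def)
  then have "{i' \<in> {1..n j}. ((j, i'), r i) \<in> pattern x} = {i' \<in> {1..n j}. x j i' = enum_at k r x i}"
    by blast
  then show ?thesis by (simp add: rep_counts_def group_count_def)
qed

lemma distinct_values_subset: "x \<in> space (obs_space d n P0) \<Longrightarrow> distinct_values d n x \<subseteq> space P0"
  by (auto simp: distinct_values_def obs_space_def space_PiM PiE_iff)

text \<open>The kernel uses the chosen representatives, but the posterior depends only on the set of
  distinct values. Hence every enumeration \<open>t\<close> yields the same law, even one picked in
  a nonmeasurable way for each \<open>x\<close>.\<close>

lemma kernel_eq:
  assumes x: "x \<in> space (obs_space d n P0)" and t: "bij_betw t {1..k} (distinct_values d n x)" and g: "good k u"
  shows "kernel (x, u) = post k (\<lambda>j i. group_count n x j (t i)) t u"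
proof -
  obtain k' r where kr: "reps (pattern x) = (k', r)" by (cases "reps (pattern x)")
  have r: "is_reps (pattern x) (k', r)" using is_reps_reps[of x] by (simp add: kr)
  note b = bij_betw_enum_at[OF r]
  have [simp]: "k' = k" using bij_betw_same_card[OF b] bij_betw_same_card[OF t] by simp
  have u: "\<And>j. j \<in> {1..d} \<Longrightarrow> 0 < u j" using g by (simp add: good_def)
  have "kernel (x, u) = post k (rep_counts (pattern x) r) (enum_at k r x) u"
    using g by (simp add: kernel_def kernel_at_def kr)
  also have "\<dots> = post k (\<lambda>j i. group_count n x j (enum_at k r x i)) (enum_at k r x) u"
    using r by (intro post_cong refl) (simp add: rep_counts_eq)
  also have "\<dots> = post k (\<lambda>j i. group_count n x j (t i)) t u"
    by (rule post_enumeration[OF u _ t distinct_values_subset[OF x]]) (use b in simp_all)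
  finally show ?thesis .
qed

lemma fst_reps_pattern:
  assumes "bij_betw t {1..k} (distinct_values d n x)"
  shows "fst (reps (pattern x)) = k"
proof -
  obtain k' r where kr: "reps (pattern x) = (k', r)" by (cases "reps (pattern x)")
  have r: "is_reps (pattern x) (k', r)" using is_reps_reps[of x] by (simp add: kr)
  show ?thesis
    using bij_betw_same_card[OF bij_betw_enum_at[OF r]] bij_betw_same_card[OF assms] by (simp add: kr)
qed

end

section \<open>Measurability of the posterior kernel\<close>

context vec_mixture_diffuse
begin

lemma measurable_obs_component:
  assumes "l \<in> obs_index"
  shows "(\<lambda>x. x (fst l) (snd l)) \<in> obs_space d n P0 \<rightarrow>\<^sub>M P0"
proof -
  have l: "fst l \<in> {1..d}" "snd l \<in> {1..n (fst l)}" using assms by auto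
  show ?thesis
    unfolding obs_space_def
    by (rule measurable_compose[OF measurable_component_singleton[OF l(1)]])
      (rule measurable_component_singleton[OF l(2)])
qed

lemma countable_patterns: "countable (Pow (obs_index \<times> obs_index))"
  by (intro countable_finite) simp

text \<open>There are finitely many patterns, and each is a finite combination of equalities between
  two observations; these are measurable because the diagonal is.\<close>

lemma measurable_pattern: "pattern \<in> obs_space d n P0 \<rightarrow>\<^sub>M count_space (Pow (obs_index \<times> obs_index))"
proof (subst measurable_count_space_eq2)
  show "finite (Pow (obs_index \<times> obs_index))" by simp
  show "pattern \<in> space (obs_space d n P0) \<rightarrow> Pow (obs_index \<times> obs_index) \<and>
    (\<forall>E\<in>Pow (obs_index \<times> obs_index). pattern -` {E} \<inter> space (obs_space d n P0) \<in> sets (obs_space d n P0))"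
  proof (intro conjI ballI funcsetI)
    show "pattern x \<in> Pow (obs_index \<times> obs_index)" for x
      unfolding pattern_def by blast
    fix E assume E: "E \<in> Pow (obs_index \<times> obs_index)"
    have "Measurable.pred (obs_space d n P0) (\<lambda>x. \<forall>p\<in>obs_index \<times> obs_index.
        (x (fst (fst p)) (snd (fst p)) = x (fst (snd p)) (snd (snd p))) \<longleftrightarrow> p \<in> E)"
    proof (rule pred_intros_finite(3))
      fix p assume "p \<in> obs_index \<times> obs_index"
      then have p: "fst p \<in> obs_index" "snd p \<in> obs_index" by auto
      have [measurable]: "Measurable.pred (obs_space d n P0) (\<lambda>x. x (fst (fst p)) (snd (fst p)) = x (fst (snd p)) (snd (snd p)))"
        by (rule measurable_pred_eq[OF diag measurable_obs_component[OF p(1)] measurable_obs_component[OF p(2)]])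
      show "Measurable.pred (obs_space d n P0) (\<lambda>x. (x (fst (fst p)) (snd (fst p)) = x (fst (snd p)) (snd (snd p))) \<longleftrightarrow> p \<in> E)"
        by measurable
    qed simp
    moreover have "pattern -` {E} \<inter> space (obs_space d n P0) = {x \<in> space (obs_space d n P0). \<forall>p\<in>obs_index \<times> obs_index.
        (x (fst (fst p)) (snd (fst p)) = x (fst (snd p)) (snd (snd p))) \<longleftrightarrow> p \<in> E}"
      using E unfolding pattern_def by blast
    ultimately show "pattern -` {E} \<inter> space (obs_space d n P0) \<in> sets (obs_space d n P0)"
      by (simp add: pred_def)
  qed
qed

lemma prob_prior: "prob_space prior" and sets_prior: "sets prior = sets (V)"
proof -
  have G: "prob_space (density lpos (\<lambda>s. ennreal (h j s))) \<and> sets (density lpos (\<lambda>s. ennreal (h j s))) = sets lpos"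
    if "j \<in> {1..d}" for j
    using prob_space_density_pos[OF h[OF that]] by simp
  show "prob_space prior"
    unfolding prior_def by (rule prob_space_vec_ifpp[OF P0 G])
  show "sets prior = sets (V)"
    unfolding prior_def by (rule sets_vec_ifpp[OF P0 G])
qed

lemma nn_integral_prior:
  assumes "f \<in> borel_measurable (V)"
  shows "(\<integral>\<^sup>+ v. f v \<partial>prior) = (\<Sum>N. ennreal (pmf q N) *
    (\<integral>\<^sup>+ z. f (atoms {1..N} (fst z) (snd z)) \<partial>(base {1..N} \<Otimes>\<^sub>M locs {1..N})))"
  unfolding prior_def base_def
  using nn_integral_vec_ifpp[OF d P0 _ _ assms, of "\<lambda>j. density lpos (\<lambda>s. ennreal (h j s))" q]
  by (simp add: prob_space_density_pos h case_prod_beta')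

lemma measurable_aux_component: "j \<in> {1..d} \<Longrightarrow> (\<lambda>y. snd y j) \<in> borel_measurable (M \<Otimes>\<^sub>M aux_space d)"
  unfolding aux_space_def by (rule measurable_compose[OF measurable_snd measurable_component_singleton])

lemma measurable_good: "Measurable.pred (M \<Otimes>\<^sub>M aux_space d) (\<lambda>y. good k (snd y))"
  unfolding good_def
proof (rule pred_intros_logic(3))
  show "Measurable.pred (M \<Otimes>\<^sub>M aux_space d) (\<lambda>y. \<forall>j\<in>{1..d}. 0 < snd y j)"
  proof (rule pred_intros_finite(3))
    fix j assume "j \<in> {1..d}"
    then have [measurable]: "(\<lambda>y. snd y j) \<in> borel_measurable (M \<Otimes>\<^sub>M aux_space d)"
      by (rule measurable_aux_component)
    show "Measurable.pred (M \<Otimes>\<^sub>M aux_space d) (\<lambda>y. 0 < snd y j)" by measurable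
  qed simp
qed simp

lemma enum_at_measurable:
  assumes "r \<in> {1..k} \<rightarrow> obs_index"
  shows "(\<lambda>y. enum_at k r (fst y)) \<in> Y_space \<rightarrow>\<^sub>M locs {1..k}"
  unfolding enum_at_def
  by (intro measurable_restrict measurable_compose[OF measurable_fst measurable_obs_component])
    (rule funcset_mem[OF assms])

text \<open>With the pattern fixed, representatives and counts are constants and the enumeration
  consists of coordinate maps. On the good set the mass of an event is a quotient of
  \<open>post_mass\<close> terms, whose measurability is known.\<close>

lemma kernel_at_measurable:
  assumes r: "fst (reps E) = k" "snd (reps E) \<in> {1..k} \<rightarrow> obs_index"
  shows "kernel_at E \<in> Y_space \<rightarrow>\<^sub>M prob_algebra (V)"
proof -
  obtain r where R: "reps E = (k, r)" using r(1) by (cases "reps E") simp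
  have r: "r \<in> {1..k} \<rightarrow> obs_index" using r(2) by (simp add: R)
  let ?c = "rep_counts E r" and ?t = "\<lambda>y. enum_at k r (fst y)"
  have t: "?t \<in> Y_space \<rightarrow>\<^sub>M locs {1..k}" by (rule enum_at_measurable[OF r])
  have K: "kernel_at E y = (if good k (snd y) then post k ?c (?t y) (snd y) else prior)" for y
    by (simp add: kernel_at_def R)
  have prob: "prob_space (kernel_at E y)" if "y \<in> space Y_space" for y
    using measurable_space[OF t that] prob_prior unfolding K
    by (auto simp: good_def intro!: prob_post)
  have sets_K: "sets (kernel_at E y) = sets (V)" for y
    unfolding K by (simp add: sets_prior) (simp add: post_def superposition_law_def)
  have "kernel_at E \<in> Y_space \<rightarrow>\<^sub>M subprob_algebra (V)"
  proof (rule measurable_subprob_algebra)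
    fix A assume A: "A \<in> sets (V)"
    have m: "(\<lambda>y. if good k (snd y) then post_mass k ?c (?t y) (snd y) (indicator A) / post_mass k ?c (?t y) (snd y) (\<lambda>_. 1)
        else emeasure prior A) \<in> borel_measurable Y_space"
      by (intro measurable_If measurable_good[unfolded pred_def] borel_measurable_divide_ennreal measurable_post_mass t
          measurable_aux_component borel_measurable_const borel_measurable_indicator A)
    show "(\<lambda>y. emeasure (kernel_at E y) A) \<in> borel_measurable Y_space"
    proof (rule measurable_cong[THEN iffD1, OF _ m])
      fix y assume y: "y \<in> space Y_space"
      show "(if good k (snd y) then post_mass k ?c (?t y) (snd y) (indicator A) / post_mass k ?c (?t y) (snd y) (\<lambda>_. 1)
        else emeasure prior A) = emeasure (kernel_at E y) A"
        unfolding K using emeasure_post[OF _ measurable_space[OF t y] _ _ A, of "snd y"]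
        by (auto simp: good_def)
    qed
  qed (use prob sets_K in \<open>auto intro: prob_space_imp_subprob_space\<close>)
  then show ?thesis
    by (intro measurable_prob_algebraI prob) auto
qed

lemma measurable_kernel: "kernel \<in> Y_space \<rightarrow>\<^sub>M prob_algebra (V)"
proof -
  let ?P = "pattern ` space (obs_space d n P0)"
  have P: "?P \<subseteq> Pow (obs_index \<times> obs_index)" unfolding pattern_def by blast
  have "(\<lambda>y. pattern (fst y)) \<in> Y_space \<rightarrow>\<^sub>M count_space (Pow (obs_index \<times> obs_index))"
    by (rule measurable_compose[OF measurable_fst measurable_pattern])
  then have p: "(\<lambda>y. pattern (fst y)) \<in> Y_space \<rightarrow>\<^sub>M count_space ?P"
    unfolding measurable_count_space_eq2[OF finite_subset[OF P finite_Pow_iff[THEN iffD2]], simplified]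
    using P by (auto simp: measurable_def space_pair_measure)
  have "(\<lambda>y. kernel_at (pattern (fst y)) y) \<in> Y_space \<rightarrow>\<^sub>M prob_algebra (V)"
  proof (rule measurable_compose_countable'[OF _ p])
    fix E assume "E \<in> ?P"
    then obtain x where E: "E = pattern x" by auto
    have "is_reps E (reps E)" unfolding E by (rule is_reps_reps)
    then have "snd (reps E) \<in> {1..fst (reps E)} \<rightarrow> obs_index"
      unfolding is_reps_def by (rule conjunct1)
    then show "kernel_at E \<in> Y_space \<rightarrow>\<^sub>M prob_algebra (V)"
      by (rule kernel_at_measurable[OF refl])
  next
    show "countable ?P" by (rule countable_subset[OF P countable_patterns])
  qed
  then show ?thesis by (simp add: kernel_def[abs_def])
qed

lemma measurable_good_pattern: "Measurable.pred Y_space (\<lambda>y. good (fst (reps (pattern (fst y)))) (snd y))"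
  by (rule measurable_compose_countable'[OF measurable_good _ countable_patterns])
    (rule measurable_compose[OF measurable_fst measurable_pattern])

section \<open>Bayes' formula on the label spaces\<close>

definition label_point :: "(nat \<times> (nat \<times> nat \<Rightarrow> nat)) \<Rightarrow> (nat \<Rightarrow> real) \<times> (nat \<Rightarrow> 'a) \<Rightarrow> (nat \<Rightarrow> nat \<Rightarrow> 'a) \<times> (nat \<Rightarrow> real)" where
  "label_point i r = (data (snd i) (snd r), fst r)"

definition label_weight :: "(nat \<times> (nat \<times> nat \<Rightarrow> nat)) \<Rightarrow> (nat \<Rightarrow> real) \<times> (nat \<Rightarrow> 'a) \<Rightarrow> ((nat \<Rightarrow> 'a measure) \<Rightarrow> ennreal) \<Rightarrow> ennreal" where
  "label_weight i r f = aux_weight (fst r) * post_mass (fst i) (counts (snd i)) (snd r) (fst r) f"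

abbreviation label_mass :: "(nat \<times> (nat \<times> nat \<Rightarrow> nat)) \<Rightarrow> (nat \<Rightarrow> real) \<times> (nat \<Rightarrow> 'a) \<Rightarrow> ennreal" where
  "label_mass i r \<equiv> label_weight i r (\<lambda>_. 1)"

abbreviation label_space :: "nat \<times> (nat \<times> nat \<Rightarrow> nat) \<Rightarrow> ((nat \<Rightarrow> real) \<times> (nat \<Rightarrow> 'a)) measure" where
  "label_space i \<equiv> leb \<Otimes>\<^sub>M locs {1..fst i}"

lemma measurable_label_point:
  assumes "i \<in> labellings"
  shows "label_point i \<in> label_space i \<rightarrow>\<^sub>M Y_space"
proof -
  have "snd i \<in> obs_index \<rightarrow> {1..fst i}" using assms by auto
  then have "(\<lambda>r. data (snd i) (snd r)) \<in> label_space i \<rightarrow>\<^sub>M obs_space d n P0"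
    by (intro measurable_compose[OF measurable_snd measurable_data])
  then show ?thesis
    unfolding label_point_def[abs_def]
    by (intro measurable_Pair) (auto simp: measurable_cong_sets[OF refl sets_aux_space])
qed

lemma measurable_label_weight:
  assumes "f \<in> borel_measurable (V)"
  shows "(\<lambda>r. label_weight i r f) \<in> borel_measurable (label_space i)"
  unfolding label_weight_def
  by (intro borel_measurable_times_ennreal measurable_compose[OF measurable_fst measurable_aux_weight]
      measurable_post_mass assms measurable_snd measurable_compose[OF measurable_fst measurable_leb_component])

text \<open>For fixed \<open>u\<close> the locations are independent draws from a diffuse law, and
  finitely many such draws are almost surely distinct.\<close>

lemma AE_label_inj: "AE r in label_space i. inj_on (snd r) {1..fst i}"
proof -
  interpret pair_sigma_finite leb "locs {1..fst i}"
    by (simp add: pair_sigma_finite_def sigma_finite_PiM_lborel sigma_finite_locs)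
  have "Measurable.pred (label_space i) (\<lambda>r. \<forall>a\<in>{1..fst i}. \<forall>b\<in>{1..fst i}. snd r a = snd r b \<longrightarrow> a = b)"
  proof (intro pred_intros_finite(3) pred_intros_logic finite_atLeastAtMost)
    fix a b assume "a \<in> {1..fst i}" "b \<in> {1..fst i}"
    then show "Measurable.pred (label_space i) (\<lambda>r. snd r a = snd r b)"
      by (intro measurable_pred_eq[OF diag] measurable_compose[OF measurable_snd measurable_component_singleton])
  qed simp_all
  then have m: "Measurable.pred (label_space i) (\<lambda>r. inj_on (snd r) {1..fst i})"
    by (simp only: inj_on_def)
  show ?thesis
  proof (rule AE_pair_measure)
    show "{r \<in> space (label_space i). inj_on (snd r) {1..fst i}} \<in> sets (label_space i)"
      using m by (simp add: pred_def)
    show "AE u in leb. AE t in locs {1..fst i}. inj_on (snd (u, t)) {1..fst i}"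
      using AE_PiM_inj_on[OF _ P0 diag diffuse, of "{1..fst i}"] by simp
  qed
qed

lemma aux_weight_nonzero:
  assumes "aux_weight u \<noteq> 0" "j \<in> {1..d}"
  shows "0 < u j"
proof (rule ccontr)
  assume "\<not> 0 < u j"
  then have "aux_weight u = 0"
    unfolding aux_weight_def using assms(2) by (intro prod_zero bexI[of _ j]) auto
  with assms(1) show False by simp
qed

text \<open>A nonzero marginal mass forces \<open>u j > 0\<close> and makes \<open>k\<close>
  components possible. If the atoms are distinct, two observations agree exactly when their labels
  do; the counts of \<open>\<pi>\<close> are then those of the data, and the kernel at the data is
  the posterior at the labelled atoms, whichever labelling produced them.\<close>

lemma label_kernel:
  assumes i: "i \<in> labellings" and r: "r \<in> space (label_space i)" and inj: "inj_on (snd r) {1..fst i}"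
    and w: "label_mass i r \<noteq> 0"
  shows "good (fst (reps (pattern (fst (label_point i r))))) (snd (label_point i r))"
    and "A \<in> sets (V) \<Longrightarrow>
      label_weight i r (indicator A) = label_mass i r * emeasure (kernel (label_point i r)) A"
proof -
  obtain k \<pi> where i_eq: "i = (k, \<pi>)" by (cases i)
  obtain u t where r_eq: "r = (u, t)" by (cases r)
  have \<pi>: "\<pi> \<in> obs_index \<rightarrow>\<^sub>E {1..k}" "\<pi> ` obs_index = {1..k}" using i by (auto simp: i_eq)
  have t: "t \<in> space (locs {1..k})" and t_inj: "inj_on t {1..k}"
    using r inj by (auto simp: i_eq r_eq space_pair_measure)
  have "aux_weight u \<noteq> 0" using w by (auto simp: label_weight_def r_eq)
  then have u: "0 < u j" if "j \<in> {1..d}" for j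
    by (rule aux_weight_nonzero[OF _ that])
  have "\<exists>N\<ge>k. 0 < pmf q N"
  proof (rule ccontr)
    assume "\<not> (\<exists>N\<ge>k. 0 < pmf q N)"
    then have "\<And>N. k \<le> N \<Longrightarrow> pmf q N = 0" by (meson pmf_pos)
    from post_mass_eq_0[OF this] show False using w by (simp add: label_weight_def i_eq r_eq)
  qed
  then obtain N where N: "k \<le> N" "0 < pmf q N" by auto
  let ?x = "data \<pi> t"
  have x: "?x \<in> space (obs_space d n P0)"
    using \<pi>(1) by (intro measurable_space[OF measurable_data t]) auto
  have x_at: "?x (fst l) (snd l) = t (\<pi> l)" if "l \<in> obs_index" for l
    using that by (cases l) (simp add: data_def)
  have "distinct_values d n ?x = t ` \<pi> ` obs_index"
    unfolding distinct_values_eq_image image_image by (intro image_cong refl x_at)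
  \<comment> \<open>Surjectivity of \<open>\<pi>\<close> enters here: every labelled atom is
    observed, so \<open>t\<close> enumerates the distinct values.\<close>
  then have b: "bij_betw t {1..k} (distinct_values d n ?x)"
    using t_inj \<pi>(2) by (simp add: bij_betw_def)
  have good: "good k u" using u N by (auto simp: good_def)
  then show "good (fst (reps (pattern (fst (label_point i r))))) (snd (label_point i r))"
    by (simp add: label_point_def i_eq r_eq fst_reps_pattern[OF b])
  assume A: "A \<in> sets (V)"
  have "kernel (?x, u) = post k (\<lambda>j a. group_count n ?x j (t a)) t u"
    by (rule kernel_eq[OF x b good])
  also have "\<dots> = post k (counts \<pi>) t u"
  proof (rule post_cong[OF refl])
    fix j a assume j: "j \<in> {1..d}" and a: "a \<in> {1..k}"
    have "?x j i = t a \<longleftrightarrow> \<pi> (j, i) = a" if "i \<in> {1..n j}" for i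
    proof -
      have l: "(j, i) \<in> obs_index" using j that by auto
      have "\<pi> (j, i) \<in> {1..k}" by (rule PiE_mem[OF \<pi>(1) l])
      then show ?thesis using x_at[OF l] inj_on_eq_iff[OF t_inj _ a] by simp
    qed
    then show "group_count n ?x j (t a) = counts \<pi> j a"
      unfolding group_count_def counts_def by (intro arg_cong[of _ _ card]) blast
  qed
  finally have "kernel (?x, u) = post k (counts \<pi>) t u" .
  moreover have "(\<integral>\<^sup>+ v. indicator A v \<partial>post k (counts \<pi>) t u) = emeasure (post k (counts \<pi>) t u) A"
    using A by (intro nn_integral_indicator) (simp add: post_def superposition_law_def)
  ultimately show "label_weight i r (indicator A) = label_mass i r * emeasure (kernel (label_point i r)) A"
    using post_mass_eq[where c = "counts \<pi>" and u = u, OF u t N borel_measurable_indicator[OF A]]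
    by (simp add: label_weight_def label_point_def i_eq r_eq mult.assoc)
qed

text \<open>For positive \<open>u\<close> and possible \<open>k\<close> the marginal mass is
  positive. If it vanishes, either \<open>aux_weight\<close> does or no number of components from
  \<open>k\<close> on has positive probability, and in both cases the joint mass vanishes as
  well.\<close>

lemma label_weight_eq_0:
  assumes i: "i \<in> labellings" and r: "r \<in> space (label_space i)"
    and w: "label_mass i r = 0" and A: "A \<in> sets (V)"
  shows "label_weight i r (indicator A) = 0"
proof (cases "aux_weight (fst r) = 0")
  case False
  then have "0 < fst r j" if "j \<in> {1..d}" for j
    by (rule aux_weight_nonzero[OF _ that])
  moreover have "post_mass (fst i) (counts (snd i)) (snd r) (fst r) (\<lambda>_. 1) = 0"
    using w False by (simp add: label_weight_def)
  moreover have "snd r \<in> space (locs {1..fst i})" using r by (auto simp: space_pair_measure)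
  ultimately have "\<And>N. fst i \<le> N \<Longrightarrow> pmf q N = 0"
    using post_mass_1_pos[of "fst r" "snd r" "fst i" _ "counts (snd i)"] by (metis less_irrefl pmf_pos)
  from post_mass_eq_0[OF this] show ?thesis by (simp add: label_weight_def)
qed (simp add: label_weight_def)

text \<open>Joint and marginal law are carried to the label spaces, where Bayes' formula holds at
  almost every point. The hypothesis on \<open>\<kappa>\<close> covers good observations only; that
  these have probability 1 is part of the proof.\<close>

theorem posterior:
  fixes M :: "'w measure" and \<mu> :: "'w \<Rightarrow> nat \<Rightarrow> 'a measure"
  assumes M: "prob_space M" and \<mu>: "\<mu> \<in> M \<rightarrow>\<^sub>M V"
    and prior: "distr M (V) \<mu> = prior"
    and sampling: "cond_law M Y_space Y (V) \<mu> (sampling_law d n)"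
    and \<kappa>: "\<And>x u. x \<in> space (obs_space d n P0) \<Longrightarrow> good (fst (reps (pattern x))) u \<Longrightarrow> \<kappa> (x, u) = kernel (x, u)"
  shows "cond_law M (V) \<mu> Y_space Y \<kappa>"
proof -
  from sampling obtain Ks where Y: "Y \<in> M \<rightarrow>\<^sub>M Y_space" and Ks: "Ks \<in> V \<rightarrow>\<^sub>M prob_algebra Y_space"
    and joint: "\<And>B A. B \<in> sets Y_space \<Longrightarrow> A \<in> sets V \<Longrightarrow> emeasure M {\<omega> \<in> space M. Y \<omega> \<in> B \<and> \<mu> \<omega> \<in> A}
      = (\<integral>\<^sup>+ v. emeasure (Ks v) B * indicator A v \<partial>prior)"
    and Ks_eq: "AE v in prior. Ks v = sampling_law d n v"
    unfolding cond_law_def prior by blast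
  have Ks_meas: "(\<lambda>v. emeasure (Ks v) B) \<in> borel_measurable V" if "B \<in> sets Y_space" for B
    using measurable_emeasure_kernel[OF measurable_prob_algebraD[OF Ks] that] .
  \<comment> \<open>\<open>Ks\<close> agrees with \<open>sampling_law\<close> only almost everywhere
    under the prior. The exceptional set is null for each number of components of positive
    probability, so the explicit formula may replace \<open>Ks\<close> term by term.\<close>
  have prior_integral: "(\<integral>\<^sup>+ v. f v * emeasure (Ks v) B \<partial>prior)
      = (\<Sum>i\<in>labellings. \<integral>\<^sup>+ r. label_weight i r f * indicator B (label_point i r) \<partial>label_space i)"
    if f: "f \<in> borel_measurable V" and B: "B \<in> sets Y_space" for f B
  proof -
    from AE_E[OF Ks_eq] obtain Z where Z: "{v \<in> space prior. \<not> Ks v = sampling_law d n v} \<subseteq> Z"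
      "emeasure prior Z = 0" "Z \<in> sets prior" .
    have Z': "Z \<in> sets V" using Z(3) by (simp add: sets_prior)
    let ?Z = "\<lambda>N. base {1..N} \<Otimes>\<^sub>M locs {1..N}"
    let ?at = "\<lambda>N z. atoms {1..N} (fst z) (snd z)"
    have at: "?at N \<in> ?Z N \<rightarrow>\<^sub>M V" for N
      using measurable_vec_atoms_pair[OF _ sets_base, of "{1..N}"] by (simp add: case_prod_beta')
    have "(\<Sum>N. ennreal (pmf q N) * (\<integral>\<^sup>+ z. indicator Z (?at N z) \<partial>(?Z N))) = 0"
      using nn_integral_prior[OF borel_measurable_indicator[OF Z']] Z by simp
    then have null: "ennreal (pmf q N) * (\<integral>\<^sup>+ z. indicator Z (?at N z) \<partial>(?Z N)) = 0" for N
      by (subst (asm) suminf_eq_zero_iff) auto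
    have "(\<integral>\<^sup>+ v. f v * emeasure (Ks v) B \<partial>prior)
        = (\<Sum>N. ennreal (pmf q N) * (\<integral>\<^sup>+ z. f (?at N z) * emeasure (Ks (?at N z)) B \<partial>(?Z N)))"
      by (rule nn_integral_prior) (intro borel_measurable_times_ennreal f Ks_meas B)
    also have "\<dots> = (\<Sum>N. ennreal (pmf q N) * (\<integral>\<^sup>+ z. f (?at N z) * emeasure (sampling_law d n (?at N z)) B \<partial>(?Z N)))"
    proof (rule suminf_cong)
      fix N
      show "ennreal (pmf q N) * (\<integral>\<^sup>+ z. f (?at N z) * emeasure (Ks (?at N z)) B \<partial>(?Z N))
          = ennreal (pmf q N) * (\<integral>\<^sup>+ z. f (?at N z) * emeasure (sampling_law d n (?at N z)) B \<partial>(?Z N))"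
      proof (cases "ennreal (pmf q N) = 0")
        case False
        then have "(\<integral>\<^sup>+ z. indicator Z (?at N z) \<partial>(?Z N)) = 0" using null[of N] by simp
        moreover have "(\<lambda>z. indicator Z (?at N z) :: ennreal) \<in> borel_measurable (?Z N)"
          by (rule measurable_compose[OF at borel_measurable_indicator[OF Z']])
        ultimately have "AE z in (?Z N). (indicator Z (?at N z) :: ennreal) = 0"
          by (simp add: nn_integral_0_iff_AE)
        then have "AE z in (?Z N). Ks (?at N z) = sampling_law d n (?at N z)"
          using AE_space
        proof eventually_elim
          case (elim z)
          have "?at N z \<in> space prior"
            using measurable_space[OF at elim(2)] sets_eq_imp_space_eq[OF sets_prior] by simp
          then show ?case using elim(1) Z(1) by (auto split: split_indicator_asm)
        qed
        then have "AE z in (?Z N). f (?at N z) * emeasure (Ks (?at N z)) B = f (?at N z) * emeasure (sampling_law d n (?at N z)) B"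
          by eventually_elim simp
        from nn_integral_cong_AE[OF this] show ?thesis by simp
      qed simp
    qed
    also have "\<dots> = (\<Sum>i\<in>labellings. \<integral>\<^sup>+ r. label_weight i r f * indicator B (label_point i r) \<partial>label_space i)"
      unfolding joint_formula[OF f B] label_weight_def label_point_def ..
    finally show ?thesis .
  qed
  let ?PY = "distr M Y_space Y"
  \<comment> \<open>The marginal law of the observations is the case \<open>f = 1\<close>.\<close>
  have PY: "emeasure ?PY B = (\<Sum>i\<in>labellings. \<integral>\<^sup>+ r. label_mass i r * indicator B (label_point i r) \<partial>label_space i)"
    if B: "B \<in> sets Y_space" for B
  proof -
    have "Y -` B \<inter> space M = {\<omega> \<in> space M. Y \<omega> \<in> B \<and> \<mu> \<omega> \<in> space V}"
      using measurable_space[OF \<mu>] by auto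
    then have "emeasure ?PY B = (\<integral>\<^sup>+ v. emeasure (Ks v) B * indicator (space V) v \<partial>prior)"
      using joint[OF B sets.top] by (simp add: emeasure_distr Y B)
    also have "\<dots> = (\<integral>\<^sup>+ v. 1 * emeasure (Ks v) B \<partial>prior)"
      using sets_eq_imp_space_eq[OF sets_prior] by (intro nn_integral_cong) simp
    finally show ?thesis using prior_integral[OF _ B, of "\<lambda>_. 1"] by simp
  qed
  have PY_integral: "(\<integral>\<^sup>+ y. g y \<partial>?PY) = (\<Sum>i\<in>labellings. \<integral>\<^sup>+ r. label_mass i r * g (label_point i r) \<partial>label_space i)"
    if "g \<in> borel_measurable Y_space" for g
    by (rule nn_integral_eq_sum_of_emeasure_eq_sum[OF finite_labellings _ measurable_label_point _ PY that])
      (auto intro: measurable_label_weight)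
  have K_joint: "emeasure M {\<omega> \<in> space M. \<mu> \<omega> \<in> A \<and> Y \<omega> \<in> B} = (\<integral>\<^sup>+ y. emeasure (kernel y) A * indicator B y \<partial>?PY)"
    if A: "A \<in> sets V" and B: "B \<in> sets Y_space" for A B
  proof -
    have "emeasure M {\<omega> \<in> space M. \<mu> \<omega> \<in> A \<and> Y \<omega> \<in> B} = (\<integral>\<^sup>+ v. indicator A v * emeasure (Ks v) B \<partial>prior)"
      using joint[OF B A] by (simp add: conj_commute mult.commute)
    also have "\<dots> = (\<Sum>i\<in>labellings. \<integral>\<^sup>+ r. label_weight i r (indicator A) * indicator B (label_point i r) \<partial>label_space i)"
      by (rule prior_integral[OF borel_measurable_indicator[OF A] B])
    also have "\<dots> = (\<Sum>i\<in>labellings. \<integral>\<^sup>+ r. label_mass i r *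
        (emeasure (kernel (label_point i r)) A * indicator B (label_point i r)) \<partial>label_space i)"
    \<comment> \<open>Diffuseness is used here: the integrands agree where the atoms are distinct,
      which is almost everywhere.\<close>
    proof (intro sum.cong refl nn_integral_cong_AE)
      fix i assume i: "i \<in> labellings"
      show "AE r in label_space i. label_weight i r (indicator A) * indicator B (label_point i r)
          = label_mass i r * (emeasure (kernel (label_point i r)) A * indicator B (label_point i r))"
        using AE_label_inj AE_space
      proof eventually_elim
        case (elim r)
        have "label_weight i r (indicator A) = label_mass i r * emeasure (kernel (label_point i r)) A"
        proof (cases "label_mass i r = 0")
          case False
          from label_kernel(2)[OF i elim(2,1) False A] show ?thesis .
        next
          case True
          then show ?thesis using label_weight_eq_0[OF i elim(2) True A] by simp
        qed
        then show ?case by (simp add: mult.assoc)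
      qed
    qed
    also have "\<dots> = (\<integral>\<^sup>+ y. emeasure (kernel y) A * indicator B y \<partial>?PY)"
      by (rule PY_integral[symmetric])
        (intro borel_measurable_times_ennreal borel_measurable_indicator B
          measurable_emeasure_kernel[OF measurable_prob_algebraD[OF measurable_kernel] A])
    finally show ?thesis .
  qed
  \<comment> \<open>A bad observation can only come from points of the label spaces with marginal
    mass 0 or with coinciding atoms, and neither contributes to its probability.\<close>
  have "AE y in ?PY. good (fst (reps (pattern (fst y)))) (snd y)"
  proof -
    let ?bad = "{y \<in> space Y_space. \<not> good (fst (reps (pattern (fst y)))) (snd y)}"
    have bad: "?bad \<in> sets Y_space"
      using pred_intros_logic(2)[OF measurable_good_pattern] by (simp add: pred_def)
    have "emeasure ?PY ?bad = 0"
      unfolding PY[OF bad]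
    proof (intro sum.neutral ballI)
      fix i assume i: "i \<in> labellings"
      have "(\<integral>\<^sup>+ r. label_mass i r * indicator ?bad (label_point i r) \<partial>label_space i) = (\<integral>\<^sup>+ r. 0 \<partial>label_space i)"
      proof (rule nn_integral_cong_AE)
        show "AE r in label_space i. label_mass i r * indicator ?bad (label_point i r) = 0"
          using AE_label_inj AE_space
        proof eventually_elim
          case (elim r)
          show ?case
            using label_kernel(1)[OF i elim(2,1)] by (cases "label_mass i r = 0") auto
        qed
      qed
      then show "(\<integral>\<^sup>+ r. label_mass i r * indicator ?bad (label_point i r) \<partial>label_space i) = 0"
        by simp
    qed
    then show ?thesis
      using bad by (intro AE_I[where N = ?bad]) auto
  qed
  then have "AE y in ?PY. kernel y = \<kappa> y"
    using AE_space
  proof eventually_elim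
    case (elim y)
    then show ?case using \<kappa>[of "fst y" "snd y"] by (auto simp: space_pair_measure)
  qed
  then show ?thesis
    unfolding cond_law_def using \<mu> Y measurable_kernel K_joint by blast
qed

end

theorem theorem3:
  fixes M :: "'w measure"
    and \<Theta> :: "(real ^ 's) set"
    and P0 :: "(real ^ 's) measure"
    and qM :: "nat pmf"
    and h :: "real \<Rightarrow> real \<Rightarrow> real"
    and \<gamma> :: "nat \<Rightarrow> real"
    and d :: nat
    and n :: "nat \<Rightarrow> nat"
    and \<mu> :: "'w \<Rightarrow> nat \<Rightarrow> (real ^ 's) measure"
    and \<theta> :: "'w \<Rightarrow> nat \<Rightarrow> nat \<Rightarrow> real ^ 's"
    and U :: "'w \<Rightarrow> nat \<Rightarrow> real"
    and K :: "(nat \<Rightarrow> nat \<Rightarrow> real ^ 's) \<Rightarrow> nat"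
    and \<theta>s :: "(nat \<Rightarrow> nat \<Rightarrow> real ^ 's) \<Rightarrow> nat \<Rightarrow> real ^ 's"
  assumes "d \<ge> 1"
    and "\<Theta> \<in> sets borel"
    and "prob_space P0" and "sets P0 = sets (restrict_space borel \<Theta>)"
    and diffuse: "\<And>x. x \<in> \<Theta> \<Longrightarrow> emeasure P0 {x} = 0"
    and "pmf qM 0 = 0"
    and "\<And>g. g > 0 \<Longrightarrow> pos_density (h g)"
    and "\<And>j. j \<in> {1..d} \<Longrightarrow> \<gamma> j > 0"
    and "\<And>j. j \<in> {1..d} \<Longrightarrow> n j \<ge> 1"
    and "prob_space M"
    and "\<mu> \<in> M \<rightarrow>\<^sub>M vec_measures d P0"
    and prior: "distr M (vec_measures d P0) \<mu>
           = vec_ifpp d qM (\<lambda>j. density lpos (\<lambda>s. ennreal (h (\<gamma> j) s))) P0"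
    and sampling: "cond_law M (obs_space d n P0 \<Otimes>\<^sub>M aux_space d) (\<lambda>\<omega>. (\<theta> \<omega>, U \<omega>))
           (vec_measures d P0) \<mu> (sampling_law d n)"
    and distinct: "\<And>x. x \<in> space (obs_space d n P0) \<Longrightarrow>
           K x = card (distinct_values d n x) \<and> bij_betw (\<theta>s x) {1..K x} (distinct_values d n x)"
  shows "cond_law M (vec_measures d P0) \<mu> (obs_space d n P0 \<Otimes>\<^sub>M aux_space d) (\<lambda>\<omega>. (\<theta> \<omega>, U \<omega>))
           (\<lambda>(x, u). superposition_law d P0
              (allocated_law d P0 (\<lambda>j. h (\<gamma> j)) (K x) (\<theta>s x)
                 (\<lambda>j k. group_count n x j (\<theta>s x k)) u)
              (vec_ifpp d (q_star d qM (\<lambda>j. h (\<gamma> j)) (K x) u) (\<lambda>j. H_star (h (\<gamma> j)) (u j)) P0))"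
proof -
  interpret vec_mixture_diffuse d n "\<lambda>j. h (\<gamma> j)" qM P0
  proof (intro vec_mixture_diffuse.intro vec_mixture.intro vec_mixture_diffuse_axioms.intro)
    have space: "space P0 = \<Theta>"
      using sets_eq_imp_space_eq[OF assms(4)] by (simp add: space_restrict_space)
    \<comment> \<open>\<open>P0\<close> carries the trace of the Borel sets, so inclusion into the
      Euclidean space is measurable; equality of two Borel maps into that space is a measurable
      event, which gives the diagonal.\<close>
    have "(\<lambda>x. x) \<in> borel_measurable P0"
      by (simp add: measurable_cong_sets[OF assms(4) refl] measurable_restrict_space1)
    then have "(\<lambda>z. fst z) \<in> borel_measurable (P0 \<Otimes>\<^sub>M P0)" "(\<lambda>z. snd z) \<in> borel_measurable (P0 \<Otimes>\<^sub>M P0)"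
      by (rule measurable_compose[OF measurable_fst], rule measurable_compose[OF measurable_snd])
    then show "Measurable.pred (P0 \<Otimes>\<^sub>M P0) (\<lambda>(x, y). x = y)"
      unfolding case_prod_beta' by measurable
    show "emeasure P0 {x} = 0" if "x \<in> space P0" for x
      using diffuse that space by simp
    show "pos_density (h (\<gamma> j))" if "j \<in> {1..d}" for j
      by (rule assms(7)[OF assms(8)[OF that]])
  qed fact+
  show ?thesis
  proof (rule posterior)
    show "distr M (vec_measures d P0) \<mu> = local.prior"
      using prior by (simp add: prior_def)
    fix x and u :: "nat \<Rightarrow> real"
    assume x: "x \<in> space (obs_space d n P0)" and g: "good (fst (reps (pattern x))) u"
    have b: "bij_betw (\<theta>s x) {1..K x} (distinct_values d n x)"
      by (rule conjunct2[OF distinct[OF x]])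
    show "(case (x, u) of (x, u) \<Rightarrow> superposition_law d P0
              (allocated_law d P0 (\<lambda>j. h (\<gamma> j)) (K x) (\<theta>s x)
                 (\<lambda>j k. group_count n x j (\<theta>s x k)) u)
              (vec_ifpp d (q_star d qM (\<lambda>j. h (\<gamma> j)) (K x) u) (\<lambda>j. H_star (h (\<gamma> j)) (u j)) P0)) = kernel (x, u)"
      \<comment> \<open>\<open>K x\<close> equals the number of representatives, as both count the
        distinct values; the claimed law is \<open>post\<close> at the enumeration
        \<open>\<theta>s x\<close>.\<close>
      using kernel_eq[OF x b] g by (simp add: fst_reps_pattern[OF b] post_def)
  qed fact+
qed

end
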